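(* Consider the following non-linear non-quadratic mean-field-free game with set of decision-makers $\mathcal{I}=\{1,\dots,I\}$. Decision-maker $i$ solves $\inf_{u_i}\mathbb{E}[L_i(x,u)]$ with $$L_i(x,u)=q_i(T,s(T))\ln^2(x(T))+\int_0^T\left(q_i\ln^2(x)+r_iu_i^2\right)dt,$$ subject to $$dx=\Big(b_1x\ln(x)+\sum_{j\in\mathcal{I}}b_{2j}xu_j\Big)dt,\qquad x(0)=x_0,\ s(0)=s_0,$$ $$\mathbb{P}(s(t+\epsilon)=s'\mid s,u)=\int_t^{t+\epsilon}\tilde q_{ss'}\,dt'+o(\epsilon),\quad s'\neq s.$$ Assume $x_0>e$, $q_i(t,s)\ge0$ and $r_i(t,s)>\delta>0$ for some constant $\delta$. Then the mean-field-free Nash equilibrium and the corresponding optimal costs are given by $$u_i^*=-\sum_{s\in\mathcal{S}}\mathbf 1_{\{s(t)=s\}}\frac{\alpha_ib_{2i}}{r_i}\ln(x),\qquad \mathbb{E}[L_i(x,u^* )]=\mathbb{E}[\alpha_i(0,s_0)\ln^2(x_0)],$$ where $\alpha_i=\alpha_i(t,s)$ satisfies $$\dot\alpha_i=-q_i-2b_1\alpha_i+2\alpha_i\sum_{j\in\mathcal{I}\setminus\{i\}}\alpha_j\frac{b_{2j}^2}{r_j}+\alpha_i^2\frac{b_{2i}^2}{r_i}-\sum_{s'\in\mathcal{S}}[\alpha_i(t,s')-\alpha_i(t,s)]\tilde q_{ss'},\qquad \alpha_i(T,s)=q_i(T,s).$$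
   Context: $T>0$ is a fixed horizon. $s(t)$ is a regime-switching process with values in a finite set $\mathcal{S}$ and rates $\tilde q_{ss'}>0$ for $s\ne s'$, $\tilde q_{ss}:=-\sum_{s'\ne s}\tilde q_{ss'}$. The coefficients $q_i,r_i,b_1,b_{2j}$ are real-valued and depend on $(t,s)$; inside the dynamics and cost they are evaluated at $(t,s(t))$. A dot denotes $\partial/\partial t$. All decision-makers observe the state and $s$. An admissible strategy $u_i$ is adapted to the underlying filtration; strategies are taken in state feedback form, depending on $(t,x(t),s(t))$. A Nash equilibrium is a profile $u^*=(u_i^* )_{i\in\mathcal{I}}$ such that for each $i$, $u_i^*$ minimizes $\mathbb{E}[L_i]$ over admissible $u_i$ when all others use the feedback strategies $u_j^*$, $j\neq i$. *)

theory Defs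
  imports "HOL-Probability.Probability"
begin

text \<open>
  Coefficients have type \<open>real \<Rightarrow> 's \<Rightarrow> real\<close> (time, regime); those of a single decision-maker carry
  the player index first. A feedback strategy maps (time, state, regime) to an action.
\<close>

definition filtered_prob_space :: "'a measure \<Rightarrow> (real \<Rightarrow> 'a measure) \<Rightarrow> bool" where
  "filtered_prob_space M F \<longleftrightarrow>
     prob_space M \<and> filtration (space M) F \<and> (\<forall>t. subalgebra M (F t))"

definition adapted_process ::
    "'a measure \<Rightarrow> (real \<Rightarrow> 'a measure) \<Rightarrow> real \<Rightarrow> (real \<Rightarrow> 'a \<Rightarrow> real) \<Rightarrow> bool" where
  "adapted_process M F T v \<longleftrightarrow>
     (\<forall>t\<in>{0..T}. v t \<in> borel_measurable (F t)) \<and>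
     (\<lambda>(t, \<omega>). v t \<omega>) \<in> borel_measurable (restrict_space borel {0..T} \<Otimes>\<^sub>M M)"

text \<open>
  The conditional switching probability is taken given the whole past \<open>F t\<close>, so given the past of
  the regime and of every adapted control. The remainder \<open>o(\<epsilon>)\<close> is understood uniformly in \<open>t\<close>:
  with a remainder that depends on \<open>t\<close>, the condition would not exclude an additional jump
  at a deterministic time.
\<close>

definition regime_switching ::
    "'a measure \<Rightarrow> (real \<Rightarrow> 'a measure) \<Rightarrow> real \<Rightarrow> ('s::finite \<Rightarrow> 's \<Rightarrow> real) \<Rightarrow> ('a \<Rightarrow> 's) \<Rightarrow>
     (real \<Rightarrow> 'a \<Rightarrow> 's) \<Rightarrow> bool" where
  "regime_switching M F T rate s0 s \<longleftrightarrow>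
     (\<forall>t\<in>{0..T}. s t \<in> measurable (F t) (count_space UNIV)) \<and>
     (\<forall>\<omega>\<in>space M. s 0 \<omega> = s0 \<omega>) \<and>
     (\<forall>\<omega>\<in>space M. \<forall>t\<in>{0..<T}. \<forall>\<^sub>F t' in at_right t. s t' \<omega> = s t \<omega>) \<and>
     (\<forall>a b. a \<noteq> b \<longrightarrow> (\<forall>\<eta>>0. \<exists>\<epsilon>0>0. \<forall>t \<epsilon>. 0 \<le> t \<longrightarrow> 0 < \<epsilon> \<longrightarrow> \<epsilon> < \<epsilon>0 \<longrightarrow> t + \<epsilon> \<le> T \<longrightarrow>
        (AE \<omega> in M. s t \<omega> = a \<longrightarrow>
           \<bar>real_cond_exp M (F t) (indicat_real {\<omega>' \<in> space M. s (t + \<epsilon>) \<omega>' = b}) \<omega>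
             - (LINT t':{t..t + \<epsilon>}|lborel. rate a b)\<bar> \<le> \<eta> * \<epsilon>)))"

definition drift ::
    "nat \<Rightarrow> (real \<Rightarrow> 's \<Rightarrow> real) \<Rightarrow> (nat \<Rightarrow> real \<Rightarrow> 's \<Rightarrow> real) \<Rightarrow> real \<Rightarrow> 's \<Rightarrow> real \<Rightarrow> (nat \<Rightarrow> real) \<Rightarrow> real"
  where
  "drift I b1 b2 t a x v = b1 t a * x * ln x + (\<Sum>j\<in>{1..I}. b2 j t a * x * v j)"

text \<open>The state equation is read in integrated (Caratheodory) form, on the domain of \<open>ln\<close>.\<close>

definition trajectory ::
    "'a measure \<Rightarrow> (real \<Rightarrow> 'a measure) \<Rightarrow> real \<Rightarrow> nat \<Rightarrow> (real \<Rightarrow> 's \<Rightarrow> real) \<Rightarrow>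
     (nat \<Rightarrow> real \<Rightarrow> 's \<Rightarrow> real) \<Rightarrow> (real \<Rightarrow> 'a \<Rightarrow> 's) \<Rightarrow> ('a \<Rightarrow> real) \<Rightarrow>
     (nat \<Rightarrow> real \<Rightarrow> 'a \<Rightarrow> real) \<Rightarrow> (real \<Rightarrow> 'a \<Rightarrow> real) \<Rightarrow> bool" where
  "trajectory M F T I b1 b2 s x0 v x \<longleftrightarrow>
     (\<forall>j\<in>{1..I}. adapted_process M F T (v j)) \<and>
     adapted_process M F T x \<and>
     (AE \<omega> in M.
        set_integrable lborel {0..T} (\<lambda>t. drift I b1 b2 t (s t \<omega>) (x t \<omega>) (\<lambda>j. v j t \<omega>)) \<and>
        (\<forall>t\<in>{0..T}. 0 < x t \<omega> \<and>
           x t \<omega> = x0 \<omega> +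
             (LINT t':{0..t}|lborel. drift I b1 b2 t' (s t' \<omega>) (x t' \<omega>) (\<lambda>j. v j t' \<omega>))))"

text \<open>
  The weights are nonnegative wherever this is used, so \<open>ennreal\<close> truncates nothing and the
  expectation is defined, possibly infinite, for every adapted control.
\<close>

definition expected_cost ::
    "'a measure \<Rightarrow> real \<Rightarrow> (real \<Rightarrow> 's \<Rightarrow> real) \<Rightarrow> (real \<Rightarrow> 's \<Rightarrow> real) \<Rightarrow> (real \<Rightarrow> 'a \<Rightarrow> 's) \<Rightarrow>
     (real \<Rightarrow> 'a \<Rightarrow> real) \<Rightarrow> (real \<Rightarrow> 'a \<Rightarrow> real) \<Rightarrow> ennreal" where
  "expected_cost M T qi ri s x w =
     (\<integral>\<^sup>+\<omega>. ennreal (qi T (s T \<omega>) * (ln (x T \<omega>))\<^sup>2) +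
        (\<integral>\<^sup>+t\<in>{0..T}. ennreal (qi t (s t \<omega>) * (ln (x t \<omega>))\<^sup>2 + ri t (s t \<omega>) * (w t \<omega>)\<^sup>2) \<partial>lborel) \<partial>M)"

definition feedback_control ::
    "(nat \<Rightarrow> real \<Rightarrow> real \<Rightarrow> 's \<Rightarrow> real) \<Rightarrow> (real \<Rightarrow> 'a \<Rightarrow> 's) \<Rightarrow> (real \<Rightarrow> 'a \<Rightarrow> real) \<Rightarrow>
     nat \<Rightarrow> real \<Rightarrow> 'a \<Rightarrow> real" where
  "feedback_control \<phi> s x j t \<omega> = \<phi> j t (x t \<omega>) (s t \<omega>)"

text \<open>
  A deviating player may use any adapted process \<open>w\<close>; the others keep their feedback laws, which
  then react to the state \<open>y\<close> resulting from the deviation. Well-posedness of the closed loop is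
  part of the definition.
\<close>

definition feedback_nash ::
    "'a measure \<Rightarrow> (real \<Rightarrow> 'a measure) \<Rightarrow> real \<Rightarrow> nat \<Rightarrow> (real \<Rightarrow> 's \<Rightarrow> real) \<Rightarrow>
     (nat \<Rightarrow> real \<Rightarrow> 's \<Rightarrow> real) \<Rightarrow> (nat \<Rightarrow> real \<Rightarrow> 's \<Rightarrow> real) \<Rightarrow> (nat \<Rightarrow> real \<Rightarrow> 's \<Rightarrow> real) \<Rightarrow>
     (real \<Rightarrow> 'a \<Rightarrow> 's) \<Rightarrow> ('a \<Rightarrow> real) \<Rightarrow> (nat \<Rightarrow> real \<Rightarrow> real \<Rightarrow> 's \<Rightarrow> real) \<Rightarrow> bool" where
  "feedback_nash M F T I b1 b2 q r s x0 \<phi> \<longleftrightarrow>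
     (\<exists>x. trajectory M F T I b1 b2 s x0 (feedback_control \<phi> s x) x) \<and>
     (\<forall>x. trajectory M F T I b1 b2 s x0 (feedback_control \<phi> s x) x \<longrightarrow>
       (\<forall>i\<in>{1..I}. \<forall>w y.
          trajectory M F T I b1 b2 s x0 ((feedback_control \<phi> s y)(i := w)) y \<longrightarrow>
          expected_cost M T (q i) (r i) s x (feedback_control \<phi> s x i)
            \<le> expected_cost M T (q i) (r i) s y w))"

end

theory Submission
  imports Defs
begin

text \<open>
  In the variable \<open>z = ln x\<close> the state equation is linear, \<open>z' = b\<^sub>1 z + (\<Sum>j. b\<^sub>2\<^sub>j u\<^sub>j)\<close>, and the
  costs are quadratic in \<open>z\<close> and in the controls: the game is linear-quadratic with regime-switching
  coefficients. The value of player \<open>i\<close> is \<open>\<alpha>\<^sub>i(t, s(t)) z(t)\<^sup>2\<close>. Suppose that the others play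
  \<open>u\<^sub>j = - gain\<^sub>j z\<close> with \<open>gain\<^sub>j = \<alpha>\<^sub>j b\<^sub>2\<^sub>j / r\<^sub>j\<close> and that player \<open>i\<close> plays an arbitrary \<open>w\<close>. The Riccati
  equation says exactly that the expected rate of change of the value is
  \<open>r\<^sub>i (w + gain\<^sub>i z)\<^sup>2 - (q\<^sub>i z\<^sup>2 + r\<^sub>i w\<^sup>2)\<close> (lemma \<open>completing_the_square\<close>), whence
  \<open>E cost(w) = E \<alpha>\<^sub>i(0, s\<^sub>0) ln\<^sup>2 x\<^sub>0 + E \<integral> r\<^sub>i (w + gain\<^sub>i z)\<^sup>2 dt\<close> (lemmas \<open>cost_identity\<close> and
  \<open>localized_cost\<close>). The last term is nonnegative and vanishes for \<open>w = - gain\<^sub>i z\<close>. This gives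
  the equilibrium property and its cost at once.

  The passage from rates of change to expectations is a Dynkin formula. The state has absolutely
  continuous paths and the regime is known only through its conditional switching probabilities
  over short intervals, so neither a martingale problem nor the jump times are at hand.
  Instead, \<open>dynkin_formula\<close> compares both sides of the formula over short intervals: they
  differ by at most \<open>e\<close> times the increment of a fixed function, for every \<open>e > 0\<close>, and this forces
  equality (lemma \<open>constant_if_locally_small_increments\<close>). The same principle yields the chain rule
  for absolutely continuous functions, without differentiating them almost everywhere.

  Integrability needs an argument because \<open>ln x\<^sub>0\<close> need not be square integrable and a deviation need not
  have finite cost. Everything is first restricted to an event \<open>A\<close> of \<open>F 0\<close> on which \<open>ln x\<^sub>0\<close> is bounded.
  If the cost of \<open>w\<close> on \<open>A\<close> is finite, \<open>r\<^sub>i > \<delta>\<close> makes \<open>\<integral> w\<^sup>2\<close> integrable there, and Gronwall's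
  inequality bounds \<open>z\<^sup>2\<close> on the whole horizon by a multiple of \<open>z(0)\<^sup>2 + \<integral> w\<^sup>2\<close>
  (lemma \<open>z_square_bound\<close>); no stopping times are involved. The bound on \<open>ln x\<^sub>0\<close> is then sent to infinity.

  Two further facts come out of the Riccati equation. The weight \<open>q\<^sub>i\<close> is integrable because it is
  nonnegative and differs from the derivative of \<open>- \<alpha>\<^sub>i\<close> by an integrable function
  (lemma \<open>primitive_on_if_derivative_le\<close>). And \<open>\<alpha>\<^sub>i(0, s\<^sub>0) \<ge> 0\<close> holds almost surely because the
  cost identity on the event \<open>\<alpha>\<^sub>i(0, s\<^sub>0) < 0\<close> would otherwise equate a nonnegative cost with a negative
  value (lemma \<open>\<alpha>_initial_nonneg\<close>).
\<close>

section \<open>Absolutely continuous functions on an interval\<close>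

text \<open>
  Absolute continuity in its integrated form. The derivative \<open>f\<close> is part of the data and is
  relevant only up to null sets, as in a Caratheodory solution of a differential equation.
\<close>

definition primitive_on :: "real \<Rightarrow> (real \<Rightarrow> real) \<Rightarrow> (real \<Rightarrow> real) \<Rightarrow> bool" where
  "primitive_on T f B \<longleftrightarrow> set_integrable lborel {0..T} f \<and>
     (\<forall>t\<in>{0..T}. B t = B 0 + (LBINT u:{0..t}. f u))"

lemma primitive_onD:
  assumes "primitive_on T f B"
  shows "set_integrable lborel {0..T} f"
    and "t \<in> {0..T} \<Longrightarrow> B t = B 0 + (LBINT u:{0..t}. f u)"
  using assms unfolding primitive_on_def by blast+

text \<open>
  On a partition of mesh below \<open>d\<close> the bounds on the increments telescope to
  \<open>\<bar>h b - h a\<bar> \<le> e * (K b - K a)\<close>, and \<open>e\<close> is arbitrary. Since \<open>K\<close> is any function, error terms may be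
  proportional to the integral of an unbounded function and not only to the length of the interval.
\<close>

lemma constant_if_locally_small_increments:
  fixes h K :: "real \<Rightarrow> real"
  assumes "a \<le> b"
    and small: "\<And>e. 0 < e \<Longrightarrow> \<exists>d>0. \<forall>s t. a \<le> s \<longrightarrow> s < t \<longrightarrow> t \<le> b \<longrightarrow> t - s < d \<longrightarrow>
      \<bar>h t - h s\<bar> \<le> e * (K t - K s)"
  shows "h b = h a"
proof (cases "a = b")
  case False
  with \<open>a \<le> b\<close> have "a < b" by simp
  have bound: "\<bar>h b - h a\<bar> \<le> e * (K b - K a)" if "0 < e" for e
  proof -
    obtain d where "0 < d" and d: "\<And>s t. a \<le> s \<Longrightarrow> s < t \<Longrightarrow> t \<le> b \<Longrightarrow> t - s < d \<Longrightarrow>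
      \<bar>h t - h s\<bar> \<le> e * (K t - K s)"
      using small[OF \<open>0 < e\<close>] by blast
    \<comment> \<open>the number of cells of the partition\<close>
    obtain n :: nat where n: "(b - a) / d < real n"
      using reals_Archimedean2 by blast
    with \<open>0 < d\<close> \<open>a < b\<close> have "0 < n"
      by (smt (verit, best) divide_pos_pos of_nat_0_less_iff)
    define c where "c k = a + real k * ((b - a) / real n)" for k
    have step: "c (Suc k) - c k = (b - a) / real n" for k
      by (simp add: c_def distrib_right del: times_divide_eq_right)
    have pos: "0 < (b - a) / real n"
      using \<open>a < b\<close> \<open>0 < n\<close> by simp
    have len: "(b - a) / real n < d"
      using n \<open>0 < d\<close> \<open>0 < n\<close> by (simp add: field_simps)
    have c0: "c 0 = a" and cn: "c n = b"
      using \<open>0 < n\<close> by (simp_all add: c_def)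
    have mono: "c k \<le> c m" if "k \<le> m" for k m
      using mult_right_mono[of "real k" "real m" "(b - a) / real n"] that pos
      by (simp add: c_def del: times_divide_eq_right)
    have "\<bar>h (c k) - h (c 0)\<bar> \<le> e * (K (c k) - K (c 0))" if "k \<le> n" for k
      using that
    proof (induction k)
      case (Suc k)
      have "\<bar>h (c (Suc k)) - h (c k)\<bar> \<le> e * (K (c (Suc k)) - K (c k))"
        using mono[of 0 k] mono[of "Suc k" n] Suc.prems step[of k] pos len
        by (intro d) (simp_all add: c0 cn)
      moreover have "\<bar>h (c k) - h (c 0)\<bar> \<le> e * (K (c k) - K (c 0))"
        using Suc by simp
      ultimately show ?case
        by (simp add: algebra_simps)
    qed simp
    from this[of n] show ?thesis
      by (simp add: c0 cn)
  qed
  have "\<bar>h b - h a\<bar> \<le> 0"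
  proof (rule field_le_epsilon)
    fix e :: real assume "0 < e"
    have "0 < e / (\<bar>K b - K a\<bar> + 1)"
      using \<open>0 < e\<close> by simp
    from bound[OF this] have "\<bar>h b - h a\<bar> \<le> e / (\<bar>K b - K a\<bar> + 1) * (K b - K a)" .
    also have "\<dots> \<le> e / (\<bar>K b - K a\<bar> + 1) * (\<bar>K b - K a\<bar> + 1)"
      using \<open>0 < e\<close> by (intro mult_left_mono) auto
    finally show "\<bar>h b - h a\<bar> \<le> 0 + e" by simp
  qed
  then show ?thesis by simp
qed simp

lemma set_integral_split_Ioc:
  fixes f :: "real \<Rightarrow> real"
  assumes "set_integrable lborel {0..T} f" "0 \<le> s" "s \<le> t" "t \<le> T"
  shows "(LBINT u:{0..t}. f u) = (LBINT u:{0..s}. f u) + (LBINT u:{s<..t}. f u)"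
proof -
  have "{0..t} = {0..s} \<union> {s<..t}" using assms by auto
  moreover have "set_integrable lborel {0..s} f" "set_integrable lborel {s<..t} f"
    using assms by (auto intro: set_integrable_subset)
  moreover have "{0..s} \<inter> {s<..t} = {}" by auto
  ultimately show ?thesis
    using set_integral_Un by metis
qed

lemma primitive_on_increment:
  assumes "primitive_on T f B" "0 \<le> s" "s \<le> t" "t \<le> T"
  shows "B t - B s = (LBINT u:{s<..t}. f u)"
  using set_integral_split_Ioc[OF primitive_onD(1)[OF assms(1)] assms(2-)]
    primitive_onD(2)[OF assms(1), of t] primitive_onD(2)[OF assms(1), of s] assms(2-) by simp

lemma continuous_on_primitive:
  assumes "primitive_on T f B"
  shows "continuous_on {0..T} B"
proof -
  have int: "f integrable_on {0..T}"
    using assms set_borel_integral_eq_integral(1)[of "{0..T}" f]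
    unfolding primitive_on_def by blast
  have "B t = B 0 + integral {0..t} f" if "t \<in> {0..T}" for t
  proof -
    have "set_integrable lborel {0..t} f"
      using primitive_onD(1)[OF assms] that by (auto intro: set_integrable_subset)
    from set_borel_integral_eq_integral(2)[OF this] show ?thesis
      using primitive_onD(2)[OF assms that] by simp
  qed
  moreover have "continuous_on {0..T} (\<lambda>t. B 0 + integral {0..t} f)"
    by (intro continuous_intros indefinite_integral_continuous_1 int)
  ultimately show ?thesis
    using continuous_on_cong by (metis (no_types, lifting))
qed

lemma primitive_on_indefinite_integral:
  assumes "set_integrable lborel {0..T} f"
  shows "primitive_on T f (\<lambda>t. C + (LBINT u:{0..t}. f u))"
proof -
  have "(LBINT u:{0..0}. f u) = 0"
    by (simp add: set_integral_at_point)
  with assms show ?thesis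
    unfolding primitive_on_def by (metis add.right_neutral)
qed

text \<open>
  Absolute continuity of the integral on intervals, as the uniform continuity of a primitive.
\<close>

lemma set_integral_uniformly_small:
  fixes f :: "real \<Rightarrow> real"
  assumes "set_integrable lborel {0..T} f" "0 < e"
  shows "\<exists>d>0. \<forall>s t. 0 \<le> s \<longrightarrow> s \<le> t \<longrightarrow> t \<le> T \<longrightarrow> t - s < d \<longrightarrow> \<bar>LBINT u:{s<..t}. f u\<bar> < e"
proof -
  define B where "B t = 0 + (LBINT u:{0..t}. f u)" for t
  have prim: "primitive_on T f B"
    unfolding B_def using assms(1) by (rule primitive_on_indefinite_integral)
  have "uniformly_continuous_on {0..T} B"
    by (intro compact_uniformly_continuous continuous_on_primitive[OF prim]) auto
  then obtain d where "0 < d" and d: "\<And>s t. s \<in> {0..T} \<Longrightarrow> t \<in> {0..T} \<Longrightarrow> dist t s < d \<Longrightarrow> dist (B t) (B s) < e"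
    using \<open>0 < e\<close> unfolding uniformly_continuous_on_def by metis
  have "\<bar>LBINT u:{s<..t}. f u\<bar> < e" if "0 \<le> s" "s \<le> t" "t \<le> T" "t - s < d" for s t
  proof -
    have "\<bar>B t - B s\<bar> < e"
      using d[of s t] that by (auto simp: dist_real_def)
    then show ?thesis
      using primitive_on_increment[OF prim that(1,2,3)] by simp
  qed
  with \<open>0 < d\<close> show ?thesis by blast
qed

lemma set_integrable_continuous_mult:
  fixes g f :: "real \<Rightarrow> real"
  assumes g: "continuous_on {0..T} g" and f: "set_integrable lborel {0..T} f"
  shows "set_integrable lborel {0..T} (\<lambda>u. g u * f u)"
proof -
  have "bounded (g ` {0..T})"
    using g by (intro compact_imp_bounded compact_continuous_image) auto
  then obtain C where C: "\<And>u. u \<in> {0..T} \<Longrightarrow> \<bar>g u\<bar> \<le> C"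
    by (force simp: bounded_iff)
  have mg: "set_borel_measurable lborel {0..T} g"
    using g borel_measurable_continuous_on_indicator[of "{0..T}" g] by (simp add: set_borel_measurable_def)
  have mf: "set_borel_measurable lborel {0..T} f"
    using f by (simp add: set_integrable_def set_borel_measurable_def)
  have meas: "set_borel_measurable lborel {0..T} (\<lambda>u. g u * f u)"
  proof -
    have "(\<lambda>u. (indicator {0..T} u *\<^sub>R g u) * (indicator {0..T} u *\<^sub>R f u)) \<in> borel_measurable lborel"
      using mg mf unfolding set_borel_measurable_def by (rule borel_measurable_times)
    also have "(\<lambda>u. (indicator {0..T} u *\<^sub>R g u) * (indicator {0..T} u *\<^sub>R f u)) =
       (\<lambda>u. indicator {0..T} u *\<^sub>R (g u * f u))"
      by (auto simp: indicator_def)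
    finally show ?thesis unfolding set_borel_measurable_def .
  qed
  have int: "set_integrable lborel {0..T} (\<lambda>u. C * f u)"
    using f by simp
  have "norm (g u * f u) \<le> norm (C * f u)" if "u \<in> {0..T}" for u
    using mult_right_mono[of "\<bar>g u\<bar>" "\<bar>C\<bar>" "\<bar>f u\<bar>"] C[OF that] by (simp add: abs_mult)
  then have AE: "AE u in lborel. u \<in> {0..T} \<longrightarrow> norm (g u * f u) \<le> norm (C * f u)"
    by (intro AE_I2) blast
  show ?thesis
    by (rule set_integrable_bound[OF int meas AE])
qed

text \<open>
  The mean value theorem gives \<open>\<phi> (B t) - \<phi> (B s) = \<phi>' (B v) * (B t - B s)\<close>, where the intermediate
  point is itself a value \<open>B v\<close> by continuity. Uniform continuity of \<open>\<phi>' \<circ> B\<close> makes the difference from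
  the integral of \<open>\<phi>' (B u) * f u\<close> at most \<open>e\<close> times the integral of \<open>\<bar>f\<bar>\<close>.
\<close>

lemma primitive_on_compose:
  assumes B: "primitive_on T f B" and "0 \<le> T"
    and deriv: "\<And>t. t \<in> {0..T} \<Longrightarrow> (\<phi> has_real_derivative \<phi>' (B t)) (at (B t))"
    and cont: "continuous_on (B ` {0..T}) \<phi>'"
  shows "primitive_on T (\<lambda>t. \<phi>' (B t) * f t) (\<lambda>t. \<phi> (B t))"
proof -
  have contB: "continuous_on {0..T} B"
    using B by (rule continuous_on_primitive)
  have int_f: "set_integrable lborel {0..T} f"
    using B by (simp add: primitive_on_def)
  have cont': "continuous_on {0..T} (\<lambda>t. \<phi>' (B t))"
    using continuous_on_compose2[OF cont contB] by simp
  then have int: "set_integrable lborel {0..T} (\<lambda>t. \<phi>' (B t) * f t)"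
    using int_f by (rule set_integrable_continuous_mult)
  define h where "h t = \<phi> (B t) - (LBINT u:{0..t}. \<phi>' (B u) * f u)" for t
  define K where "K t = 0 + (LBINT u:{0..t}. \<bar>f u\<bar>)" for t
  have K: "primitive_on T (\<lambda>u. \<bar>f u\<bar>) K"
    unfolding K_def by (intro primitive_on_indefinite_integral set_integrable_abs int_f)
  have local: "\<exists>d>0. \<forall>s t. 0 \<le> s \<longrightarrow> s < t \<longrightarrow> t \<le> T \<longrightarrow> t - s < d \<longrightarrow> \<bar>h t - h s\<bar> \<le> e * (K t - K s)"
    if "0 < e" for e
  proof -
    have "uniformly_continuous_on {0..T} (\<lambda>t. \<phi>' (B t))"
      using cont' by (intro compact_uniformly_continuous) auto
    then obtain d where "0 < d" and d: "\<And>u v. u \<in> {0..T} \<Longrightarrow> v \<in> {0..T} \<Longrightarrow> dist u v < d \<Longrightarrow>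
        dist (\<phi>' (B u)) (\<phi>' (B v)) < e"
      using \<open>0 < e\<close> unfolding uniformly_continuous_on_def by metis
    have "\<bar>h t - h s\<bar> \<le> e * (K t - K s)" if st: "0 \<le> s" "s < t" "t \<le> T" "t - s < d" for s t
    proof -
      have sub: "{s..t} \<subseteq> {0..T}" using st by auto
      have ivt: "\<exists>v\<in>{s..t}. B v = \<xi>" if "\<xi> \<in> closed_segment (B s) (B t)" for \<xi>
      proof -
        have "connected (B ` {s..t})"
          using contB sub by (intro connected_continuous_image) (auto intro: continuous_on_subset)
        then have "convex (B ` {s..t})"
          by (metis is_interval_connected_1 is_interval_convex_1)
        then have "closed_segment (B s) (B t) \<subseteq> B ` {s..t}"
          using st by (intro closed_segment_subset) auto
        then show ?thesis using that by auto
      qed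
      have "\<exists>v\<in>{s..t}. \<phi> (B t) - \<phi> (B s) = \<phi>' (B v) * (B t - B s)"
      proof -
        have dd: "(\<phi> has_real_derivative \<phi>' \<xi>) (at \<xi>)" if "\<xi> \<in> closed_segment (B s) (B t)" for \<xi>
          using ivt[OF that] deriv sub by auto
        consider "B s < B t" | "B s = B t" | "B t < B s" by linarith
        then show ?thesis
        proof cases
          case 1
          from MVT2[OF 1, of \<phi> \<phi>'] dd obtain \<xi> where "B s < \<xi>" "\<xi> < B t"
             "\<phi> (B t) - \<phi> (B s) = (B t - B s) * \<phi>' \<xi>"
            by (auto simp: closed_segment_eq_real_ivl)
          moreover from this ivt[of \<xi>] obtain v where "v \<in> {s..t}" "B v = \<xi>"
            by (auto simp: closed_segment_eq_real_ivl)
          ultimately show ?thesis by auto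
        next
          case 2
          with st show ?thesis by auto
        next
          case 3
          from MVT2[OF 3, of \<phi> \<phi>'] dd obtain \<xi> where "B t < \<xi>" "\<xi> < B s"
             "\<phi> (B s) - \<phi> (B t) = (B s - B t) * \<phi>' \<xi>"
            by (auto simp: closed_segment_eq_real_ivl)
          moreover from this ivt[of \<xi>] obtain v where "v \<in> {s..t}" "B v = \<xi>"
            by (auto simp: closed_segment_eq_real_ivl)
          ultimately show ?thesis by (intro bexI[of _ v]) (auto simp: algebra_simps)
        qed
      qed
      then obtain v where v: "v \<in> {s..t}" "\<phi> (B t) - \<phi> (B s) = \<phi>' (B v) * (B t - B s)" by blast
      have i1: "set_integrable lborel {s<..t} f" "set_integrable lborel {s<..t} (\<lambda>t. \<phi>' (B t) * f t)"
        using st int_f int by (auto intro: set_integrable_subset)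
      have "h t - h s = \<phi>' (B v) * (LBINT u:{s<..t}. f u) - (LBINT u:{s<..t}. \<phi>' (B u) * f u)"
        unfolding h_def using v(2) primitive_on_increment[OF B, of s t] st
          set_integral_split_Ioc[OF int, of s t] by simp
      also have "\<dots> = (LBINT u:{s<..t}. (\<phi>' (B v) - \<phi>' (B u)) * f u)"
        using i1 by (simp add: left_diff_distrib)
      finally have "\<bar>h t - h s\<bar> = \<bar>LBINT u:{s<..t}. (\<phi>' (B v) - \<phi>' (B u)) * f u\<bar>" by simp
      also have "\<dots> \<le> (LBINT u:{s<..t}. e * \<bar>f u\<bar>)"
      proof -
        have "set_integrable lborel {s<..t} (\<lambda>u. \<phi>' (B v) * f u - \<phi>' (B u) * f u)"
          using i1 by (intro set_integral_diff) auto
        then have i2: "set_integrable lborel {s<..t} (\<lambda>u. (\<phi>' (B v) - \<phi>' (B u)) * f u)"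
          by (simp add: left_diff_distrib)
        have "\<bar>LBINT u:{s<..t}. (\<phi>' (B v) - \<phi>' (B u)) * f u\<bar>
            \<le> (LBINT u:{s<..t}. \<bar>(\<phi>' (B v) - \<phi>' (B u)) * f u\<bar>)"
          using integral_abs_bound[of lborel "\<lambda>u. indicator {s<..t} u *\<^sub>R ((\<phi>' (B v) - \<phi>' (B u)) * f u)"]
          unfolding set_lebesgue_integral_def by (simp add: abs_mult)
        also have "\<dots> \<le> (LBINT u:{s<..t}. e * \<bar>f u\<bar>)"
        proof (rule set_integral_mono)
          show "set_integrable lborel {s<..t} (\<lambda>u. \<bar>(\<phi>' (B v) - \<phi>' (B u)) * f u\<bar>)"
            using i2 by (rule set_integrable_abs)
          show "set_integrable lborel {s<..t} (\<lambda>u. e * \<bar>f u\<bar>)"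
            using set_integrable_abs[OF i1(1)] by simp
          fix u assume u: "u \<in> {s<..t}"
          have "dist (\<phi>' (B v)) (\<phi>' (B u)) < e"
            using v(1) u st by (intro d) (auto simp: dist_real_def)
          then show "\<bar>(\<phi>' (B v) - \<phi>' (B u)) * f u\<bar> \<le> e * \<bar>f u\<bar>"
            unfolding abs_mult dist_real_def by (intro mult_right_mono) auto
        qed
        finally show ?thesis .
      qed
      also have "\<dots> = e * (K t - K s)"
        using primitive_on_increment[OF K, of s t] st by simp
      finally show ?thesis .
    qed
    with \<open>0 < d\<close> show ?thesis by blast
  qed
  have const: "h t = h 0" if "t \<in> {0..T}" for t
  proof (rule constant_if_locally_small_increments[of 0 t h K])
    fix e :: real assume "0 < e"
    from local[OF this] show "\<exists>d>0. \<forall>s ta. 0 \<le> s \<longrightarrow> s < ta \<longrightarrow> ta \<le> t \<longrightarrow> ta - s < d \<longrightarrow>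
       \<bar>h ta - h s\<bar> \<le> e * (K ta - K s)"
      using that by (meson atLeastAtMost_iff order_trans)
  qed (use that in auto)
  have "h 0 = \<phi> (B 0)"
    unfolding h_def by (simp add: set_integral_at_point)
  then have "\<phi> (B t) = \<phi> (B 0) + (LBINT u:{0..t}. \<phi>' (B u) * f u)" if "t \<in> {0..T}" for t
    using const[OF that] unfolding h_def by linarith
  with int show ?thesis
    unfolding primitive_on_def by blast
qed

lemma primitive_on_add:
  assumes "primitive_on T f B" "primitive_on T g C"
  shows "primitive_on T (\<lambda>t. f t + g t) (\<lambda>t. B t + C t)"
  unfolding primitive_on_def
proof (intro conjI ballI)
  show "set_integrable lborel {0..T} (\<lambda>t. f t + g t)"
    using assms[THEN primitive_onD(1)] by (rule set_integral_add(1))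
  fix t assume t: "t \<in> {0..T}"
  then have "set_integrable lborel {0..t} f" "set_integrable lborel {0..t} g"
    using assms[THEN primitive_onD(1)] by (auto intro: set_integrable_subset)
  then have "(LBINT u:{0..t}. f u + g u) = (LBINT u:{0..t}. f u) + (LBINT u:{0..t}. g u)"
    by (rule set_integral_add(2))
  then show "B t + C t = B 0 + C 0 + (LBINT u:{0..t}. f u + g u)"
    using primitive_onD(2)[OF assms(1) t] primitive_onD(2)[OF assms(2) t] by linarith
qed

lemma primitive_on_cmult:
  assumes "primitive_on T f B"
  shows "primitive_on T (\<lambda>t. c * f t) (\<lambda>t. c * B t)"
  unfolding primitive_on_def
proof (intro conjI ballI)
  fix t assume "t \<in> {0..T}"
  from arg_cong[OF primitive_onD(2)[OF assms this], of "(*) c"]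
  show "c * B t = c * B 0 + (LBINT u:{0..t}. c * f u)"
    by (simp only: set_integral_mult_right distrib_left)
qed (rule set_integrable_mult_right, rule primitive_onD(1)[OF assms])

lemma primitive_on_cong:
  assumes "primitive_on T f B" "\<And>t. t \<in> {0..T} \<Longrightarrow> f t = g t" "\<And>t. t \<in> {0..T} \<Longrightarrow> B t = C t" "0 \<le> T"
  shows "primitive_on T g C"
proof -
  have "set_integrable lborel {0..T} g"
    using primitive_onD(1)[OF assms(1)] assms(2)
      set_integrable_cong[of lborel lborel "{0..T}" "{0..T}" f g] by blast
  moreover have "(LBINT u:{0..t}. f u) = (LBINT u:{0..t}. g u)" if "t \<in> {0..T}" for t
    using assms(2) that by (intro set_lebesgue_integral_cong) auto
  moreover have "0 \<in> {0..T}" using \<open>0 \<le> T\<close> by simp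
  ultimately have "C t = C 0 + (LBINT u:{0..t}. g u)" if "t \<in> {0..T}" for t
    using primitive_onD(2)[OF assms(1) that] assms(3)[OF that] assms(3)[of 0] that by auto
  with \<open>set_integrable lborel {0..T} g\<close> show ?thesis
    unfolding primitive_on_def by blast
qed

lemma primitive_on_square:
  assumes "primitive_on T f B" "0 \<le> T"
  shows "primitive_on T (\<lambda>t. 2 * B t * f t) (\<lambda>t. (B t)\<^sup>2)"
proof (rule primitive_on_compose[OF assms, of "\<lambda>x. x\<^sup>2" "\<lambda>x. 2 * x"])
  show "((\<lambda>x. x\<^sup>2) has_real_derivative 2 * B t) (at (B t))" for t
    by (auto intro: derivative_eq_intros)
qed (intro continuous_intros)

text \<open>
  By polarization from the chain rule for the square.
\<close>

lemma primitive_on_mult: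
  assumes B: "primitive_on T f B" and C: "primitive_on T g C" and "0 \<le> T"
  shows "primitive_on T (\<lambda>t. f t * C t + B t * g t) (\<lambda>t. B t * C t)"
proof -
  have "primitive_on T (\<lambda>t. 1/4 * (2 * (B t + C t) * (f t + g t)) +
      (-1/4) * (2 * (B t + (-1) * C t) * (f t + (-1) * g t)))
     (\<lambda>t. 1/4 * (B t + C t)\<^sup>2 + (-1/4) * (B t + (-1) * C t)\<^sup>2)"
    using assms by (intro primitive_on_add primitive_on_cmult primitive_on_square)
  then show ?thesis
    by (rule primitive_on_cong) (simp_all add: algebra_simps power2_eq_square \<open>0 \<le> T\<close>)
qed

text \<open>
  With the integrating factor \<open>E = exp (- \<integral> k) \<le> 1\<close>, the derivative of \<open>E * Q\<close> is at most \<open>h\<close>.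
\<close>

lemma primitive_on_gronwall:
  assumes Q: "primitive_on T Q' Q" and "0 \<le> T"
    and k: "set_integrable lborel {0..T} k" "\<And>t. t \<in> {0..T} \<Longrightarrow> 0 \<le> k t"
    and h: "set_integrable lborel {0..T} h" "\<And>t. t \<in> {0..T} \<Longrightarrow> 0 \<le> h t"
    and le: "\<And>t. t \<in> {0..T} \<Longrightarrow> Q' t \<le> k t * Q t + h t"
    and "0 \<le> Q 0" and t: "t \<in> {0..T}"
  shows "Q t \<le> exp (LBINT u:{0..T}. k u) * (Q 0 + (LBINT u:{0..T}. h u))"
proof -
  define B where "B t = 0 + (LBINT u:{0..t}. k u)" for t
  have B: "primitive_on T k B"
    unfolding B_def using k(1) by (rule primitive_on_indefinite_integral)
  have B0: "B 0 = 0" by (simp add: B_def set_integral_at_point)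
  have inc: "0 \<le> B t'" "B t' \<le> B T" if "t' \<in> {0..T}" for t'
  proof -
    have "0 \<le> (LBINT u:{0..t'}. k u)" "0 \<le> (LBINT u:{t'<..T}. k u)"
      using k(2) that by (auto simp: set_lebesgue_integral_def indicator_def intro!: integral_nonneg_AE AE_I2)
    then show "0 \<le> B t'" "B t' \<le> B T"
      using primitive_on_increment[OF B, of t' T] that by (auto simp: B_def)
  qed
  define E where "E t = exp (- 1 * B t)" for t
  have "primitive_on T (\<lambda>t. exp (-1 * B t) * (-1 * k t)) E"
    unfolding E_def
    by (rule primitive_on_compose[OF primitive_on_cmult[OF B, of "-1"] \<open>0 \<le> T\<close>, of exp exp])
       (rule DERIV_exp, intro continuous_intros)
  from primitive_on_mult[OF this Q \<open>0 \<le> T\<close>]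
  have EQ: "primitive_on T (\<lambda>t. E t * (Q' t - k t * Q t)) (\<lambda>t. E t * Q t)"
    by (rule primitive_on_cong) (auto simp: E_def algebra_simps \<open>0 \<le> T\<close>)
  have le1: "E t' \<le> 1" if "t' \<in> {0..T}" for t'
    using inc[OF that] by (simp add: E_def)
  have Ed: "E t' * (Q' t' - k t' * Q t') \<le> h t'" if "t' \<in> {0..T}" for t'
  proof -
    have "E t' * (Q' t' - k t' * Q t') \<le> E t' * h t'"
      using le[OF that] by (intro mult_left_mono) (auto simp: E_def)
    also have "\<dots> \<le> 1 * h t'"
      using le1[OF that] h(2)[OF that] by (intro mult_right_mono) auto
    finally show ?thesis by simp
  qed
  have "E t * Q t = E 0 * Q 0 + (LBINT u:{0..t}. E u * (Q' u - k u * Q u))"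
    using EQ t unfolding primitive_on_def by blast
  also have "\<dots> \<le> Q 0 + (LBINT u:{0..t}. h u)"
  proof -
    have "set_integrable lborel {0..t} (\<lambda>u. E u * (Q' u - k u * Q u))" "set_integrable lborel {0..t} h"
      using primitive_onD(1)[OF EQ] h(1) t by (auto intro: set_integrable_subset)
    then have "(LBINT u:{0..t}. E u * (Q' u - k u * Q u)) \<le> (LBINT u:{0..t}. h u)"
      using Ed t by (intro set_integral_mono) auto
    then show ?thesis by (simp add: E_def B0)
  qed
  also have "\<dots> \<le> Q 0 + (LBINT u:{0..T}. h u)"
  proof -
    have "0 \<le> (LBINT u:{t<..T}. h u)"
      using h(2) t by (auto simp: set_lebesgue_integral_def indicator_def intro!: integral_nonneg_AE AE_I2)
    then show ?thesis
      using set_integral_split_Ioc[OF h(1), of t T] t by simp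
  qed
  finally have main: "E t * Q t \<le> Q 0 + (LBINT u:{0..T}. h u)" .
  have H0: "0 \<le> (LBINT u:{0..T}. h u)"
    using h(2) by (auto simp: set_lebesgue_integral_def indicator_def intro!: integral_nonneg_AE AE_I2)
  have "Q t = exp (B t) * (E t * Q t)"
    by (simp add: E_def exp_minus field_simps)
  also have "\<dots> \<le> exp (B t) * (Q 0 + (LBINT u:{0..T}. h u))"
    using main by (intro mult_left_mono) auto
  also have "\<dots> \<le> exp (B T) * (Q 0 + (LBINT u:{0..T}. h u))"
    using inc[OF t] H0 \<open>0 \<le> Q 0\<close> by (intro mult_right_mono) auto
  finally show ?thesis by (simp add: B_def)
qed

text \<open>
  The gauge integral recovers \<open>\<alpha>\<close> from its pointwise derivative without any integrability assumption.
  Then \<open>g - \<alpha>'\<close> is gauge integrable and nonnegative, hence Lebesgue integrable.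
\<close>

lemma primitive_on_if_derivative_le:
  fixes \<alpha> \<alpha>' g :: "real \<Rightarrow> real"
  assumes "0 \<le> T"
    and deriv: "\<And>t. t \<in> {0..T} \<Longrightarrow> (\<alpha> has_real_derivative \<alpha>' t) (at t within {0..T})"
    and g: "set_integrable lborel {0..T} g"
    and le: "\<And>t. t \<in> {0..T} \<Longrightarrow> \<alpha>' t \<le> g t"
    and meas: "set_borel_measurable lborel {0..T} \<alpha>'"
  shows "primitive_on T \<alpha>' \<alpha>"
proof -
  have ftc: "(\<alpha>' has_integral (\<alpha> t - \<alpha> 0)) {0..t}" if "t \<in> {0..T}" for t
  proof (rule fundamental_theorem_of_calculus)
    show "0 \<le> t" using that by simp
    fix x assume "x \<in> {0..t}"
    with that have "x \<in> {0..T}" "{0..t} \<subseteq> {0..T}" by auto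
    from deriv[OF this(1)] has_field_derivative_subset[OF _ this(2)]
    show "(\<alpha> has_vector_derivative \<alpha>' x) (at x within {0..t})"
      by (auto simp: has_real_derivative_iff_has_vector_derivative[symmetric])
  qed
  have "\<alpha>' integrable_on {0..T}" using ftc[of T] \<open>0 \<le> T\<close> by auto
  moreover have "g integrable_on {0..T}"
    using g by (rule set_borel_integral_eq_integral)
  ultimately have "(\<lambda>t. g t - \<alpha>' t) integrable_on {0..T}" by (intro integrable_diff)
  then have "(\<lambda>t. g t - \<alpha>' t) absolutely_integrable_on {0..T}"
    using le by (intro nonnegative_absolutely_integrable_1) auto
  moreover have "set_borel_measurable lborel {0..T} (\<lambda>t. g t - \<alpha>' t)"
    using g meas unfolding set_integrable_def set_borel_measurable_def
    by (simp add: right_diff_distrib)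
  ultimately have "set_integrable lborel {0..T} (\<lambda>t. g t - \<alpha>' t)"
    unfolding set_integrable_def set_borel_measurable_def by (simp add: integrable_completion)
  from set_integral_diff(1)[OF g this] have int: "set_integrable lborel {0..T} \<alpha>'"
    by (simp only: diff_diff_eq2 add_diff_cancel_left')
  have "(LBINT u:{0..t}. \<alpha>' u) = \<alpha> t - \<alpha> 0" if "t \<in> {0..T}" for t
  proof -
    have "set_integrable lborel {0..t} \<alpha>'" using int that by (auto intro: set_integrable_subset)
    then show ?thesis using ftc[OF that] set_borel_integral_eq_integral(2) integral_unique by metis
  qed
  then have "\<alpha> t = \<alpha> 0 + (LBINT u:{0..t}. \<alpha>' u)" if "t \<in> {0..T}" for t
    using that by (simp only: diff_add_cancel add.commute[of "\<alpha> 0"])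
  with int show ?thesis unfolding primitive_on_def by blast
qed

lemma abs_set_integral_le:
  fixes f g :: "real \<Rightarrow> real"
  assumes "set_integrable lborel S f" "set_integrable lborel S g"
    and "AE u in lborel. u \<in> S \<longrightarrow> \<bar>f u\<bar> \<le> g u"
  shows "\<bar>LBINT u:S. f u\<bar> \<le> (LBINT u:S. g u)"
proof -
  have "\<bar>LBINT u:S. f u\<bar> \<le> (LBINT u. \<bar>indicator S u *\<^sub>R f u\<bar>)"
    unfolding set_lebesgue_integral_def by (rule integral_abs_bound)
  also have "\<dots> \<le> (LBINT u. indicator S u *\<^sub>R g u)"
  proof (rule integral_mono_AE)
    show "AE u in lborel. \<bar>indicator S u *\<^sub>R f u\<bar> \<le> indicator S u *\<^sub>R g u"
      using assms(3) by eventually_elim (auto simp: indicator_def)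
  qed (use assms(1,2) in \<open>auto simp: set_integrable_def\<close>)
  finally show ?thesis by (simp add: set_lebesgue_integral_def)
qed

section \<open>Products of time and sample space\<close>

lemma set_borel_measurable_restrict:
  fixes f :: "real \<Rightarrow> real"
  assumes "S \<in> sets borel"
  shows "set_borel_measurable lborel S f \<longleftrightarrow> f \<in> borel_measurable (restrict_space borel S)"
  using assms by (simp add: set_borel_measurable_def borel_measurable_restrict_space_iff)

text \<open>
  A function on the interval is extended by zero through the retraction of the line onto \<open>{0..T}\<close>.
\<close>

lemma measurable_extend_interval:
  fixes f :: "real \<times> 'b \<Rightarrow> real" and T :: real
  assumes f: "f \<in> borel_measurable (restrict_space borel {0..T} \<Otimes>\<^sub>M N)" and "0 \<le> T"
  shows "(\<lambda>p. indicat_real {0..T} (fst p) * f p) \<in> borel_measurable (lborel \<Otimes>\<^sub>M N)"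
proof -
  have "(\<lambda>p. (max 0 (min T (fst p)), snd p)) \<in> measurable (lborel \<Otimes>\<^sub>M N) (restrict_space borel {0..T} \<Otimes>\<^sub>M N)"
    using \<open>0 \<le> T\<close> by (intro measurable_Pair measurable_restrict_space2) auto
  from measurable_compose[OF this f]
  have [measurable]: "(\<lambda>p. f (max 0 (min T (fst p)), snd p)) \<in> borel_measurable (lborel \<Otimes>\<^sub>M N)" .
  have "(\<lambda>p. indicat_real {0..T} (fst p) * f (max 0 (min T (fst p)), snd p)) \<in> borel_measurable (lborel \<Otimes>\<^sub>M N)"
    by measurable
  also have "(\<lambda>p. indicat_real {0..T} (fst p) * f (max 0 (min T (fst p)), snd p))
      = (\<lambda>p. indicat_real {0..T} (fst p) * f p)"
    by (auto simp: fun_eq_iff indicator_def max_def min_def)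
  finally show ?thesis .
qed

lemma AE_snd_pair:
  assumes "sigma_finite_measure N" "AE \<omega> in N. P \<omega>"
  shows "AE p in M1 \<Otimes>\<^sub>M N. P (snd p)"
proof -
  interpret sigma_finite_measure N by fact
  obtain N0 where N0: "N0 \<in> null_sets N" "{\<omega> \<in> space N. \<not> P \<omega>} \<subseteq> N0"
    using assms(2) by (auto simp: eventually_ae_filter)
  have "emeasure (M1 \<Otimes>\<^sub>M N) (space M1 \<times> N0) = emeasure M1 (space M1) * emeasure N N0"
    using N0 by (intro emeasure_pair_measure_Times) auto
  also have "\<dots> = 0" using N0 by auto
  finally have "space M1 \<times> N0 \<in> null_sets (M1 \<Otimes>\<^sub>M N)"
    using N0 by (auto intro!: null_setsI)
  moreover have "{p \<in> space (M1 \<Otimes>\<^sub>M N). \<not> P (snd p)} \<subseteq> space M1 \<times> N0"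
    using N0(2) by (auto simp: space_pair_measure)
  ultimately show ?thesis by (rule AE_I')
qed

lemma (in pair_sigma_finite) integrable_mult_pair:
  fixes f g :: "_ \<Rightarrow> real"
  assumes f: "integrable M1 f" and g: "integrable M2 g"
  shows "integrable (M1 \<Otimes>\<^sub>M M2) (\<lambda>p. f (fst p) * g (snd p))"
proof (rule Fubini_integrable)
  have [measurable]: "f \<in> borel_measurable M1" "g \<in> borel_measurable M2"
    using f g by auto
  show "(\<lambda>p. f (fst p) * g (snd p)) \<in> borel_measurable (M1 \<Otimes>\<^sub>M M2)" by measurable
  show "integrable M1 (\<lambda>x. \<integral>y. norm (f (fst (x, y)) * g (snd (x, y))) \<partial>M2)"
    using f by (simp add: abs_mult)
  show "AE x in M1. integrable M2 (\<lambda>y. f (fst (x, y)) * g (snd (x, y)))"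
    using g by simp
qed

text \<open>
  Monotone convergence along the events \<open>\<bar>Z\<bar> \<le> n\<close>, which exhaust the space because \<open>Z\<close> is finite.
\<close>

lemma nn_integral_le_by_localization:
  fixes Z :: "'a \<Rightarrow> real"
  assumes [measurable]: "Z \<in> borel_measurable M" "f \<in> borel_measurable M"
    and le: "\<And>n::nat. (\<integral>\<^sup>+\<omega>. indicator {\<omega> \<in> space M. \<bar>Z \<omega>\<bar> \<le> real n} \<omega> * f \<omega> \<partial>M)
      \<le> (\<integral>\<^sup>+\<omega>. indicator {\<omega> \<in> space M. \<bar>Z \<omega>\<bar> \<le> real n} \<omega> * g \<omega> \<partial>M)"
  shows "(\<integral>\<^sup>+\<omega>. f \<omega> \<partial>M) \<le> (\<integral>\<^sup>+\<omega>. g \<omega> \<partial>M)"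
proof -
  let ?h = "\<lambda>n \<omega>. indicator {\<omega> \<in> space M. \<bar>Z \<omega>\<bar> \<le> real n} \<omega> * f \<omega>"
  have "(\<integral>\<^sup>+\<omega>. f \<omega> \<partial>M) = (\<integral>\<^sup>+\<omega>. (SUP n. ?h n \<omega>) \<partial>M)"
  proof (rule nn_integral_cong)
    fix \<omega> assume "\<omega> \<in> space M"
    obtain n :: nat where "\<bar>Z \<omega>\<bar> \<le> real n" using real_arch_simple by blast
    with \<open>\<omega> \<in> space M\<close> have eq: "f \<omega> = ?h n \<omega>" by simp
    have "?h n \<omega> \<le> (SUP n. ?h n \<omega>)" by (rule SUP_upper) simp
    with eq have "f \<omega> \<le> (SUP n. ?h n \<omega>)" by (rule ord_eq_le_trans)
    moreover have "?h m \<omega> \<le> f \<omega>" for m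
      by (auto simp: indicator_def)
    then have "(SUP n. ?h n \<omega>) \<le> f \<omega>" by (rule SUP_least)
    ultimately show "f \<omega> = (SUP n. ?h n \<omega>)" by (rule antisym)
  qed
  also have "\<dots> = (SUP n. \<integral>\<^sup>+\<omega>. ?h n \<omega> \<partial>M)"
    by (rule nn_integral_monotone_convergence_SUP) (auto simp: incseq_def le_fun_def indicator_def)
  also have "\<dots> \<le> (\<integral>\<^sup>+\<omega>. g \<omega> \<partial>M)"
  proof (rule SUP_least)
    fix n
    have "(\<integral>\<^sup>+\<omega>. indicator {\<omega> \<in> space M. \<bar>Z \<omega>\<bar> \<le> real n} \<omega> * g \<omega> \<partial>M) \<le> (\<integral>\<^sup>+\<omega>. g \<omega> \<partial>M)"
      by (intro nn_integral_mono) (auto simp: indicator_def)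
    with le[of n] show "(\<integral>\<^sup>+\<omega>. ?h n \<omega> \<partial>M) \<le> (\<integral>\<^sup>+\<omega>. g \<omega> \<partial>M)" by simp
  qed
  finally show ?thesis .
qed

section \<open>Regime-switching processes\<close>

locale regime_filtration =
  fixes M :: "'a measure" and F :: "real \<Rightarrow> 'a measure" and T :: real
    and rate :: "'s::finite \<Rightarrow> 's \<Rightarrow> real" and s0 :: "'a \<Rightarrow> 's" and s :: "real \<Rightarrow> 'a \<Rightarrow> 's"
  assumes filtered: "filtered_prob_space M F"
    and horizon_pos: "0 < T"
    and rate_row_sum: "rate a a = - (\<Sum>b\<in>UNIV - {a}. rate a b)"
    and switching: "regime_switching M F T rate s0 s"
begin

abbreviation ind :: "'s \<Rightarrow> real \<Rightarrow> 'a \<Rightarrow> real" where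
  "ind a t \<omega> \<equiv> indicat_real {a} (s t \<omega>)"

abbreviation \<mu> :: "(real \<times> 'a) measure" where
  "\<mu> \<equiv> lborel \<Otimes>\<^sub>M M"

abbreviation on_horizon :: "(real \<Rightarrow> 'a \<Rightarrow> real) \<Rightarrow> real \<times> 'a \<Rightarrow> real" where
  "on_horizon f \<equiv> (\<lambda>(t, \<omega>). indicat_real {0..T} t * f t \<omega>)"

sublocale prob_space M
  using filtered by (simp add: filtered_prob_space_def)

lemma subalg: "subalgebra M (F t)"
  using filtered by (simp add: filtered_prob_space_def)

lemma space_F [simp]: "space (F t) = space M"
  using subalg by (simp add: subalgebra_def)

lemma sets_F_mono: "t \<le> t' \<Longrightarrow> sets (F t) \<subseteq> sets (F t')"
  using filtered filtration.sets_F_mono[of "space M" F] by (auto simp: filtered_prob_space_def)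

lemma measurable_F_mono: "f \<in> measurable (F t) N \<Longrightarrow> t \<le> t' \<Longrightarrow> f \<in> measurable (F t') N"
  using sets_F_mono[of t t'] by (auto simp: measurable_def)

lemma measurable_F_M: "f \<in> measurable (F t) N \<Longrightarrow> f \<in> measurable M N"
  using subalg measurable_from_subalg by blast

lemma sigma_finite_F: "sigma_finite_subalgebra M (F t)"
proof -
  interpret finite_measure_subalgebra M "F t"
    by unfold_locales (rule subalg)
  show ?thesis by unfold_locales
qed

lemma measurable_regime_F: "t \<in> {0..T} \<Longrightarrow> s t \<in> measurable (F t) (count_space UNIV)"
  using switching by (simp add: regime_switching_def)

lemma measurable_regime: "t \<in> {0..T} \<Longrightarrow> s t \<in> measurable M (count_space UNIV)"
  using measurable_regime_F measurable_F_M by blast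

lemma regime_right_continuous:
  "\<omega> \<in> space M \<Longrightarrow> 0 \<le> t \<Longrightarrow> t < T \<Longrightarrow> \<forall>\<^sub>F t' in at_right t. s t' \<omega> = s t \<omega>"
  using switching by (simp add: regime_switching_def)

text \<open>
  Right-continuity makes \<open>s\<close> a limit of processes that are constant on the cells of a grid and take
  the value of \<open>s\<close> at the right end of the cell. Capping the grid at \<open>t\<close> keeps these values
  \<open>F t\<close>-measurable, so that \<open>s\<close> is progressively measurable and not merely adapted.
\<close>

lemma measurable_regime_indicator:
  assumes "0 \<le> t" "t \<le> T"
  shows "(\<lambda>(u, \<omega>). indicat_real {0..t} u * ind c u \<omega>) \<in> borel_measurable (borel \<Otimes>\<^sub>M F t)"
proof -
  define g where "g n k = max 0 (min t ((of_int k + 1) / (real n + 1)))" for n :: nat and k :: int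
  \<comment> \<open>the right end of the cell of \<open>u\<close>, which lies strictly to the right of \<open>u\<close> for \<open>u < t\<close>\<close>
  define grid where "grid n u = g n \<lfloor>u * (real n + 1)\<rfloor>" for n :: nat and u :: real
  have g: "g n k \<in> {0..t}" for n k
    using assms by (auto simp: g_def)
  have grid_gt: "u < grid n u" and grid_le: "grid n u \<le> u + 1 / (real n + 1)" if "0 \<le> u" "u < t" for n u
  proof -
    have "u * (real n + 1) < of_int \<lfloor>u * (real n + 1)\<rfloor> + 1" by linarith
    then have "u < (of_int \<lfloor>u * (real n + 1)\<rfloor> + 1) / (real n + 1)"
      by (simp add: pos_less_divide_eq)
    with that show "u < grid n u" by (auto simp: grid_def g_def)
    have "(of_int \<lfloor>u * (real n + 1)\<rfloor> + 1) / (real n + 1) \<le> (u * (real n + 1) + 1) / (real n + 1)"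
      by (intro divide_right_mono) auto
    also have "\<dots> = u + 1 / (real n + 1)" by (simp add: field_simps)
    finally show "grid n u \<le> u + 1 / (real n + 1)"
      using that by (auto simp: grid_def g_def)
  qed
  have grid_t: "grid n t = t" for n
  proof -
    have "t * (real n + 1) < of_int \<lfloor>t * (real n + 1)\<rfloor> + 1" by linarith
    then have "t < (of_int \<lfloor>t * (real n + 1)\<rfloor> + 1) / (real n + 1)"
      by (simp add: pos_less_divide_eq)
    then show ?thesis using assms by (auto simp: grid_def g_def)
  qed
  have "(\<lambda>p. indicat_real {0..t} (fst p) * ind c (fst p) (snd p)) \<in> borel_measurable (borel \<Otimes>\<^sub>M F t)"
  proof (rule borel_measurable_LIMSEQ_real)
    fix n :: nat
    have "s (g n k) \<in> measurable (F t) (count_space UNIV)" for k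
      using g[of n k] assms measurable_F_mono[OF measurable_regime_F[of "g n k"], of t] by auto
    then have [measurable]: "(\<lambda>p. s (g n k) (snd p)) \<in> measurable (borel \<Otimes>\<^sub>M F t) (count_space UNIV)" for k
      by measurable
    have "(\<lambda>p. s (g n \<lfloor>fst p * (real n + 1)\<rfloor>) (snd p)) \<in> measurable (borel \<Otimes>\<^sub>M F t) (count_space UNIV)"
      by (rule measurable_compose_countable[where g="\<lambda>p. \<lfloor>fst p * (real n + 1)\<rfloor>"]) measurable
    then have [measurable]: "(\<lambda>p. s (grid n (fst p)) (snd p)) \<in> measurable (borel \<Otimes>\<^sub>M F t) (count_space UNIV)"
      by (simp add: grid_def)
    show "(\<lambda>p. indicat_real {0..t} (fst p) * indicat_real {c} (s (grid n (fst p)) (snd p))) \<in> borel_measurable (borel \<Otimes>\<^sub>M F t)"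
      by measurable
  next
    fix p :: "real \<times> 'a" assume "p \<in> space (borel \<Otimes>\<^sub>M F t)"
    then obtain u \<omega> where p: "p = (u, \<omega>)" "\<omega> \<in> space M"
      by (auto simp: space_pair_measure)
    show "(\<lambda>n. indicat_real {0..t} (fst p) * indicat_real {c} (s (grid n (fst p)) (snd p)))
      \<longlonglongrightarrow> indicat_real {0..t} (fst p) * ind c (fst p) (snd p)"
    proof (cases "0 \<le> u \<and> u < t")
      case True
      have "(\<lambda>n. grid n u) \<longlonglongrightarrow> u"
      proof (rule tendsto_sandwich)
        show "\<forall>\<^sub>F n in sequentially. u \<le> grid n u" "\<forall>\<^sub>F n in sequentially. grid n u \<le> u + 1 / (real n + 1)"
          using grid_gt[of u] grid_le[of u] True by (auto intro!: always_eventually less_imp_le)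
        have "(\<lambda>n. 1 / (real n + 1)) \<longlonglongrightarrow> 0"
          using LIMSEQ_inverse_real_of_nat by (simp add: inverse_eq_divide add.commute)
        then show "(\<lambda>n. u + 1 / (real n + 1)) \<longlonglongrightarrow> u"
          using tendsto_add[OF tendsto_const[of u]] by fastforce
      qed simp
      then have "filterlim (\<lambda>n. grid n u) (at_right u) sequentially"
        using grid_gt[of u] True by (auto simp: filterlim_at intro!: always_eventually)
          (metis less_irrefl)
      with regime_right_continuous[of \<omega> u] p(2) True assms
      have "\<forall>\<^sub>F n in sequentially. s (grid n u) \<omega> = s u \<omega>"
        by (auto simp: filterlim_iff)
      then show ?thesis
        by (intro tendsto_eventually) (simp add: p eventually_mono)
    next
      case False
      then have "u = t \<or> indicat_real {0..t} u = 0" by (auto simp: indicator_def)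
      then show ?thesis by (auto simp: p grid_t)
    qed
  qed
  then show ?thesis by (simp add: case_prod_beta')
qed

lemma progressively_measurable_regime:
  assumes "0 \<le> t" "t \<le> T"
  shows "(\<lambda>p. s (fst p) (snd p)) \<in> measurable (restrict_space borel {0..t} \<Otimes>\<^sub>M F t) (count_space UNIV)"
proof -
  let ?R = "restrict_space borel {0..t} \<Otimes>\<^sub>M F t"
  have "(\<lambda>p. s (fst p) (snd p)) -` {c} \<inter> space ?R \<in> sets ?R" for c
  proof -
    have "(\<lambda>p. (fst p, snd p)) \<in> measurable ?R (borel \<Otimes>\<^sub>M F t)"
      by (intro measurable_Pair measurable_compose[OF measurable_fst measurable_restrict_space1] measurable_snd)
         (rule measurable_ident_sets[OF refl])
    from measurable_compose[OF this measurable_regime_indicator[OF assms, of c]]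
    have "(\<lambda>p. indicat_real {0..t} (fst p) * ind c (fst p) (snd p)) \<in> borel_measurable ?R"
      by (simp add: case_prod_beta')
    from measurable_sets[OF this, of "{1}"]
    have "(\<lambda>p. indicat_real {0..t} (fst p) * ind c (fst p) (snd p)) -` {1} \<inter> space ?R \<in> sets ?R"
      by simp
    also have "(\<lambda>p. indicat_real {0..t} (fst p) * ind c (fst p) (snd p)) -` {1} \<inter> space ?R
       = (\<lambda>p. s (fst p) (snd p)) -` {c} \<inter> space ?R"
      by (auto simp: indicator_def space_pair_measure space_restrict_space)
    finally show ?thesis .
  qed
  then show ?thesis by (simp add: measurable_count_space_eq2)
qed

lemma measurable_regime_product:
  "(\<lambda>p. s (fst p) (snd p)) \<in> measurable (restrict_space borel {0..T} \<Otimes>\<^sub>M M) (count_space UNIV)"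
proof -
  have "(\<lambda>x. x) \<in> measurable M (F T)"
    by (rule measurable_F_M[OF measurable_ident_sets[OF refl]])
  then have "(\<lambda>p. (fst p, snd p)) \<in> measurable (restrict_space borel {0..T} \<Otimes>\<^sub>M M) (restrict_space borel {0..T} \<Otimes>\<^sub>M F T)"
    by (intro measurable_Pair measurable_compose[OF measurable_snd]) auto
  from measurable_compose[OF this progressively_measurable_regime[of T]] show ?thesis
    using horizon_pos by simp
qed

text \<open>
  Away from the current regime the estimate is the definition of the switching rates. The probability
  of staying is one minus the others, and the diagonal entry of \<open>rate\<close> is minus the row sum.
\<close>

lemma switching_probability_estimate:
  assumes "0 < \<eta>"
  shows "\<exists>\<epsilon>0>0. \<forall>a t t'. 0 \<le> t \<longrightarrow> t < t' \<longrightarrow> t' \<le> T \<longrightarrow> t' - t < \<epsilon>0 \<longrightarrow>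
       (AE \<omega> in M. \<bar>real_cond_exp M (F t) (indicat_real {\<omega>' \<in> space M. s t' \<omega>' = a}) \<omega>
          - ind a t \<omega> - (t' - t) * rate (s t \<omega>) a\<bar> \<le> \<eta> * (t' - t))"
proof -
  define N where "N = real CARD('s)"
  have N1: "1 \<le> N" unfolding N_def by (simp add: Suc_leI)
  \<comment> \<open>the probability of staying collects one error for each of the other regimes\<close>
  define \<eta>' where "\<eta>' = \<eta> / N"
  have "0 < \<eta>'" using assms N1 by (simp add: \<eta>'_def)
  define P where "P a b \<epsilon>0 \<longleftrightarrow> 0 < \<epsilon>0 \<and> (\<forall>t \<epsilon>. 0 \<le> t \<longrightarrow> 0 < \<epsilon> \<longrightarrow> \<epsilon> < \<epsilon>0 \<longrightarrow> t + \<epsilon> \<le> T \<longrightarrow>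
        (AE \<omega> in M. s t \<omega> = a \<longrightarrow>
           \<bar>real_cond_exp M (F t) (indicat_real {\<omega>' \<in> space M. s (t + \<epsilon>) \<omega>' = b}) \<omega>
             - (LBINT t':{t..t + \<epsilon>}. rate a b)\<bar> \<le> \<eta>' * \<epsilon>))" for a b \<epsilon>0
  have "\<exists>\<epsilon>0. a \<noteq> b \<longrightarrow> P a b \<epsilon>0" for a b
    using switching \<open>0 < \<eta>'\<close> unfolding regime_switching_def P_def by blast
  then obtain e where e: "\<And>a b. a \<noteq> b \<Longrightarrow> P a b (e a b)" by metis
  define \<epsilon>0 where "\<epsilon>0 = Min (insert 1 ((\<lambda>(a, b). e a b) ` {(a, b). a \<noteq> b}))"
  have "0 < \<epsilon>0" unfolding \<epsilon>0_def
    by (subst Min_gr_iff) (use e in \<open>auto simp: P_def\<close>)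
  have \<epsilon>0_le: "\<epsilon>0 \<le> e a b" if "a \<noteq> b" for a b
    unfolding \<epsilon>0_def by (rule Min_le) (use that in \<open>auto intro!: image_eqI[of _ _ "(a, b)"]\<close>)
  have "AE \<omega> in M. \<bar>real_cond_exp M (F t) (indicat_real {\<omega>' \<in> space M. s t' \<omega>' = a}) \<omega>
          - ind a t \<omega> - (t' - t) * rate (s t \<omega>) a\<bar> \<le> \<eta> * (t' - t)"
    if t: "0 \<le> t" "t < t'" "t' \<le> T" "t' - t < \<epsilon>0" for a t t'
  proof -
    interpret sub: sigma_finite_subalgebra M "F t" by (rule sigma_finite_F)
    define p where "p b = real_cond_exp M (F t) (indicat_real {\<omega>' \<in> space M. s t' \<omega>' = b})" for b
    have [measurable]: "s t' \<in> measurable M (count_space UNIV)"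
      using t by (intro measurable_regime) auto
    have ev: "{\<omega>' \<in> space M. s t' \<omega>' = b} \<in> sets M" for b
      by measurable
    have off: "AE \<omega> in M. \<forall>c b. c \<noteq> b \<longrightarrow> s t \<omega> = c \<longrightarrow> \<bar>p b \<omega> - (t' - t) * rate c b\<bar> \<le> \<eta>' * (t' - t)"
    proof -
      have "AE \<omega> in M. \<forall>cb\<in>UNIV. fst cb \<noteq> snd cb \<longrightarrow> s t \<omega> = fst cb \<longrightarrow>
          \<bar>p (snd cb) \<omega> - (t' - t) * rate (fst cb) (snd cb)\<bar> \<le> \<eta>' * (t' - t)"
      proof (intro AE_finite_allI)
        fix cb :: "'s \<times> 's"
        obtain c b where cb: "cb = (c, b)" by (cases cb)
        have int: "(LBINT t':{t..t + (t' - t)}. rate c b) = (t' - t) * rate c b"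
          using t by (simp add: set_integral_const set_lebesgue_integral_def)
        show "AE \<omega> in M. fst cb \<noteq> snd cb \<longrightarrow> s t \<omega> = fst cb \<longrightarrow>
          \<bar>p (snd cb) \<omega> - (t' - t) * rate (fst cb) (snd cb)\<bar> \<le> \<eta>' * (t' - t)"
        proof (cases "c = b")
          case False
          have "t' - t < e c b" using t \<epsilon>0_le[OF False] by simp
          with conjunct2[OF e[OF False, unfolded P_def], rule_format, of t "t' - t"] t
          have "AE \<omega> in M. s t \<omega> = c \<longrightarrow>
             \<bar>real_cond_exp M (F t) (indicat_real {\<omega>' \<in> space M. s (t + (t' - t)) \<omega>' = b}) \<omega>
               - (LBINT t':{t..t + (t' - t)}. rate c b)\<bar> \<le> \<eta>' * (t' - t)"
            by simp
          then show ?thesis unfolding int by (simp add: cb p_def)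
        qed (simp add: cb)
      qed simp
      then show ?thesis by (rule AE_mp) (intro AE_I2, auto)
    qed
    have total: "AE \<omega> in M. (\<Sum>b\<in>UNIV. p b \<omega>) = 1"
    proof -
      have "AE \<omega> in M. real_cond_exp M (F t) (\<lambda>\<omega>. \<Sum>b\<in>UNIV. indicat_real {\<omega>' \<in> space M. s t' \<omega>' = b} \<omega>) \<omega> = (\<Sum>b\<in>UNIV. p b \<omega>)"
        unfolding p_def by (rule sub.real_cond_exp_sum) (intro integrable_real_indicator ev, simp add: less_top[symmetric])
      moreover have "AE \<omega> in M. real_cond_exp M (F t) (\<lambda>\<omega>. \<Sum>b\<in>UNIV. indicat_real {\<omega>' \<in> space M. s t' \<omega>' = b} \<omega>) \<omega>
           = real_cond_exp M (F t) (\<lambda>\<omega>. 1) \<omega>"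
      proof (rule sub.real_cond_exp_cong)
        show "AE \<omega> in M. (\<Sum>b\<in>UNIV. indicat_real {\<omega>' \<in> space M. s t' \<omega>' = b} \<omega>) = 1"
          by (intro AE_I2) (simp add: indicator_def of_bool_def sum.delta if_distrib)
      qed measurable
      moreover have "AE \<omega> in M. real_cond_exp M (F t) (\<lambda>\<omega>. 1) \<omega> = 1"
        by (rule sub.real_cond_exp_F_meas) auto
      ultimately show ?thesis by eventually_elim simp
    qed
    from off total show ?thesis
    proof eventually_elim
      case (elim \<omega>)
      show ?case
      proof (cases "s t \<omega> = a")
        case False
        then have "\<bar>p a \<omega> - (t' - t) * rate (s t \<omega>) a\<bar> \<le> \<eta>' * (t' - t)" using elim by blast
        also have "\<dots> \<le> \<eta> * (t' - t)"
          using N1 assms t by (intro mult_right_mono) (auto simp: \<eta>'_def divide_le_eq)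
        finally show ?thesis using False by (simp add: p_def)
      next
        case True
        have "p a \<omega> - 1 - (t' - t) * rate a a = - (\<Sum>b\<in>UNIV - {a}. p b \<omega> - (t' - t) * rate a b)"
          using elim(2) rate_row_sum[of a] by (simp add: sum.remove[of UNIV a] sum_subtractf sum_distrib_left)
        then have "\<bar>p a \<omega> - 1 - (t' - t) * rate a a\<bar> \<le> (\<Sum>b\<in>UNIV - {a}. \<bar>p b \<omega> - (t' - t) * rate a b\<bar>)"
          by (simp add: sum_abs)
        also have "\<dots> \<le> (\<Sum>b\<in>UNIV - {a}. \<eta>' * (t' - t))"
          using elim(1) True by (intro sum_mono) auto
        also have "\<dots> \<le> N * (\<eta>' * (t' - t))"
        proof -
          have "real (card (UNIV - {a})) \<le> N" by (simp add: N_def card_mono)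
          then show ?thesis using \<open>0 < \<eta>'\<close> t by (simp add: mult_right_mono del: card_Diff_insert)
        qed
        also have "\<dots> = \<eta> * (t' - t)" using N1 by (simp add: \<eta>'_def)
        finally show ?thesis using True by (simp add: p_def)
      qed
    qed
  qed
  with \<open>0 < \<epsilon>0\<close> show ?thesis by blast
qed

text \<open>
  The weight \<open>X\<close> is known at time \<open>t\<close>, so the indicator of the later regime may be replaced by its
  conditional probability.
\<close>

lemma expected_switching_estimate:
  assumes "0 < \<eta>"
  shows "\<exists>\<epsilon>0>0. \<forall>a t t' X. 0 \<le> t \<longrightarrow> t < t' \<longrightarrow> t' \<le> T \<longrightarrow> t' - t < \<epsilon>0 \<longrightarrow>
       X \<in> borel_measurable (F t) \<longrightarrow> integrable M X \<longrightarrow>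
       \<bar>expectation (\<lambda>\<omega>. X \<omega> * (ind a t' \<omega> - ind a t \<omega> - (t' - t) * rate (s t \<omega>) a))\<bar>
         \<le> \<eta> * (t' - t) * expectation (\<lambda>\<omega>. \<bar>X \<omega>\<bar>)"
proof -
  obtain \<epsilon>0 where "0 < \<epsilon>0" and \<epsilon>0: "\<And>a t t'. 0 \<le> t \<Longrightarrow> t < t' \<Longrightarrow> t' \<le> T \<Longrightarrow> t' - t < \<epsilon>0 \<Longrightarrow>
       AE \<omega> in M. \<bar>real_cond_exp M (F t) (indicat_real {\<omega>' \<in> space M. s t' \<omega>' = a}) \<omega>
          - ind a t \<omega> - (t' - t) * rate (s t \<omega>) a\<bar> \<le> \<eta> * (t' - t)"
    using switching_probability_estimate[OF assms] by blast
  have "\<bar>expectation (\<lambda>\<omega>. X \<omega> * (ind a t' \<omega> - ind a t \<omega> - (t' - t) * rate (s t \<omega>) a))\<bar>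
         \<le> \<eta> * (t' - t) * expectation (\<lambda>\<omega>. \<bar>X \<omega>\<bar>)"
    if t: "0 \<le> t" "t < t'" "t' \<le> T" "t' - t < \<epsilon>0" and [measurable]: "X \<in> borel_measurable (F t)" and X: "integrable M X"
    for a t t' X
  proof -
    interpret sub: sigma_finite_subalgebra M "F t" by (rule sigma_finite_F)
    have [measurable]: "s t' \<in> measurable M (count_space UNIV)" "s t \<in> measurable M (count_space UNIV)"
      using t by (auto intro!: measurable_regime)
    define g where "g = indicat_real {\<omega>' \<in> space M. s t' \<omega>' = a}"
    define R where "R \<omega> = ind a t \<omega> + (t' - t) * rate (s t \<omega>) a" for \<omega>
    have [measurable]: "g \<in> borel_measurable M" unfolding g_def by measurable
    have [measurable]: "R \<in> borel_measurable M" unfolding R_def by measurable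
    define C where "C = 1 + (t' - t) * Max (range (\<lambda>c. \<bar>rate c a\<bar>))"
    have R_le: "\<bar>R \<omega>\<bar> \<le> C" for \<omega>
    proof -
      have "\<bar>rate (s t \<omega>) a\<bar> \<le> Max (range (\<lambda>c. \<bar>rate c a\<bar>))" by (rule Max_ge) auto
      then have "\<bar>(t' - t) * rate (s t \<omega>) a\<bar> \<le> (t' - t) * Max (range (\<lambda>c. \<bar>rate c a\<bar>))"
        using t by (simp add: abs_mult mult_left_mono)
      then show ?thesis unfolding R_def C_def by (auto simp: indicator_def)
    qed
    have XR: "integrable M (\<lambda>\<omega>. X \<omega> * R \<omega>)"
    proof (rule Bochner_Integration.integrable_bound[where f="\<lambda>\<omega>. C * X \<omega>"])
      show "AE \<omega> in M. norm (X \<omega> * R \<omega>) \<le> norm (C * X \<omega>)"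
      proof (intro AE_I2)
        fix \<omega>
        have "\<bar>R \<omega>\<bar> \<le> \<bar>C\<bar>" using R_le[of \<omega>] by simp
        from mult_left_mono[OF this, of "\<bar>X \<omega>\<bar>"] show "norm (X \<omega> * R \<omega>) \<le> norm (C * X \<omega>)"
          by (simp add: abs_mult mult.commute)
      qed
    qed (use X in auto)
    have Xg: "integrable M (\<lambda>\<omega>. X \<omega> * g \<omega>)"
      by (rule Bochner_Integration.integrable_bound[OF X]) (use X in \<open>auto simp: g_def indicator_def\<close>)
    note ce = sub.real_cond_exp_intg[OF Xg \<open>X \<in> borel_measurable (F t)\<close> \<open>g \<in> borel_measurable M\<close>]
    have "expectation (\<lambda>\<omega>. X \<omega> * (ind a t' \<omega> - ind a t \<omega> - (t' - t) * rate (s t \<omega>) a))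
        = expectation (\<lambda>\<omega>. X \<omega> * g \<omega> - X \<omega> * R \<omega>)"
      by (intro Bochner_Integration.integral_cong) (auto simp: g_def R_def indicator_def algebra_simps)
    also have "\<dots> = expectation (\<lambda>\<omega>. X \<omega> * real_cond_exp M (F t) g \<omega> - X \<omega> * R \<omega>)"
      using Xg XR ce by simp
    also have "\<bar>\<dots>\<bar> \<le> expectation (\<lambda>\<omega>. \<bar>X \<omega> * real_cond_exp M (F t) g \<omega> - X \<omega> * R \<omega>\<bar>)"
      by (rule integral_abs_bound)
    also have "\<dots> \<le> expectation (\<lambda>\<omega>. \<eta> * (t' - t) * \<bar>X \<omega>\<bar>)"
    proof (rule integral_mono_AE)
      show "integrable M (\<lambda>\<omega>. \<bar>X \<omega> * real_cond_exp M (F t) g \<omega> - X \<omega> * R \<omega>\<bar>)"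
        using XR ce(1) by auto
      show "integrable M (\<lambda>\<omega>. \<eta> * (t' - t) * \<bar>X \<omega>\<bar>)" using X by auto
      show "AE \<omega> in M. \<bar>X \<omega> * real_cond_exp M (F t) g \<omega> - X \<omega> * R \<omega>\<bar> \<le> \<eta> * (t' - t) * \<bar>X \<omega>\<bar>"
        using \<epsilon>0[OF t, of a]
      proof eventually_elim
        case (elim \<omega>)
        then have "\<bar>real_cond_exp M (F t) g \<omega> - R \<omega>\<bar> \<le> \<eta> * (t' - t)"
          by (simp add: g_def R_def diff_diff_eq)
        from mult_left_mono[OF this, of "\<bar>X \<omega>\<bar>"] show ?case
          by (simp add: abs_mult[symmetric] right_diff_distrib mult.commute)
      qed
    qed
    also have "\<dots> = \<eta> * (t' - t) * expectation (\<lambda>\<omega>. \<bar>X \<omega>\<bar>)" by simp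
    finally show ?thesis .
  qed
  with \<open>0 < \<epsilon>0\<close> show ?thesis by blast
qed

end

section \<open>Dynkin's formula\<close>

text \<open>
  An adapted process \<open>Y\<close> whose paths are primitives of an adapted process \<open>V\<close> with
  finite expected total variation. The value of the game has this form once the regime is
  frozen: \<open>Y t = \<alpha>\<^sub>i(t, a) z(t)\<^sup>2\<close> for a fixed \<open>a\<close>.
\<close>

locale adapted_primitive = regime_filtration M F T rate s0 s
  for M :: "'a measure" and F :: "real \<Rightarrow> 'a measure" and T :: real
    and rate :: "'s::finite \<Rightarrow> 's \<Rightarrow> real" and s0 :: "'a \<Rightarrow> 's" and s :: "real \<Rightarrow> 'a \<Rightarrow> 's" +
  fixes Y V :: "real \<Rightarrow> 'a \<Rightarrow> real"
  assumes Y_adapted: "t \<in> {0..T} \<Longrightarrow> Y t \<in> borel_measurable (F t)"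
    and Y_measurable: "(on_horizon Y) \<in> borel_measurable \<mu>"
    and V_adapted: "t \<in> {0..T} \<Longrightarrow> V t \<in> borel_measurable (F t)"
    and V_integrable: "integrable \<mu> (on_horizon V)"
    and Y0_integrable: "integrable M (Y 0)"
    and Y_primitive: "AE \<omega> in M. primitive_on T (\<lambda>t. V t \<omega>) (\<lambda>t. Y t \<omega>)"
begin

sublocale prod: pair_sigma_finite lborel M ..

abbreviation "regime_mean a t \<equiv> expectation (\<lambda>\<omega>. Y t \<omega> * ind a t \<omega>)"

definition "speed u = expectation (\<lambda>\<omega>. \<bar>V u \<omega>\<bar>)"

definition "envelope \<omega> = \<bar>Y 0 \<omega>\<bar> + (LBINT u:{0..T}. \<bar>V u \<omega>\<bar>)"

lemma speed_integrable: "set_integrable lborel {0..T} speed"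
proof -
  have "integrable \<mu> (\<lambda>(t, \<omega>). \<bar>indicat_real {0..T} t * V t \<omega>\<bar>)"
    using integrable_abs[OF V_integrable] by (simp add: case_prod_beta')
  from prod.integrable_fst[OF this] show ?thesis
    by (simp add: set_integrable_def speed_def abs_mult)
qed

lemma speed_nonneg: "0 \<le> speed u"
  by (simp add: speed_def)

lemma envelope_integrable: "integrable M envelope"
proof -
  have "integrable \<mu> (\<lambda>(t, \<omega>). \<bar>indicat_real {0..T} t * V t \<omega>\<bar>)"
    using integrable_abs[OF V_integrable] by (simp add: case_prod_beta')
  from prod.integrable_snd[OF this] show ?thesis
    using Y0_integrable unfolding envelope_def by (simp add: set_lebesgue_integral_def abs_mult)
qed

lemma envelope_bound: "AE \<omega> in M. \<forall>t\<in>{0..T}. \<bar>Y t \<omega>\<bar> \<le> envelope \<omega>"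
  using Y_primitive
proof eventually_elim
  case (elim \<omega>)
  show ?case
  proof
    fix t assume t: "t \<in> {0..T}"
    have int: "set_integrable lborel {0..T} (\<lambda>u. \<bar>V u \<omega>\<bar>)"
      using primitive_onD(1)[OF elim] by (rule set_integrable_abs)
    have "\<bar>LBINT u:{0..t}. V u \<omega>\<bar> \<le> (LBINT u:{0..t}. \<bar>V u \<omega>\<bar>)"
      using primitive_onD(1)[OF elim] int t by (intro abs_set_integral_le) (auto intro: set_integrable_subset)
    moreover have "0 \<le> (LBINT u:{t<..T}. \<bar>V u \<omega>\<bar>)"
      by (auto simp: set_lebesgue_integral_def intro!: integral_nonneg_AE)
    ultimately show "\<bar>Y t \<omega>\<bar> \<le> envelope \<omega>"
      using primitive_onD(2)[OF elim t] set_integral_split_Ioc[OF int, of t T] t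
      unfolding envelope_def by auto
  qed
qed

lemma Y_integrable:
  assumes "t \<in> {0..T}" shows "integrable M (Y t)"
proof (rule Bochner_Integration.integrable_bound[OF envelope_integrable])
  show "Y t \<in> borel_measurable M" using Y_adapted[OF assms] by (rule measurable_F_M)
  show "AE \<omega> in M. norm (Y t \<omega>) \<le> norm (envelope \<omega>)"
    using envelope_bound by eventually_elim (use assms in \<open>auto intro: order_trans[OF _ abs_ge_self]\<close>)
qed

lemma Y_abs_expectation_le:
  assumes "t \<in> {0..T}" shows "expectation (\<lambda>\<omega>. \<bar>Y t \<omega>\<bar>) \<le> expectation envelope"
proof (rule integral_mono_AE)
  show "AE \<omega> in M. \<bar>Y t \<omega>\<bar> \<le> envelope \<omega>"
    using envelope_bound by eventually_elim (use assms in auto)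
qed (use Y_integrable[OF assms] envelope_integrable in auto)

lemma Y_product_integrable: "integrable \<mu> (on_horizon Y)"
proof (rule prod.Fubini_integrable)
  have [measurable]: "(\<lambda>(t, \<omega>). norm (indicat_real {0..T} t * Y t \<omega>)) \<in> borel_measurable \<mu>"
    using measurable_compose[OF Y_measurable borel_measurable_norm]
    by (simp add: case_prod_beta')
  have meas: "(\<lambda>t. expectation (\<lambda>\<omega>. norm (indicat_real {0..T} t * Y t \<omega>))) \<in> borel_measurable lborel"
    by measurable
  have "integrable lborel (\<lambda>t. expectation (\<lambda>\<omega>. norm (indicat_real {0..T} t * Y t \<omega>)))"
  proof (rule Bochner_Integration.integrable_bound[OF _ meas])
    show "integrable lborel (\<lambda>t. indicat_real {0..T} t * expectation envelope)"
      using horizon_pos by (intro integrable_mult_left integrable_real_indicator) auto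
    show "AE t in lborel. norm (expectation (\<lambda>\<omega>. norm (indicat_real {0..T} t * Y t \<omega>)))
         \<le> norm (indicat_real {0..T} t * expectation envelope)"
    proof (intro AE_I2)
      fix t
      show "norm (expectation (\<lambda>\<omega>. norm (indicat_real {0..T} t * Y t \<omega>)))
         \<le> norm (indicat_real {0..T} t * expectation envelope)"
        using Y_abs_expectation_le[of t] by (cases "t \<in> {0..T}") (auto simp: indicator_def abs_mult)
    qed
  qed
  then show "integrable lborel (\<lambda>t. expectation (\<lambda>\<omega>. norm (case (t, \<omega>) of (t, \<omega>) \<Rightarrow> indicat_real {0..T} t * Y t \<omega>)))"
    by simp
  show "AE t in lborel. integrable M (\<lambda>\<omega>. case (t, \<omega>) of (t, \<omega>) \<Rightarrow> indicat_real {0..T} t * Y t \<omega>)"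
  proof (intro AE_I2)
    fix t show "integrable M (\<lambda>\<omega>. case (t, \<omega>) of (t, \<omega>) \<Rightarrow> indicat_real {0..T} t * Y t \<omega>)"
      using Y_integrable[of t] by (cases "t \<in> {0..T}") auto
  qed
qed (rule Y_measurable)

lemma V_integrable_AE: "AE u in lborel. u \<in> {0..T} \<longrightarrow> integrable M (V u)"
  using prod.AE_integrable_fst[OF V_integrable] by eventually_elim auto

lemma product_regime_measurable [measurable]:
  "(\<lambda>(u, \<omega>). indicat_real {0..T} u * ind c u \<omega>) \<in> borel_measurable \<mu>"
proof -
  have "(\<lambda>x. x) \<in> measurable M (F T)"
    by (rule measurable_F_M[OF measurable_ident_sets[OF refl]])
  then have "(\<lambda>p. (fst p, snd p)) \<in> measurable \<mu> (borel \<Otimes>\<^sub>M F T)"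
    by (intro measurable_Pair measurable_compose[OF measurable_snd]) auto
  from measurable_compose[OF this measurable_regime_indicator[of T c]] show ?thesis
    using horizon_pos by (simp add: case_prod_beta')
qed

lemma weighted_V_integrable:
  assumes Z: "(\<lambda>(u, \<omega>). Z u \<omega>) \<in> borel_measurable \<mu>" "\<And>u \<omega>. \<bar>Z u \<omega>\<bar> \<le> C"
    and S: "S \<in> sets borel" "S \<subseteq> {0..T}"
  shows "integrable \<mu> (\<lambda>(u, \<omega>). indicat_real S u * (V u \<omega> * Z u \<omega>))"
proof (rule Bochner_Integration.integrable_bound)
  show "integrable \<mu> (\<lambda>p. C * (on_horizon V p))"
    by (intro integrable_mult_right V_integrable)
  have [measurable]: "(\<lambda>p. indicat_real {0..T} (fst p) * V (fst p) (snd p)) \<in> borel_measurable \<mu>"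
    using borel_measurable_integrable[OF V_integrable] by (simp add: case_prod_beta')
  have [measurable]: "(\<lambda>p. Z (fst p) (snd p)) \<in> borel_measurable \<mu>"
    using Z(1) by (simp add: case_prod_beta')
  have "(\<lambda>p. indicat_real S (fst p) * ((indicat_real {0..T} (fst p) * V (fst p) (snd p)) * Z (fst p) (snd p)))
      \<in> borel_measurable \<mu>"
    using S(1) by measurable
  also have "(\<lambda>p. indicat_real S (fst p) * ((indicat_real {0..T} (fst p) * V (fst p) (snd p)) * Z (fst p) (snd p)))
     = (\<lambda>(u, \<omega>). indicat_real S u * (V u \<omega> * Z u \<omega>))"
    using S(2) by (auto simp: indicator_def fun_eq_iff)
  finally show "(\<lambda>(u, \<omega>). indicat_real S u * (V u \<omega> * Z u \<omega>)) \<in> borel_measurable \<mu>" .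
  have "\<bar>Z u \<omega>\<bar> * \<bar>V u \<omega>\<bar> \<le> \<bar>C\<bar> * \<bar>V u \<omega>\<bar>" for u \<omega>
    using Z(2)[of u \<omega>] by (intro mult_right_mono) auto
  then show "AE p in \<mu>. norm (case p of (u, \<omega>) \<Rightarrow> indicat_real S u * (V u \<omega> * Z u \<omega>))
     \<le> norm (C * (on_horizon V p))"
    using S(2) by (intro AE_I2) (auto simp: indicator_def abs_mult mult.commute split: prod.splits)
qed

lemma expectation_increment_le:
  assumes "0 \<le> t" "t \<le> u" "u \<le> T"
  shows "expectation (\<lambda>\<omega>. \<bar>Y u \<omega> - Y t \<omega>\<bar>) \<le> (LBINT v:{t<..u}. speed v)"
proof -
  have sub: "{t<..u} \<subseteq> {0..T}" using assms by auto
  have "integrable \<mu> (\<lambda>(v, \<omega>). \<bar>indicat_real {t<..u} v * (V v \<omega> * 1)\<bar>)"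
    using integrable_abs[OF weighted_V_integrable[of "\<lambda>_ _. 1" 1 "{t<..u}"]] sub by (simp add: case_prod_beta')
  then have int: "integrable \<mu> (\<lambda>(v, \<omega>). indicat_real {t<..u} v * \<bar>V v \<omega>\<bar>)"
    by (simp add: abs_mult)
  have "expectation (\<lambda>\<omega>. \<bar>Y u \<omega> - Y t \<omega>\<bar>) \<le> expectation (\<lambda>\<omega>. LBINT v. indicat_real {t<..u} v * \<bar>V v \<omega>\<bar>)"
  proof (rule integral_mono_AE)
    show "integrable M (\<lambda>\<omega>. LBINT v. indicat_real {t<..u} v * \<bar>V v \<omega>\<bar>)"
      using prod.integrable_snd[OF int] .
    show "AE \<omega> in M. \<bar>Y u \<omega> - Y t \<omega>\<bar> \<le> (LBINT v. indicat_real {t<..u} v * \<bar>V v \<omega>\<bar>)"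
      using Y_primitive
    proof eventually_elim
      case (elim \<omega>)
      have i: "set_integrable lborel {t<..u} (\<lambda>v. V v \<omega>)"
        using primitive_onD(1)[OF elim] sub by (auto intro: set_integrable_subset)
      have "\<bar>LBINT v:{t<..u}. V v \<omega>\<bar> \<le> (LBINT v:{t<..u}. \<bar>V v \<omega>\<bar>)"
        using i set_integrable_abs[OF i] by (intro abs_set_integral_le) auto
      with primitive_on_increment[OF elim assms] show ?case
        by (simp add: set_lebesgue_integral_def)
    qed
  qed (use Y_integrable[of u] Y_integrable[of t] assms in auto)
  also have "\<dots> = (LBINT v. expectation (\<lambda>\<omega>. indicat_real {t<..u} v * \<bar>V v \<omega>\<bar>))"
    using prod.Fubini_integral[OF int] .
  also have "\<dots> = (LBINT v:{t<..u}. speed v)"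
    by (simp add: set_lebesgue_integral_def speed_def)
  finally show ?thesis .
qed

text \<open>
  Fubini turns the weighted increment of \<open>Y\<close> into a time integral of weighted velocities. The
  weight will be the indicator of the regime at the right end of the interval.
\<close>

lemma expectation_increment_weighted:
  assumes "0 \<le> t" "t \<le> u" "u \<le> T" and [measurable]: "z \<in> borel_measurable M" and z: "\<And>\<omega>. \<bar>z \<omega>\<bar> \<le> 1"
  shows "expectation (\<lambda>\<omega>. (Y u \<omega> - Y t \<omega>) * z \<omega>) = (LBINT v:{t<..u}. expectation (\<lambda>\<omega>. V v \<omega> * z \<omega>))"
    and "set_integrable lborel {t<..u} (\<lambda>v. expectation (\<lambda>\<omega>. V v \<omega> * z \<omega>))"
proof -
  have sub: "{t<..u} \<subseteq> {0..T}" using assms by auto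
  have int: "integrable \<mu> (\<lambda>(v, \<omega>). indicat_real {t<..u} v * (V v \<omega> * z \<omega>))"
    by (rule weighted_V_integrable[of "\<lambda>v \<omega>. z \<omega>" 1]) (use sub z in auto)
  have 1: "AE \<omega> in M. (Y u \<omega> - Y t \<omega>) * z \<omega> = (LBINT v. indicat_real {t<..u} v * (V v \<omega> * z \<omega>))"
    using Y_primitive
  proof eventually_elim
    case (elim \<omega>)
    from primitive_on_increment[OF elim assms(1-3)] show ?case
      by (simp add: set_lebesgue_integral_def mult.assoc[symmetric])
  qed
  have "Y u \<in> borel_measurable M" "Y t \<in> borel_measurable M"
    using Y_integrable[of u] Y_integrable[of t] assms by auto
  then have "expectation (\<lambda>\<omega>. (Y u \<omega> - Y t \<omega>) * z \<omega>) =
     expectation (\<lambda>\<omega>. LBINT v. indicat_real {t<..u} v * (V v \<omega> * z \<omega>))"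
    using 1 borel_measurable_integrable[OF prod.integrable_snd[OF int]] by (intro integral_cong_AE) auto
  also have "\<dots> = (LBINT v. expectation (\<lambda>\<omega>. indicat_real {t<..u} v * (V v \<omega> * z \<omega>)))"
    using prod.Fubini_integral[OF int] .
  finally show "expectation (\<lambda>\<omega>. (Y u \<omega> - Y t \<omega>) * z \<omega>) = (LBINT v:{t<..u}. expectation (\<lambda>\<omega>. V v \<omega> * z \<omega>))"
    by (simp add: set_lebesgue_integral_def)
  show "set_integrable lborel {t<..u} (\<lambda>v. expectation (\<lambda>\<omega>. V v \<omega> * z \<omega>))"
    using prod.integrable_fst[OF int] by (simp add: set_integrable_def)
qed

definition "rate_bound = Max (range (\<lambda>(c, b). \<bar>rate c b\<bar>))"

lemma rate_bound: "\<bar>rate c b\<bar> \<le> rate_bound"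
  unfolding rate_bound_def by (rule Max_ge) (auto intro: range_eqI[of _ _ "(c, b)"])

lemma rate_bound_nonneg: "0 \<le> rate_bound"
  using rate_bound[of undefined undefined] by linarith

lemma rate_regime_eq: "rate (s u \<omega>) a = (\<Sum>c\<in>UNIV. rate c a * ind c u \<omega>)"
  by (simp add: indicator_def of_bool_def if_distrib sum.delta cong: if_cong)

lemma product_rate_measurable:
  "(\<lambda>(u, \<omega>). indicat_real {0..T} u * rate (s u \<omega>) a) \<in> borel_measurable \<mu>"
proof -
  have [measurable]: "(\<lambda>p. indicat_real {0..T} (fst p) * ind c (fst p) (snd p)) \<in> borel_measurable \<mu>" for c
    using product_regime_measurable by (simp add: case_prod_beta')
  have "(\<lambda>p. \<Sum>c\<in>UNIV. rate c a * (indicat_real {0..T} (fst p) * ind c (fst p) (snd p))) \<in> borel_measurable \<mu>"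
    by measurable
  also have "(\<lambda>p. \<Sum>c\<in>UNIV. rate c a * (indicat_real {0..T} (fst p) * ind c (fst p) (snd p))) =
      (\<lambda>(u, \<omega>). indicat_real {0..T} u * rate (s u \<omega>) a)"
    by (simp only: fun_eq_iff case_prod_beta' rate_regime_eq sum_distrib_left mult.left_commute) simp
  finally show ?thesis .
qed

lemma Y_bounded_mult_integrable:
  assumes "t \<in> {0..T}" "z \<in> borel_measurable M" "\<And>\<omega>. \<bar>z \<omega>\<bar> \<le> C"
  shows "integrable M (\<lambda>\<omega>. Y t \<omega> * z \<omega>)"
proof (rule Bochner_Integration.integrable_bound)
  show "integrable M (\<lambda>\<omega>. C * Y t \<omega>)" using Y_integrable[OF assms(1)] by simp
  show "(\<lambda>\<omega>. Y t \<omega> * z \<omega>) \<in> borel_measurable M"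
    using Y_integrable[OF assms(1)] assms(2) by simp
  have "\<bar>z \<omega>\<bar> * \<bar>Y t \<omega>\<bar> \<le> \<bar>C\<bar> * \<bar>Y t \<omega>\<bar>" for \<omega>
    using assms(3)[of \<omega>] by (intro mult_right_mono) auto
  then show "AE \<omega> in M. norm (Y t \<omega> * z \<omega>) \<le> norm (C * Y t \<omega>)"
    by (simp add: abs_mult mult.commute)
qed

text \<open>
  The rate of change of \<open>Y\<close> on the event that the regime is \<open>a\<close>: the velocity of \<open>Y\<close> there, and the
  probability that flows into regime \<open>a\<close> (out of it if the current regime is \<open>a\<close>, since \<open>rate a a\<close>
  is negative).
\<close>

definition "generator a u \<omega> = V u \<omega> * ind a u \<omega> + Y u \<omega> * rate (s u \<omega>) a"

lemma V_regime_integrable: "integrable \<mu> (\<lambda>(u, \<omega>). indicat_real {0..T} u * (V u \<omega> * ind a u \<omega>))"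
proof -
  have "integrable \<mu> (\<lambda>(u, \<omega>). indicat_real {0..T} u * (V u \<omega> * (indicat_real {0..T} u * ind a u \<omega>)))"
    by (rule weighted_V_integrable[OF product_regime_measurable, where C = 1 and S = "{0..T}"]) (auto simp: indicator_def)
  also have "(\<lambda>(u, \<omega>). indicat_real {0..T} u * (V u \<omega> * (indicat_real {0..T} u * ind a u \<omega>))) =
     (\<lambda>(u, \<omega>). indicat_real {0..T} u * (V u \<omega> * ind a u \<omega>))"
    by (auto simp: fun_eq_iff indicator_def)
  finally show ?thesis .
qed

lemma Y_rate_integrable: "integrable \<mu> (\<lambda>(u, \<omega>). indicat_real {0..T} u * (Y u \<omega> * rate (s u \<omega>) a))"
proof (rule Bochner_Integration.integrable_bound)
  show "integrable \<mu> (\<lambda>p. rate_bound * (on_horizon Y p))"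
    by (intro integrable_mult_right Y_product_integrable)
  have [measurable]: "(\<lambda>p. indicat_real {0..T} (fst p) * Y (fst p) (snd p)) \<in> borel_measurable \<mu>"
    "(\<lambda>p. indicat_real {0..T} (fst p) * rate (s (fst p) (snd p)) a) \<in> borel_measurable \<mu>"
    using Y_measurable product_rate_measurable by (simp_all add: case_prod_beta')
  have "(\<lambda>p. (indicat_real {0..T} (fst p) * Y (fst p) (snd p)) * (indicat_real {0..T} (fst p) * rate (s (fst p) (snd p)) a)) \<in> borel_measurable \<mu>"
    by measurable
  also have "(\<lambda>p. (indicat_real {0..T} (fst p) * Y (fst p) (snd p)) * (indicat_real {0..T} (fst p) * rate (s (fst p) (snd p)) a))
     = (\<lambda>(u, \<omega>). indicat_real {0..T} u * (Y u \<omega> * rate (s u \<omega>) a))"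
    by (auto simp: fun_eq_iff indicator_def)
  finally show "(\<lambda>(u, \<omega>). indicat_real {0..T} u * (Y u \<omega> * rate (s u \<omega>) a)) \<in> borel_measurable \<mu>" .
  have "\<bar>rate (s u \<omega>) a\<bar> * \<bar>Y u \<omega>\<bar> \<le> rate_bound * \<bar>Y u \<omega>\<bar>" for u \<omega>
    by (intro mult_right_mono rate_bound) auto
  then show "AE p in \<mu>. norm (case p of (u, \<omega>) \<Rightarrow> indicat_real {0..T} u * (Y u \<omega> * rate (s u \<omega>) a))
     \<le> norm (rate_bound * (on_horizon Y p))"
    using rate_bound_nonneg by (intro AE_I2) (auto simp: indicator_def abs_mult mult.commute split: prod.splits)
qed

lemma generator_integrable: "integrable \<mu> (on_horizon (generator a))"
  using Bochner_Integration.integrable_add[OF V_regime_integrable Y_rate_integrable, of a a]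
  by (simp add: generator_def case_prod_beta' distrib_left)

text \<open>
  The case \<open>\<eta> = 1\<close> of the switching estimate, with the drift absorbed in the bound.
\<close>

lemma regime_drift_bound:
  "\<exists>\<epsilon>0>0. \<forall>a t t' X. 0 \<le> t \<longrightarrow> t \<le> t' \<longrightarrow> t' \<le> T \<longrightarrow> t' - t < \<epsilon>0 \<longrightarrow>
     X \<in> borel_measurable (F t) \<longrightarrow> integrable M X \<longrightarrow>
     \<bar>expectation (\<lambda>\<omega>. X \<omega> * (ind a t' \<omega> - ind a t \<omega>))\<bar>
       \<le> (1 + rate_bound) * (t' - t) * expectation (\<lambda>\<omega>. \<bar>X \<omega>\<bar>)"
proof -
  obtain \<epsilon>0 where "0 < \<epsilon>0" and \<epsilon>0: "\<forall>a t t' X. 0 \<le> t \<longrightarrow> t < t' \<longrightarrow> t' \<le> T \<longrightarrow> t' - t < \<epsilon>0 \<longrightarrow>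
       X \<in> borel_measurable (F t) \<longrightarrow> integrable M X \<longrightarrow>
       \<bar>expectation (\<lambda>\<omega>. X \<omega> * (ind a t' \<omega> - ind a t \<omega> - (t' - t) * rate (s t \<omega>) a))\<bar>
         \<le> 1 * (t' - t) * expectation (\<lambda>\<omega>. \<bar>X \<omega>\<bar>)"
    using expected_switching_estimate[of 1] by auto
  have "\<bar>expectation (\<lambda>\<omega>. X \<omega> * (ind a t' \<omega> - ind a t \<omega>))\<bar>
       \<le> (1 + rate_bound) * (t' - t) * expectation (\<lambda>\<omega>. \<bar>X \<omega>\<bar>)"
    if t: "0 \<le> t" "t \<le> t'" "t' \<le> T" "t' - t < \<epsilon>0" and X: "X \<in> borel_measurable (F t)" "integrable M X" for a t t' X
  proof (cases "t = t'")
    case False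
    define A where "A \<omega> = X \<omega> * (ind a t' \<omega> - ind a t \<omega>)" for \<omega>
    define B where "B \<omega> = X \<omega> * rate (s t \<omega>) a" for \<omega>
    have [measurable]: "s t' \<in> measurable M (count_space UNIV)" "s t \<in> measurable M (count_space UNIV)"
      using t by (auto intro!: measurable_regime)
    have [measurable]: "X \<in> borel_measurable M" using X by simp
    have A: "integrable M A"
      unfolding A_def by (rule Bochner_Integration.integrable_bound[OF X(2)]) (auto simp: indicator_def)
    have B_le: "\<bar>B \<omega>\<bar> \<le> rate_bound * \<bar>X \<omega>\<bar>" for \<omega>
      using mult_right_mono[OF rate_bound, of "\<bar>X \<omega>\<bar>" "s t \<omega>" a] by (simp add: B_def abs_mult mult.commute)
    have B: "integrable M B"
    proof (rule Bochner_Integration.integrable_bound)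
      show "integrable M (\<lambda>\<omega>. rate_bound * X \<omega>)" using X(2) by simp
      show "B \<in> borel_measurable M" unfolding B_def by measurable
      show "AE \<omega> in M. norm (B \<omega>) \<le> norm (rate_bound * X \<omega>)"
        using B_le rate_bound_nonneg by (simp add: abs_mult)
    qed
    have "\<bar>expectation (\<lambda>\<omega>. A \<omega> - (t' - t) * B \<omega>)\<bar> \<le> (t' - t) * expectation (\<lambda>\<omega>. \<bar>X \<omega>\<bar>)"
      using \<epsilon>0[rule_format, of t t' X a] t X False by (simp add: A_def B_def algebra_simps)
    moreover have "expectation (\<lambda>\<omega>. A \<omega> - (t' - t) * B \<omega>) = expectation A - (t' - t) * expectation B"
      using A B by simp
    moreover have "\<bar>expectation B\<bar> \<le> rate_bound * expectation (\<lambda>\<omega>. \<bar>X \<omega>\<bar>)"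
    proof -
      have "\<bar>expectation B\<bar> \<le> expectation (\<lambda>\<omega>. \<bar>B \<omega>\<bar>)" by (rule integral_abs_bound)
      also have "\<dots> \<le> expectation (\<lambda>\<omega>. rate_bound * \<bar>X \<omega>\<bar>)"
        using B X(2) B_le by (intro integral_mono) auto
      finally show ?thesis by simp
    qed
    then have "\<bar>(t' - t) * expectation B\<bar> \<le> (t' - t) * (rate_bound * expectation (\<lambda>\<omega>. \<bar>X \<omega>\<bar>))"
      using t unfolding abs_mult by (simp add: mult_left_mono)
    ultimately have "\<bar>expectation A\<bar> \<le> (t' - t) * expectation (\<lambda>\<omega>. \<bar>X \<omega>\<bar>) + (t' - t) * (rate_bound * expectation (\<lambda>\<omega>. \<bar>X \<omega>\<bar>))"
      by linarith
    then have "\<bar>expectation A\<bar> \<le> (1 + rate_bound) * (t' - t) * expectation (\<lambda>\<omega>. \<bar>X \<omega>\<bar>)"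
      by (simp add: algebra_simps)
    then show ?thesis unfolding A_def .
  qed simp
  with \<open>0 < \<epsilon>0\<close> show ?thesis by blast
qed

text \<open>
  The paths of \<open>s\<close> need not have left limits, but the weighted probability of each regime is
  continuous in time. This is what allows values at the left end of a short interval to be replaced
  by values inside it.
\<close>

lemma regime_expectation_continuous:
  "\<exists>\<epsilon>0>0. \<forall>c t u. 0 \<le> t \<longrightarrow> t \<le> u \<longrightarrow> u \<le> T \<longrightarrow> u - t < \<epsilon>0 \<longrightarrow>
     \<bar>regime_mean c u - regime_mean c t\<bar>
       \<le> (LBINT v:{t<..u}. speed v) + (1 + rate_bound) * (u - t) * expectation envelope"
proof -
  obtain \<epsilon>0 where "0 < \<epsilon>0" and \<epsilon>0: "\<forall>a t t' X. 0 \<le> t \<longrightarrow> t \<le> t' \<longrightarrow> t' \<le> T \<longrightarrow> t' - t < \<epsilon>0 \<longrightarrow>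
     X \<in> borel_measurable (F t) \<longrightarrow> integrable M X \<longrightarrow>
     \<bar>expectation (\<lambda>\<omega>. X \<omega> * (ind a t' \<omega> - ind a t \<omega>))\<bar>
       \<le> (1 + rate_bound) * (t' - t) * expectation (\<lambda>\<omega>. \<bar>X \<omega>\<bar>)"
    using regime_drift_bound by blast
  have "\<bar>regime_mean c u - regime_mean c t\<bar>
       \<le> (LBINT v:{t<..u}. speed v) + (1 + rate_bound) * (u - t) * expectation envelope"
    if t: "0 \<le> t" "t \<le> u" "u \<le> T" "u - t < \<epsilon>0" for c t u
  proof -
    have [measurable]: "s u \<in> measurable M (count_space UNIV)" "s t \<in> measurable M (count_space UNIV)"
      using t by (auto intro!: measurable_regime)
    have i1: "integrable M (\<lambda>\<omega>. Y u \<omega> * ind c u \<omega>)"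
      and i2: "integrable M (\<lambda>\<omega>. Y t \<omega> * ind c t \<omega>)"
      and i3: "integrable M (\<lambda>\<omega>. Y t \<omega> * ind c u \<omega>)"
      using t by (auto intro!: Y_bounded_mult_integrable[where C = 1])
    have "regime_mean c u - regime_mean c t
      = expectation (\<lambda>\<omega>. (Y u \<omega> - Y t \<omega>) * ind c u \<omega>)
        + expectation (\<lambda>\<omega>. Y t \<omega> * (ind c u \<omega> - ind c t \<omega>))"
      using i1 i2 i3 by (simp add: algebra_simps)
    moreover have "\<bar>expectation (\<lambda>\<omega>. (Y u \<omega> - Y t \<omega>) * ind c u \<omega>)\<bar> \<le> (LBINT v:{t<..u}. speed v)"
    proof -
      have "\<bar>expectation (\<lambda>\<omega>. (Y u \<omega> - Y t \<omega>) * ind c u \<omega>)\<bar>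
         \<le> expectation (\<lambda>\<omega>. \<bar>(Y u \<omega> - Y t \<omega>) * ind c u \<omega>\<bar>)"
        by (rule integral_abs_bound)
      also have "\<dots> \<le> expectation (\<lambda>\<omega>. \<bar>Y u \<omega> - Y t \<omega>\<bar>)"
      proof (rule integral_mono)
        show "integrable M (\<lambda>\<omega>. \<bar>(Y u \<omega> - Y t \<omega>) * ind c u \<omega>\<bar>)"
          using i1 i3 by (intro integrable_abs) (simp add: left_diff_distrib)
      qed (use Y_integrable[of u] Y_integrable[of t] t in \<open>auto simp: indicator_def\<close>)
      also have "\<dots> \<le> (LBINT v:{t<..u}. speed v)" using t by (intro expectation_increment_le)
      finally show ?thesis .
    qed
    moreover have "\<bar>expectation (\<lambda>\<omega>. Y t \<omega> * (ind c u \<omega> - ind c t \<omega>))\<bar>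
       \<le> (1 + rate_bound) * (u - t) * expectation envelope"
    proof -
      have "\<bar>expectation (\<lambda>\<omega>. Y t \<omega> * (ind c u \<omega> - ind c t \<omega>))\<bar>
         \<le> (1 + rate_bound) * (u - t) * expectation (\<lambda>\<omega>. \<bar>Y t \<omega>\<bar>)"
        using \<epsilon>0[rule_format, of t u "Y t" c] t Y_adapted[of t] Y_integrable[of t] by auto
      also have "\<dots> \<le> (1 + rate_bound) * (u - t) * expectation envelope"
        using t rate_bound_nonneg Y_abs_expectation_le[of t] by (intro mult_left_mono) auto
      finally show ?thesis .
    qed
    ultimately show ?thesis by linarith
  qed
  with \<open>0 < \<epsilon>0\<close> show ?thesis by blast
qed

definition "mean_generator a u = expectation (\<lambda>\<omega>. generator a u \<omega>)"

lemma mean_generator_integrable: "set_integrable lborel {0..T} (mean_generator a)"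
  using prod.integrable_fst[OF generator_integrable[of a]] by (simp add: set_integrable_def mean_generator_def)

text \<open>
  Over \<open>{t<..t'}\<close> the increment is split as
  \<open>(Y t' - Y t) * ind a t' + Y t * (ind a t' - ind a t)\<close>.
  In the first part the regime at \<open>t'\<close> is replaced by the one at \<open>u\<close>, with an error of order
  \<open>t' - u\<close> because \<open>V u\<close> is known at time \<open>u\<close> (estimate \<open>E1\<close>). In the second part the indicator
  of the regime at \<open>t'\<close> is replaced by its conditional probability (estimate \<open>E2\<close>), and then the
  left end \<open>t\<close> by \<open>u\<close> (estimate \<open>E3\<close>).
\<close>

lemma local_dynkin_estimate:
  assumes "0 < e"
  shows "\<exists>d>0. \<forall>t t'. 0 \<le> t \<longrightarrow> t < t' \<longrightarrow> t' \<le> T \<longrightarrow> t' - t < d \<longrightarrow>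
    \<bar>regime_mean a t' - regime_mean a t
       - (LBINT u:{t<..t'}. mean_generator a u)\<bar>
      \<le> e * ((LBINT u:{t<..t'}. speed u) + (t' - t))"
proof -
  define L where "L = 1 + rate_bound"
  define R where "R = expectation envelope"
  define N where "N = real CARD('s)"
  have R0: "0 \<le> R"
  proof -
    have "0 \<le> expectation (\<lambda>\<omega>. \<bar>Y 0 \<omega>\<bar>)" by simp
    also have "\<dots> \<le> R"
      unfolding R_def using horizon_pos by (intro Y_abs_expectation_le) simp
    finally show ?thesis .
  qed
  have L1: "1 \<le> L" using rate_bound_nonneg by (simp add: L_def)
  \<comment> \<open>collects the constants of \<open>E1\<close>, \<open>E2\<close> and \<open>E3\<close>, so that \<open>\<eta> * G = e\<close>\<close>
  define G where "G = L + R + N * rate_bound * (1 + L * R)"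
  have G: "1 \<le> G" "L \<le> G" "R + N * rate_bound * (1 + L * R) \<le> G"
    using R0 L1 rate_bound_nonneg by (auto simp: G_def N_def intro!: add_increasing2 mult_nonneg_nonneg add_nonneg_nonneg)
  define \<eta> where "\<eta> = e / G"
  have \<eta>: "0 < \<eta>" "\<eta> * G = e" using assms G by (auto simp: \<eta>_def)
  obtain \<epsilon>1 where "0 < \<epsilon>1" and \<epsilon>1: "\<forall>a t t' X. 0 \<le> t \<longrightarrow> t < t' \<longrightarrow> t' \<le> T \<longrightarrow> t' - t < \<epsilon>1 \<longrightarrow>
       X \<in> borel_measurable (F t) \<longrightarrow> integrable M X \<longrightarrow>
       \<bar>expectation (\<lambda>\<omega>. X \<omega> * (ind a t' \<omega> - ind a t \<omega> - (t' - t) * rate (s t \<omega>) a))\<bar>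
         \<le> \<eta> * (t' - t) * expectation (\<lambda>\<omega>. \<bar>X \<omega>\<bar>)"
    using expected_switching_estimate[OF \<eta>(1)] by blast
  obtain \<epsilon>2 where "0 < \<epsilon>2" and \<epsilon>2: "\<forall>a t t' X. 0 \<le> t \<longrightarrow> t \<le> t' \<longrightarrow> t' \<le> T \<longrightarrow> t' - t < \<epsilon>2 \<longrightarrow>
     X \<in> borel_measurable (F t) \<longrightarrow> integrable M X \<longrightarrow>
     \<bar>expectation (\<lambda>\<omega>. X \<omega> * (ind a t' \<omega> - ind a t \<omega>))\<bar>
       \<le> L * (t' - t) * expectation (\<lambda>\<omega>. \<bar>X \<omega>\<bar>)"
    unfolding L_def using regime_drift_bound by blast
  obtain \<epsilon>3 where "0 < \<epsilon>3" and \<epsilon>3: "\<forall>c t u. 0 \<le> t \<longrightarrow> t \<le> u \<longrightarrow> u \<le> T \<longrightarrow> u - t < \<epsilon>3 \<longrightarrow>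
     \<bar>regime_mean c u - regime_mean c t\<bar>
       \<le> (LBINT v:{t<..u}. speed v) + L * (u - t) * R"
    unfolding L_def R_def using regime_expectation_continuous by blast
  obtain \<epsilon>4 where "0 < \<epsilon>4" and \<epsilon>4: "\<And>t u. 0 \<le> t \<Longrightarrow> t \<le> u \<Longrightarrow> u \<le> T \<Longrightarrow> u - t < \<epsilon>4 \<Longrightarrow>
       \<bar>LBINT v:{t<..u}. speed v\<bar> < \<eta>"
    using set_integral_uniformly_small[OF speed_integrable \<eta>(1)] by blast
  define d where "d = Min {\<epsilon>1, \<epsilon>2, \<epsilon>3, \<epsilon>4, \<eta>}"
  have "0 < d" using \<open>0 < \<epsilon>1\<close> \<open>0 < \<epsilon>2\<close> \<open>0 < \<epsilon>3\<close> \<open>0 < \<epsilon>4\<close> \<eta>(1) by (simp add: d_def)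
  have d_le: "d \<le> \<epsilon>1" "d \<le> \<epsilon>2" "d \<le> \<epsilon>3" "d \<le> \<epsilon>4" "d \<le> \<eta>" by (simp_all add: d_def)
  have "\<bar>regime_mean a t' - regime_mean a t
       - (LBINT u:{t<..t'}. mean_generator a u)\<bar>
      \<le> e * ((LBINT u:{t<..t'}. speed u) + (t' - t))"
    if t: "0 \<le> t" "t < t'" "t' \<le> T" and len: "t' - t < d" for t t'
  proof -
    define S where "S = {t<..t'}"
    have sub: "S \<subseteq> {0..T}" using t by (auto simp: S_def)
    have tT: "t \<in> {0..T}" "t' \<in> {0..T}" using t by auto
    have [measurable]: "s t' \<in> measurable M (count_space UNIV)" "s t \<in> measurable M (count_space UNIV)"
      using tT by (auto intro!: measurable_regime)
    define p where "p c u = regime_mean c u" for c u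
    define V1 where "V1 u = expectation (\<lambda>\<omega>. V u \<omega> * ind a t' \<omega>)" for u
    define V2 where "V2 u = expectation (\<lambda>\<omega>. V u \<omega> * ind a u \<omega>)" for u
    define Y2 where "Y2 u = expectation (\<lambda>\<omega>. Y u \<omega> * rate (s u \<omega>) a)" for u
    have speedS: "set_integrable lborel S speed"
      using speed_integrable sub by (auto intro: set_integrable_subset simp: S_def)
    have V2S: "set_integrable lborel S V2"
    proof -
      have "set_integrable lborel {0..T} V2"
        using prod.integrable_fst[OF V_regime_integrable[of a]] by (simp add: set_integrable_def V2_def)
      then show ?thesis using sub by (auto intro: set_integrable_subset simp: S_def)
    qed
    have Y2S: "set_integrable lborel S Y2"
    proof -
      have "set_integrable lborel {0..T} Y2"
        using prod.integrable_fst[OF Y_rate_integrable[of a]] by (simp add: set_integrable_def Y2_def)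
      then show ?thesis using sub by (auto intro: set_integrable_subset simp: S_def)
    qed
    have V1S: "set_integrable lborel S V1"
      and incr: "expectation (\<lambda>\<omega>. (Y t' \<omega> - Y t \<omega>) * ind a t' \<omega>) = (LBINT u:S. V1 u)"
      using expectation_increment_weighted[of t t' "\<lambda>\<omega>. ind a t' \<omega>"] t
      by (simp_all add: V1_def[abs_def] S_def)
    have Y2_eq: "Y2 u = (\<Sum>c\<in>UNIV. rate c a * p c u)" if "u \<in> {0..T}" for u
    proof -
      have [measurable]: "s u \<in> measurable M (count_space UNIV)" using that by (rule measurable_regime)
      have "integrable M (\<lambda>\<omega>. rate c a * (Y u \<omega> * ind c u \<omega>))" for c
        using that by (intro integrable_mult_right Y_bounded_mult_integrable[where C = 1]) auto
      then have "expectation (\<lambda>\<omega>. \<Sum>c\<in>UNIV. rate c a * (Y u \<omega> * ind c u \<omega>))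
          = (\<Sum>c\<in>UNIV. expectation (\<lambda>\<omega>. rate c a * (Y u \<omega> * ind c u \<omega>)))"
        by (rule Bochner_Integration.integral_sum)
      moreover have "Y2 u = expectation (\<lambda>\<omega>. \<Sum>c\<in>UNIV. rate c a * (Y u \<omega> * ind c u \<omega>))"
        unfolding Y2_def rate_regime_eq[of u] sum_distrib_left by (simp only: mult.left_commute)
      ultimately show ?thesis by (simp add: p_def)
    qed
    have gen: "(LBINT u:S. mean_generator a u) = (LBINT u:S. V2 u) + (LBINT u:S. Y2 u)"
    proof -
      have "AE u in lborel. u \<in> S \<longrightarrow> mean_generator a u = V2 u + Y2 u"
        using prod.AE_integrable_fst[OF V_regime_integrable[of a]] prod.AE_integrable_fst[OF Y_rate_integrable[of a]]
      proof eventually_elim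
        case (elim u)
        show ?case
          using elim sub by (auto simp: mean_generator_def generator_def V2_def Y2_def S_def)
      qed
      then have AE: "AE u in lborel. indicat_real S u *\<^sub>R mean_generator a u = indicat_real S u *\<^sub>R (V2 u + Y2 u)"
        by eventually_elim (auto simp: indicator_def)
      have "set_integrable lborel S (mean_generator a)"
        using mean_generator_integrable[of a] sub by (auto intro: set_integrable_subset simp: S_def)
      then have "(LBINT u:S. mean_generator a u) = (LBINT u:S. V2 u + Y2 u)"
        using set_integral_add(1)[OF V2S Y2S] unfolding set_lebesgue_integral_def set_integrable_def
        by (intro integral_cong_AE AE borel_measurable_integrable)
      then show ?thesis using set_integral_add(2)[OF V2S Y2S] by simp
    qed
    have E1: "\<bar>(LBINT u:S. V1 u - V2 u)\<bar> \<le> \<eta> * L * (LBINT u:S. speed u)"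
    proof -
      have "\<bar>(LBINT u:S. V1 u - V2 u)\<bar> \<le> (LBINT u:S. \<eta> * L * speed u)"
      proof (rule abs_set_integral_le)
        show "set_integrable lborel S (\<lambda>u. V1 u - V2 u)" using V1S V2S by (rule set_integral_diff(1))
        show "set_integrable lborel S (\<lambda>u. \<eta> * L * speed u)" using speedS by (rule set_integrable_mult_right)
        show "AE u in lborel. u \<in> S \<longrightarrow> \<bar>V1 u - V2 u\<bar> \<le> \<eta> * L * speed u"
          using V_integrable_AE
        proof eventually_elim
          case (elim u)
          show ?case
          proof
            assume u: "u \<in> S"
            then have uT: "u \<in> {0..T}" "0 \<le> u" "u \<le> t'" "t' - u < \<epsilon>2" "t' - u < \<eta>"
              using sub len d_le t by (auto simp: S_def)
            have [measurable]: "s u \<in> measurable M (count_space UNIV)" using uT(1) by (rule measurable_regime)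
            have Vu: "integrable M (V u)" using elim uT by simp
            then have [measurable]: "V u \<in> borel_measurable M" by simp
            have "integrable M (\<lambda>\<omega>. V u \<omega> * ind a t' \<omega>)" "integrable M (\<lambda>\<omega>. V u \<omega> * ind a u \<omega>)"
              by (rule Bochner_Integration.integrable_bound[OF Vu]; auto simp: indicator_def)+
            then have "V1 u - V2 u = expectation (\<lambda>\<omega>. V u \<omega> * (ind a t' \<omega> - ind a u \<omega>))"
              by (simp add: V1_def V2_def right_diff_distrib)
            then have "\<bar>V1 u - V2 u\<bar> \<le> L * (t' - u) * speed u"
              using \<epsilon>2[rule_format, of u t' "V u" a] uT t Vu V_adapted by (simp add: speed_def)
            also have "\<dots> \<le> L * \<eta> * speed u"
              using L1 uT speed_nonneg by (intro mult_right_mono mult_left_mono) auto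
            finally show "\<bar>V1 u - V2 u\<bar> \<le> \<eta> * L * speed u" by (simp add: mult.commute)
          qed
        qed
      qed
      then show ?thesis by simp
    qed
    have E2: "\<bar>expectation (\<lambda>\<omega>. Y t \<omega> * (ind a t' \<omega> - ind a t \<omega>)) - (t' - t) * Y2 t\<bar>
       \<le> \<eta> * (t' - t) * R"
    proof -
      have i: "integrable M (\<lambda>\<omega>. Y t \<omega> * (ind a t' \<omega> - ind a t \<omega>))"
          "integrable M (\<lambda>\<omega>. Y t \<omega> * rate (s t \<omega>) a)"
        by (rule Y_bounded_mult_integrable[where C = 1], use tT in \<open>auto simp: indicator_def\<close>)
           (rule Y_bounded_mult_integrable[where C = rate_bound], use tT rate_bound in auto)
      have "expectation (\<lambda>\<omega>. Y t \<omega> * (ind a t' \<omega> - ind a t \<omega>)) - (t' - t) * Y2 t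
        = expectation (\<lambda>\<omega>. Y t \<omega> * (ind a t' \<omega> - ind a t \<omega>) - (t' - t) * (Y t \<omega> * rate (s t \<omega>) a))"
        using i by (simp add: Y2_def)
      also have "\<dots> = expectation (\<lambda>\<omega>. Y t \<omega> * (ind a t' \<omega> - ind a t \<omega> - (t' - t) * rate (s t \<omega>) a))"
        by (simp add: algebra_simps)
      also have "\<bar>\<dots>\<bar> \<le> \<eta> * (t' - t) * expectation (\<lambda>\<omega>. \<bar>Y t \<omega>\<bar>)"
        using \<epsilon>1[rule_format, of t t' "Y t" a] t len d_le Y_adapted[OF tT(1)] Y_integrable[OF tT(1)] by simp
      also have "\<dots> \<le> \<eta> * (t' - t) * R"
        using \<eta> t Y_abs_expectation_le[OF tT(1)] by (intro mult_left_mono) (auto simp: R_def)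
      finally show ?thesis .
    qed
    have const: "set_integrable lborel S (\<lambda>u. c)" "(LBINT u:S. c) = (t' - t) * c" for c :: real
      using t by (auto simp: S_def set_integrable_def set_lebesgue_integral_def)
    have E3: "\<bar>(LBINT u:S. Y2 t - Y2 u)\<bar> \<le> (t' - t) * (N * rate_bound * (\<eta> * (1 + L * R)))"
    proof -
      have "\<bar>(LBINT u:S. Y2 t - Y2 u)\<bar> \<le> (LBINT u:S. N * rate_bound * (\<eta> * (1 + L * R)))"
      proof (rule abs_set_integral_le)
        show "set_integrable lborel S (\<lambda>u. Y2 t - Y2 u)" using const(1) Y2S by (rule set_integral_diff(1))
        show "AE u in lborel. u \<in> S \<longrightarrow> \<bar>Y2 t - Y2 u\<bar> \<le> N * rate_bound * (\<eta> * (1 + L * R))"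
        proof (intro AE_I2 impI)
          fix u assume "u \<in> S"
          then have u: "u \<in> {0..T}" "t \<le> u" "u \<le> T" "u - t < d"
            using sub len by (auto simp: S_def)
          have pc: "\<bar>p c t - p c u\<bar> \<le> \<eta> * (1 + L * R)" for c
          proof -
            have "\<bar>p c u - p c t\<bar> \<le> (LBINT v:{t<..u}. speed v) + L * (u - t) * R"
              unfolding p_def using \<epsilon>3[rule_format, of t u c] t u d_le by linarith
            moreover have "(LBINT v:{t<..u}. speed v) < \<eta>"
              using \<epsilon>4[of t u] t u d_le by linarith
            moreover have "L * (u - t) * R \<le> L * \<eta> * R"
              using L1 R0 u d_le by (intro mult_right_mono mult_left_mono) auto
            moreover have "\<eta> * (1 + L * R) = \<eta> + L * \<eta> * R" by (simp add: algebra_simps)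
            ultimately show ?thesis by linarith
          qed
          have "Y2 t - Y2 u = (\<Sum>c\<in>UNIV. rate c a * (p c t - p c u))"
            by (simp add: Y2_eq[OF tT(1)] Y2_eq[OF u(1)] right_diff_distrib sum_subtractf)
          then have "\<bar>Y2 t - Y2 u\<bar> \<le> (\<Sum>c\<in>UNIV. \<bar>rate c a * (p c t - p c u)\<bar>)" by (simp add: sum_abs)
          also have "\<dots> \<le> (\<Sum>c\<in>(UNIV::'s set). rate_bound * (\<eta> * (1 + L * R)))"
            unfolding abs_mult by (intro sum_mono mult_mono rate_bound pc) (auto simp: rate_bound_nonneg)
          also have "\<dots> = N * rate_bound * (\<eta> * (1 + L * R))" by (simp add: N_def)
          finally show "\<bar>Y2 t - Y2 u\<bar> \<le> N * rate_bound * (\<eta> * (1 + L * R))" .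
        qed
      qed (rule const)
      then show ?thesis by (simp only: const)
    qed
    have i: "integrable M (\<lambda>\<omega>. Y t' \<omega> * ind a t' \<omega>)"
      "integrable M (\<lambda>\<omega>. Y t \<omega> * ind a t \<omega>)"
      "integrable M (\<lambda>\<omega>. Y t \<omega> * ind a t' \<omega>)"
      using tT by (auto intro!: Y_bounded_mult_integrable[where C = 1])
    have "p a t' - p a t = (LBINT u:S. V1 u)
        + expectation (\<lambda>\<omega>. Y t \<omega> * (ind a t' \<omega> - ind a t \<omega>))"
      unfolding incr[symmetric] p_def using i by (simp add: algebra_simps)
    moreover have "(LBINT u:S. V1 u - V2 u) = (LBINT u:S. V1 u) - (LBINT u:S. V2 u)"
      using V1S V2S by (rule set_integral_diff(2))
    moreover have "(LBINT u:S. Y2 t - Y2 u) = (t' - t) * Y2 t - (LBINT u:S. Y2 u)"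
      using set_integral_diff(2)[OF const(1) Y2S, of "Y2 t"] by (simp only: const(2))
    ultimately have "\<bar>p a t' - p a t - (LBINT u:S. mean_generator a u)\<bar>
       \<le> \<eta> * L * (LBINT u:S. speed u) + \<eta> * (t' - t) * R + (t' - t) * (N * rate_bound * (\<eta> * (1 + L * R)))"
      using gen E1 E2 E3 by linarith
    also have "\<dots> = \<eta> * L * (LBINT u:S. speed u) + \<eta> * (R + N * rate_bound * (1 + L * R)) * (t' - t)"
      by (simp add: algebra_simps)
    also have "\<dots> \<le> \<eta> * G * (LBINT u:S. speed u) + \<eta> * G * (t' - t)"
    proof (intro add_mono mult_right_mono mult_left_mono G)
      show "0 \<le> (LBINT u:S. speed u)"
        by (auto simp: set_lebesgue_integral_def speed_nonneg intro!: integral_nonneg_AE)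
    qed (use \<eta> t in auto)
    also have "\<dots> = e * ((LBINT u:S. speed u) + (t' - t))"
      by (simp add: \<eta> distrib_left)
    finally show ?thesis by (simp add: p_def S_def)
  qed
  with \<open>0 < d\<close> show ?thesis by blast
qed

theorem dynkin_formula:
  "regime_mean a T = regime_mean a 0
     + integral\<^sup>L \<mu> (on_horizon (generator a))"
proof -
  define h where "h t = regime_mean a t - (LBINT u:{0..t}. mean_generator a u)" for t
  define K where "K t = (LBINT u:{0..t}. speed u) + t" for t
  have "h T = h 0"
  proof (rule constant_if_locally_small_increments[where h = h and K = K and a = 0 and b = T])
    fix e :: real assume "0 < e"
    have h_diff: "h t' - h t = regime_mean a t' - regime_mean a t
       - (LBINT u:{t<..t'}. mean_generator a u)" if "0 \<le> t" "t < t'" "t' \<le> T" for t t'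
      using set_integral_split_Ioc[OF mean_generator_integrable[of a], of t t'] that by (simp add: h_def)
    have K_diff: "K t' - K t = (LBINT u:{t<..t'}. speed u) + (t' - t)" if "0 \<le> t" "t < t'" "t' \<le> T" for t t'
      using set_integral_split_Ioc[OF speed_integrable, of t t'] that by (simp add: K_def)
    obtain d where "0 < d" and d: "\<forall>t t'. 0 \<le> t \<longrightarrow> t < t' \<longrightarrow> t' \<le> T \<longrightarrow> t' - t < d \<longrightarrow>
      \<bar>regime_mean a t' - regime_mean a t
       - (LBINT u:{t<..t'}. mean_generator a u)\<bar>
      \<le> e * ((LBINT u:{t<..t'}. speed u) + (t' - t))"
      using local_dynkin_estimate[OF \<open>0 < e\<close>] by blast
    show "\<exists>d>0. \<forall>t t'. 0 \<le> t \<longrightarrow> t < t' \<longrightarrow> t' \<le> T \<longrightarrow> t' - t < d \<longrightarrow> \<bar>h t' - h t\<bar> \<le> e * (K t' - K t)"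
    proof (intro exI[of _ d] conjI allI impI)
      fix t t' assume "0 \<le> t" "t < t'" "t' \<le> T" "t' - t < d"
      with d[rule_format, of t t'] show "\<bar>h t' - h t\<bar> \<le> e * (K t' - K t)"
        by (simp only: h_diff K_diff)
    qed (rule \<open>0 < d\<close>)
  qed (use horizon_pos in simp)
  moreover have "(LBINT u:{0..0}. mean_generator a u) = 0"
    by (simp add: set_integral_at_point)
  moreover have "(LBINT u:{0..T}. mean_generator a u)
     = integral\<^sup>L \<mu> (on_horizon (generator a))"
    using prod.integral_fst[OF generator_integrable[of a]] by (simp add: set_lebesgue_integral_def mean_generator_def)
  ultimately show ?thesis by (simp add: h_def)
qed

end

section \<open>The Riccati system\<close>

text \<open>
  The data of the game, with a solution \<open>\<alpha>\<close> of the Riccati system.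
\<close>

locale log_quadratic_game = regime_filtration M F T rate s0 s
  for M :: "'a measure" and F :: "real \<Rightarrow> 'a measure" and T :: real
    and rate :: "'s::finite \<Rightarrow> 's \<Rightarrow> real" and s0 :: "'a \<Rightarrow> 's" and s :: "real \<Rightarrow> 'a \<Rightarrow> 's" +
  fixes \<delta> :: real and I :: nat and x0 :: "'a \<Rightarrow> real"
    and b1 :: "real \<Rightarrow> 's \<Rightarrow> real" and b2 q r \<alpha> :: "nat \<Rightarrow> real \<Rightarrow> 's \<Rightarrow> real"
  assumes x0_measurable: "x0 \<in> borel_measurable (F 0)"
    and x0_gt: "AE \<omega> in M. exp 1 < x0 \<omega>"
    and b1_integrable: "\<And>a. set_integrable lborel {0..T} (\<lambda>t. b1 t a)"
    and b2_measurable: "\<And>j a. j \<in> {1..I} \<Longrightarrow> set_borel_measurable lborel {0..T} (\<lambda>t. b2 j t a)"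
    and b2_integrable: "\<And>j a. j \<in> {1..I} \<Longrightarrow> set_integrable lborel {0..T} (\<lambda>t. (b2 j t a)\<^sup>2)"
    and q_measurable: "\<And>i a. i \<in> {1..I} \<Longrightarrow> set_borel_measurable lborel {0..T} (\<lambda>t. q i t a)"
    and r_measurable: "\<And>i a. i \<in> {1..I} \<Longrightarrow> set_borel_measurable lborel {0..T} (\<lambda>t. r i t a)"
    and q_nonneg: "\<And>i t a. i \<in> {1..I} \<Longrightarrow> t \<in> {0..T} \<Longrightarrow> 0 \<le> q i t a"
    and \<delta>_pos: "0 < \<delta>" and r_gt: "\<And>i t a. i \<in> {1..I} \<Longrightarrow> t \<in> {0..T} \<Longrightarrow> \<delta> < r i t a"
    and riccati: "\<And>i t a. i \<in> {1..I} \<Longrightarrow> t \<in> {0..T} \<Longrightarrow>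
      ((\<lambda>t'. \<alpha> i t' a) has_real_derivative
        (- q i t a - 2 * b1 t a * \<alpha> i t a
         + 2 * \<alpha> i t a * (\<Sum>j\<in>{1..I} - {i}. \<alpha> j t a * ((b2 j t a)\<^sup>2 / r j t a))
         + (\<alpha> i t a)\<^sup>2 * ((b2 i t a)\<^sup>2 / r i t a)
         - (\<Sum>b\<in>UNIV. (\<alpha> i t b - \<alpha> i t a) * rate a b))) (at t within {0..T})"
    and terminal: "\<And>i a. i \<in> {1..I} \<Longrightarrow> \<alpha> i T a = q i T a"
begin

abbreviation "horizon \<equiv> restrict_space borel {0..T}"

definition "\<alpha>' i t a = - q i t a - 2 * b1 t a * \<alpha> i t a
         + 2 * \<alpha> i t a * (\<Sum>j\<in>{1..I} - {i}. \<alpha> j t a * ((b2 j t a)\<^sup>2 / r j t a))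
         + (\<alpha> i t a)\<^sup>2 * ((b2 i t a)\<^sup>2 / r i t a)
         - (\<Sum>b\<in>UNIV. (\<alpha> i t b - \<alpha> i t a) * rate a b)"

definition "gain j t a = \<alpha> j t a * b2 j t a / r j t a"

lemma T_nonneg: "0 \<le> T" using horizon_pos by simp

lemma r_pos: "i \<in> {1..I} \<Longrightarrow> t \<in> {0..T} \<Longrightarrow> 0 < r i t a"
  using r_gt[of i t a] \<delta>_pos by simp

lemma \<alpha>_derivative:
  "i \<in> {1..I} \<Longrightarrow> t \<in> {0..T} \<Longrightarrow> ((\<lambda>t'. \<alpha> i t' a) has_real_derivative \<alpha>' i t a) (at t within {0..T})"
  unfolding \<alpha>'_def by (rule riccati)

lemma \<alpha>_continuous: "i \<in> {1..I} \<Longrightarrow> continuous_on {0..T} (\<lambda>t. \<alpha> i t a)"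
  using \<alpha>_derivative by (meson DERIV_continuous_on)

lemma coefficient_measurable [measurable]:
  "(\<lambda>t. b1 t a) \<in> borel_measurable horizon"
  "j \<in> {1..I} \<Longrightarrow> (\<lambda>t. b2 j t a) \<in> borel_measurable horizon"
  "j \<in> {1..I} \<Longrightarrow> (\<lambda>t. q j t a) \<in> borel_measurable horizon"
  "j \<in> {1..I} \<Longrightarrow> (\<lambda>t. r j t a) \<in> borel_measurable horizon"
  "j \<in> {1..I} \<Longrightarrow> (\<lambda>t. \<alpha> j t a) \<in> borel_measurable horizon"
proof -
  have "set_borel_measurable lborel {0..T} (\<lambda>t. b1 t a)"
    using b1_integrable[of a] by (simp add: set_integrable_def set_borel_measurable_def)
  then show "(\<lambda>t. b1 t a) \<in> borel_measurable horizon"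
    by (simp add: set_borel_measurable_restrict)
  have iv: "{0..T} \<in> sets borel" by simp
  note restrict = set_borel_measurable_restrict[OF iv, THEN iffD1]
  show "j \<in> {1..I} \<Longrightarrow> (\<lambda>t. b2 j t a) \<in> borel_measurable horizon"
    by (intro restrict b2_measurable)
  show "j \<in> {1..I} \<Longrightarrow> (\<lambda>t. q j t a) \<in> borel_measurable horizon"
    by (intro restrict q_measurable)
  show "j \<in> {1..I} \<Longrightarrow> (\<lambda>t. r j t a) \<in> borel_measurable horizon"
    by (intro restrict r_measurable)
  show "j \<in> {1..I} \<Longrightarrow> (\<lambda>t. \<alpha> j t a) \<in> borel_measurable horizon"
    by (intro borel_measurable_continuous_on_restrict \<alpha>_continuous)
qed

lemma gain_measurable [measurable]: "j \<in> {1..I} \<Longrightarrow> (\<lambda>t. gain j t a) \<in> borel_measurable horizon"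
  unfolding gain_def by measurable

lemma \<alpha>'_measurable [measurable]: "i \<in> {1..I} \<Longrightarrow> (\<lambda>t. \<alpha>' i t a) \<in> borel_measurable horizon"
  unfolding \<alpha>'_def
  by (intro borel_measurable_diff borel_measurable_add borel_measurable_times borel_measurable_sum
      borel_measurable_divide borel_measurable_power borel_measurable_uminus borel_measurable_const
      coefficient_measurable) auto

text \<open>
  The lower bound \<open>\<delta>\<close> on \<open>r\<close> enters here: it makes square integrability of \<open>b2\<close> enough.
\<close>

lemma b2_weight_integrable:
  assumes "j \<in> {1..I}"
  shows "set_integrable lborel {0..T} (\<lambda>t. (b2 j t a)\<^sup>2 / r j t a)"
proof (rule set_integrable_bound)
  show "set_integrable lborel {0..T} (\<lambda>t. (b2 j t a)\<^sup>2 / \<delta>)"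
    using b2_integrable[OF assms] by (rule set_integrable_divide)
  show "set_borel_measurable lborel {0..T} (\<lambda>t. (b2 j t a)\<^sup>2 / r j t a)"
    using assms by (simp add: set_borel_measurable_restrict)
  show "AE t in lborel. t \<in> {0..T} \<longrightarrow> norm ((b2 j t a)\<^sup>2 / r j t a) \<le> norm ((b2 j t a)\<^sup>2 / \<delta>)"
  proof (intro AE_I2 impI)
    fix t assume "t \<in> {0..T}"
    then have "\<delta> \<le> r j t a" "0 < r j t a" using r_gt[OF assms] r_pos[OF assms] by (auto intro: less_imp_le)
    then have "(b2 j t a)\<^sup>2 / r j t a \<le> (b2 j t a)\<^sup>2 / \<delta>"
      using \<delta>_pos by (intro divide_left_mono) auto
    with \<open>0 < r j t a\<close> \<delta>_pos show "norm ((b2 j t a)\<^sup>2 / r j t a) \<le> norm ((b2 j t a)\<^sup>2 / \<delta>)"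
      by simp
  qed
qed

text \<open>
  The derivative of \<open>\<alpha>\<close> is an integrable function minus \<open>q\<close>, hence bounded above by that function.
\<close>

lemma \<alpha>_primitive:
  assumes i: "i \<in> {1..I}"
  shows "primitive_on T (\<lambda>t. \<alpha>' i t a) (\<lambda>t. \<alpha> i t a)"
proof (rule primitive_on_if_derivative_le)
  \<comment> \<open>the right-hand side of the Riccati equation without the term \<open>- q\<close>\<close>
  let ?g = "\<lambda>t. \<alpha>' i t a + q i t a"
  have "set_integrable lborel {0..T} (\<lambda>t. (- 2 * \<alpha> i t a) * b1 t a
     + (\<Sum>j\<in>{1..I} - {i}. (2 * \<alpha> i t a * \<alpha> j t a) * ((b2 j t a)\<^sup>2 / r j t a))
     + (\<alpha> i t a)\<^sup>2 * ((b2 i t a)\<^sup>2 / r i t a)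
     - (\<Sum>b\<in>UNIV. (\<alpha> i t b - \<alpha> i t a) * rate a b))"
  proof (rule set_integral_diff(1)[OF set_integral_add(1)[OF set_integral_add(1)]])
    show "set_integrable lborel {0..T} (\<lambda>t. (- 2 * \<alpha> i t a) * b1 t a)"
      by (intro set_integrable_continuous_mult b1_integrable continuous_intros \<alpha>_continuous i)
    have "set_integrable lborel {0..T} (\<lambda>t. (2 * \<alpha> i t a * \<alpha> j t a) * ((b2 j t a)\<^sup>2 / r j t a))" if "j \<in> {1..I}" for j
      using that by (intro set_integrable_continuous_mult b2_weight_integrable continuous_intros \<alpha>_continuous i)
    then have "integrable lborel (\<lambda>t. \<Sum>j\<in>{1..I} - {i}. indicat_real {0..T} t *\<^sub>R ((2 * \<alpha> i t a * \<alpha> j t a) * ((b2 j t a)\<^sup>2 / r j t a)))"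
      unfolding set_integrable_def by (intro Bochner_Integration.integrable_sum) auto
    then show "set_integrable lborel {0..T} (\<lambda>t. \<Sum>j\<in>{1..I} - {i}. (2 * \<alpha> i t a * \<alpha> j t a) * ((b2 j t a)\<^sup>2 / r j t a))"
      unfolding set_integrable_def by (simp add: sum_distrib_left)
    show "set_integrable lborel {0..T} (\<lambda>t. (\<alpha> i t a)\<^sup>2 * ((b2 i t a)\<^sup>2 / r i t a))"
      by (intro set_integrable_continuous_mult b2_weight_integrable continuous_intros \<alpha>_continuous i)
    show "set_integrable lborel {0..T} (\<lambda>t. \<Sum>b\<in>UNIV. (\<alpha> i t b - \<alpha> i t a) * rate a b)"
      by (rule borel_integrable_atLeastAtMost') (intro continuous_intros \<alpha>_continuous i)
  qed
  also have "(\<lambda>t. (- 2 * \<alpha> i t a) * b1 t a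
     + (\<Sum>j\<in>{1..I} - {i}. (2 * \<alpha> i t a * \<alpha> j t a) * ((b2 j t a)\<^sup>2 / r j t a))
     + (\<alpha> i t a)\<^sup>2 * ((b2 i t a)\<^sup>2 / r i t a)
     - (\<Sum>b\<in>UNIV. (\<alpha> i t b - \<alpha> i t a) * rate a b)) = ?g"
    by (rule ext) (simp add: \<alpha>'_def sum_distrib_left algebra_simps)
  finally show "set_integrable lborel {0..T} ?g" .
  show "\<And>t. t \<in> {0..T} \<Longrightarrow> \<alpha>' i t a \<le> ?g t" using q_nonneg[OF i] by simp
  show "set_borel_measurable lborel {0..T} (\<lambda>t. \<alpha>' i t a)"
    using i by (simp add: set_borel_measurable_restrict)
qed (use T_nonneg \<alpha>_derivative[OF i] in auto)

lemma \<alpha>_bounded: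
  assumes "i \<in> {1..I}"
  obtains C where "0 \<le> C" "\<And>t a. t \<in> {0..T} \<Longrightarrow> \<bar>\<alpha> i t a\<bar> \<le> C"
proof -
  have "\<exists>C. \<forall>t\<in>{0..T}. \<bar>\<alpha> i t a\<bar> \<le> C" for a
  proof -
    have "bounded ((\<lambda>t. \<alpha> i t a) ` {0..T})"
      using \<alpha>_continuous[OF assms] by (intro compact_imp_bounded compact_continuous_image) auto
    then show ?thesis by (auto simp: bounded_iff)
  qed
  then obtain C where C: "\<And>a t. t \<in> {0..T} \<Longrightarrow> \<bar>\<alpha> i t a\<bar> \<le> C a" by metis
  show ?thesis
  proof (rule that[of "\<Sum>a\<in>UNIV. \<bar>C a\<bar>"])
    fix t a assume "t \<in> {0..T}"
    have "\<bar>\<alpha> i t a\<bar> \<le> \<bar>C a\<bar>" using C[OF \<open>t \<in> {0..T}\<close>, of a] by simp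
    also have "\<dots> \<le> (\<Sum>a\<in>UNIV. \<bar>C a\<bar>)" by (rule member_le_sum) auto
    finally show "\<bar>\<alpha> i t a\<bar> \<le> (\<Sum>a\<in>UNIV. \<bar>C a\<bar>)" .
  qed (simp add: sum_nonneg)
qed

lemma gain_weight_dominated:
  assumes i: "i \<in> {1..I}"
  shows "\<exists>m. set_integrable lborel {0..T} m \<and> (\<forall>t\<in>{0..T}. \<forall>a. r i t a * (gain i t a)\<^sup>2 \<le> m t)"
proof -
  obtain C where C: "0 \<le> C" "\<And>t a. t \<in> {0..T} \<Longrightarrow> \<bar>\<alpha> i t a\<bar> \<le> C"
    using \<alpha>_bounded[OF i] by blast
  define m where "m t = (\<Sum>a\<in>UNIV. C\<^sup>2 * ((b2 i t a)\<^sup>2 / r i t a))" for t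
  have "integrable lborel (\<lambda>t. \<Sum>a\<in>UNIV. C\<^sup>2 * (indicat_real {0..T} t *\<^sub>R ((b2 i t a)\<^sup>2 / r i t a)))"
    using b2_weight_integrable[OF i] unfolding set_integrable_def
    by (intro Bochner_Integration.integrable_sum integrable_mult_right) auto
  then have "set_integrable lborel {0..T} m"
    unfolding set_integrable_def m_def by (simp add: sum_distrib_left mult.left_commute)
  moreover have "r i t a * (gain i t a)\<^sup>2 \<le> m t" if t: "t \<in> {0..T}" for t a
  proof -
    have nn: "0 \<le> C\<^sup>2 * ((b2 i t a)\<^sup>2 / r i t a)" for a
      using r_pos[OF i t, of a] by simp
    have "r i t a * (gain i t a)\<^sup>2 = (\<alpha> i t a)\<^sup>2 * ((b2 i t a)\<^sup>2 / r i t a)"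
      using r_pos[OF i t, of a] by (simp add: gain_def power2_eq_square field_simps)
    also have "\<dots> \<le> C\<^sup>2 * ((b2 i t a)\<^sup>2 / r i t a)"
      using C(1) C(2)[OF t, of a] r_pos[OF i t, of a]
      by (intro mult_right_mono) (auto simp: abs_le_square_iff[symmetric])
    also have "\<dots> \<le> m t"
      unfolding m_def using nn by (intro member_le_sum) auto
    finally show ?thesis .
  qed
  ultimately show ?thesis by blast
qed

text \<open>
  The coefficients of \<open>z\<close> in the equation of \<open>z = ln x\<close> when all players but \<open>i\<close>, respectively all
  players, use the law \<open>- gain * z\<close>.
\<close>

definition "others_rate i t a = b1 t a - (\<Sum>j\<in>{1..I} - {i}. b2 j t a * gain j t a)"
definition "closed_rate t a = b1 t a - (\<Sum>j\<in>{1..I}. b2 j t a * gain j t a)"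

lemma closed_rate_eq: "i \<in> {1..I} \<Longrightarrow> closed_rate t a = others_rate i t a - b2 i t a * gain i t a"
  using sum.remove[of "{1..I}" i "\<lambda>j. b2 j t a * gain j t a"] by (simp add: closed_rate_def others_rate_def)

lemma b2_gain_integrable:
  assumes "j \<in> {1..I}" shows "set_integrable lborel {0..T} (\<lambda>t. b2 j t a * gain j t a)"
proof -
  have "set_integrable lborel {0..T} (\<lambda>t. \<alpha> j t a * ((b2 j t a)\<^sup>2 / r j t a))"
    using assms by (intro set_integrable_continuous_mult \<alpha>_continuous b2_weight_integrable)
  then show ?thesis by (simp add: gain_def power2_eq_square mult_ac)
qed

lemma rate_integrable:
  "set_integrable lborel {0..T} (\<lambda>t. others_rate i t a)"
  "set_integrable lborel {0..T} (\<lambda>t. closed_rate t a)"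
proof -
  have *: "set_integrable lborel {0..T} (\<lambda>t. b1 t a - (\<Sum>j\<in>J. b2 j t a * gain j t a))" if "J \<subseteq> {1..I}" for J
  proof (rule set_integral_diff(1)[OF b1_integrable])
    have "integrable lborel (\<lambda>t. \<Sum>j\<in>J. indicat_real {0..T} t *\<^sub>R (b2 j t a * gain j t a))"
      using that b2_gain_integrable unfolding set_integrable_def
      by (intro Bochner_Integration.integrable_sum) auto
    then show "set_integrable lborel {0..T} (\<lambda>t. \<Sum>j\<in>J. b2 j t a * gain j t a)"
      unfolding set_integrable_def by (simp add: sum_distrib_left)
  qed
  show "set_integrable lborel {0..T} (\<lambda>t. others_rate i t a)"
    "set_integrable lborel {0..T} (\<lambda>t. closed_rate t a)"
    unfolding others_rate_def closed_rate_def by (intro *; auto)+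
qed

lemma rate_measurable [measurable]:
  "(\<lambda>t. others_rate i t a) \<in> borel_measurable horizon"
  "(\<lambda>t. closed_rate t a) \<in> borel_measurable horizon"
  unfolding others_rate_def closed_rate_def
  by (intro borel_measurable_diff borel_measurable_add borel_measurable_times borel_measurable_sum
      borel_measurable_divide borel_measurable_power borel_measurable_uminus borel_measurable_const
      coefficient_measurable gain_measurable; auto)+

lemma regime_coefficient_measurable:
  fixes f :: "real \<Rightarrow> 's \<Rightarrow> real"
  assumes "\<And>a. (\<lambda>t. f t a) \<in> borel_measurable horizon"
  shows "(\<lambda>p. f (fst p) (s (fst p) (snd p))) \<in> borel_measurable (horizon \<Otimes>\<^sub>M M)"
proof (rule measurable_compose_countable[where f = "\<lambda>a p. f (fst p) a"])
  show "(\<lambda>p. f (fst p) a) \<in> borel_measurable (horizon \<Otimes>\<^sub>M M)" for a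
    using measurable_compose[OF measurable_fst assms] .
qed (rule measurable_regime_product)

lemma regime_coefficient_adapted:
  fixes f :: "real \<Rightarrow> 's \<Rightarrow> real"
  assumes "t \<in> {0..T}"
  shows "(\<lambda>\<omega>. f t (s t \<omega>)) \<in> borel_measurable (F t)"
  using measurable_compose[OF measurable_regime_F[OF assms], of "f t" borel] by simp

end

section \<open>Deviations of one player\<close>

context log_quadratic_game
begin

text \<open>
  The factor \<open>x\<close> in the drift cancels against the derivative of \<open>ln\<close>, which leaves a linear equation.
\<close>

lemma trajectory_log:
  assumes "trajectory M F T I b1 b2 s x0 v y"
  shows "AE \<omega> in M. (\<forall>t\<in>{0..T}. 0 < y t \<omega>) \<and> y 0 \<omega> = x0 \<omega> \<and>
    primitive_on T (\<lambda>t. b1 t (s t \<omega>) * ln (y t \<omega>) + (\<Sum>j\<in>{1..I}. b2 j t (s t \<omega>) * v j t \<omega>)) (\<lambda>t. ln (y t \<omega>))"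
proof -
  have "AE \<omega> in M. set_integrable lborel {0..T} (\<lambda>t. drift I b1 b2 t (s t \<omega>) (y t \<omega>) (\<lambda>j. v j t \<omega>)) \<and>
        (\<forall>t\<in>{0..T}. 0 < y t \<omega> \<and>
           y t \<omega> = x0 \<omega> + (LBINT t':{0..t}. drift I b1 b2 t' (s t' \<omega>) (y t' \<omega>) (\<lambda>j. v j t' \<omega>)))"
    using assms by (simp add: trajectory_def)
  then show ?thesis
  proof eventually_elim
    case (elim \<omega>)
    let ?d = "\<lambda>t. drift I b1 b2 t (s t \<omega>) (y t \<omega>) (\<lambda>j. v j t \<omega>)"
    have int: "set_integrable lborel {0..T} ?d"
      and y: "\<And>t. t \<in> {0..T} \<Longrightarrow> 0 < y t \<omega>"
        "\<And>t. t \<in> {0..T} \<Longrightarrow> y t \<omega> = x0 \<omega> + (LBINT t':{0..t}. ?d t')"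
      using elim by blast+
    have prim: "primitive_on T ?d (\<lambda>t. y t \<omega>)"
      by (rule primitive_on_cong[OF primitive_on_indefinite_integral[OF int, of "x0 \<omega>"]])
         (use y(2) T_nonneg in auto)
    have "(LBINT t':{0..0}. ?d t') = 0" by (simp add: set_integral_at_point)
    then have y0: "y 0 \<omega> = x0 \<omega>" using y(2)[of 0] T_nonneg by simp
    have "primitive_on T (\<lambda>t. inverse (y t \<omega>) * ?d t) (\<lambda>t. ln (y t \<omega>))"
    proof (rule primitive_on_compose[OF prim T_nonneg])
      show "(ln has_real_derivative inverse (y t \<omega>)) (at (y t \<omega>))" if "t \<in> {0..T}" for t
        using y(1)[OF that] by (rule DERIV_ln)
      show "continuous_on ((\<lambda>t. y t \<omega>) ` {0..T}) inverse"
        by (rule continuous_on_inverse[OF continuous_on_id]) (use y(1) in force)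
    qed
    then have "primitive_on T (\<lambda>t. b1 t (s t \<omega>) * ln (y t \<omega>) + (\<Sum>j\<in>{1..I}. b2 j t (s t \<omega>) * v j t \<omega>)) (\<lambda>t. ln (y t \<omega>))"
    proof (rule primitive_on_cong)
      fix t assume "t \<in> {0..T}"
      then have "y t \<omega> \<noteq> 0" using y(1) by force
      moreover have "?d t = y t \<omega> * (b1 t (s t \<omega>) * ln (y t \<omega>) + (\<Sum>j\<in>{1..I}. b2 j t (s t \<omega>) * v j t \<omega>))"
        by (simp add: drift_def distrib_left sum_distrib_left mult_ac)
      ultimately show "inverse (y t \<omega>) * ?d t = b1 t (s t \<omega>) * ln (y t \<omega>) + (\<Sum>j\<in>{1..I}. b2 j t (s t \<omega>) * v j t \<omega>)"
        by (simp add: field_simps)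
    qed (use T_nonneg in auto)
    with y y0 show ?case by blast
  qed
qed

end

text \<open>
  Player \<open>i\<close> uses an arbitrary adapted control \<open>w\<close> while the others react to the resulting state \<open>y\<close>
  through the law \<open>\<phi>\<close>.
\<close>

locale unilateral_deviation = log_quadratic_game +
  fixes \<phi> i w y
  assumes player: "i \<in> {1..I}"
    and law: "\<And>j t x a. j \<in> {1..I} \<Longrightarrow> \<phi> j t x a = - gain j t a * ln x"
    and deviation: "trajectory M F T I b1 b2 s x0 ((feedback_control \<phi> s y)(i := w)) y"
begin

sublocale prod: pair_sigma_finite lborel M ..

definition "z t \<omega> = ln (y t \<omega>)"
definition "z' t \<omega> = others_rate i t (s t \<omega>) * z t \<omega> + b2 i t (s t \<omega>) * w t \<omega>"
text \<open>
  A deterministic rate at which \<open>z\<^sup>2\<close> may grow in the absence of \<open>w\<close>, valid in every regime.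
\<close>

definition "growth t = (\<Sum>a\<in>UNIV. 2 * \<bar>others_rate i t a\<bar> + (b2 i t a)\<^sup>2)"

lemma z_primitive: "AE \<omega> in M. z 0 \<omega> = ln (x0 \<omega>) \<and> primitive_on T (\<lambda>t. z' t \<omega>) (\<lambda>t. z t \<omega>)"
  using trajectory_log[OF deviation]
proof eventually_elim
  case (elim \<omega>)
  let ?v = "\<lambda>j t. ((feedback_control \<phi> s y)(i := w)) j t \<omega>"
  have "primitive_on T (\<lambda>t. b1 t (s t \<omega>) * ln (y t \<omega>) + (\<Sum>j\<in>{1..I}. b2 j t (s t \<omega>) * ?v j t)) (\<lambda>t. ln (y t \<omega>))"
    using elim by blast
  then have "primitive_on T (\<lambda>t. z' t \<omega>) (\<lambda>t. z t \<omega>)"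
  proof (rule primitive_on_cong)
    fix t
    have "(\<Sum>j\<in>{1..I}. b2 j t (s t \<omega>) * ?v j t) = b2 i t (s t \<omega>) * w t \<omega>
         + (\<Sum>j\<in>{1..I} - {i}. b2 j t (s t \<omega>) * ?v j t)"
      using player by (subst sum.remove[of _ i]) auto
    also have "(\<Sum>j\<in>{1..I} - {i}. b2 j t (s t \<omega>) * ?v j t)
        = (\<Sum>j\<in>{1..I} - {i}. - (b2 j t (s t \<omega>) * gain j t (s t \<omega>)) * ln (y t \<omega>))"
      by (intro sum.cong refl) (simp add: feedback_control_def law)
    also have "\<dots> = - (\<Sum>j\<in>{1..I} - {i}. b2 j t (s t \<omega>) * gain j t (s t \<omega>)) * ln (y t \<omega>)"
      by (simp add: sum_distrib_right sum_negf)
    finally show "b1 t (s t \<omega>) * ln (y t \<omega>) + (\<Sum>j\<in>{1..I}. b2 j t (s t \<omega>) * ?v j t) = z' t \<omega>"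
      by (simp add: z'_def z_def others_rate_def algebra_simps)
  qed (use T_nonneg in \<open>auto simp: z_def\<close>)
  with elim show ?case by (simp add: z_def)
qed

lemma y_adapted: "t \<in> {0..T} \<Longrightarrow> y t \<in> borel_measurable (F t)"
  and y_product: "(\<lambda>(t, \<omega>). y t \<omega>) \<in> borel_measurable (horizon \<Otimes>\<^sub>M M)"
  using deviation by (auto simp: trajectory_def adapted_process_def)

lemma w_adapted: "t \<in> {0..T} \<Longrightarrow> w t \<in> borel_measurable (F t)"
  and w_product: "(\<lambda>(t, \<omega>). w t \<omega>) \<in> borel_measurable (horizon \<Otimes>\<^sub>M M)"
proof -
  have "adapted_process M F T w"
    using deviation player unfolding trajectory_def by (metis fun_upd_same)
  then show "t \<in> {0..T} \<Longrightarrow> w t \<in> borel_measurable (F t)"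
    and "(\<lambda>(t, \<omega>). w t \<omega>) \<in> borel_measurable (horizon \<Otimes>\<^sub>M M)"
    by (auto simp: adapted_process_def)
qed

lemma product_measurable [measurable]:
  "(\<lambda>p. z (fst p) (snd p)) \<in> borel_measurable (horizon \<Otimes>\<^sub>M M)"
  "(\<lambda>p. w (fst p) (snd p)) \<in> borel_measurable (horizon \<Otimes>\<^sub>M M)"
  "(\<lambda>p. b2 i (fst p) (s (fst p) (snd p))) \<in> borel_measurable (horizon \<Otimes>\<^sub>M M)"
  "(\<lambda>p. q i (fst p) (s (fst p) (snd p))) \<in> borel_measurable (horizon \<Otimes>\<^sub>M M)"
  "(\<lambda>p. r i (fst p) (s (fst p) (snd p))) \<in> borel_measurable (horizon \<Otimes>\<^sub>M M)"
  "(\<lambda>p. gain i (fst p) (s (fst p) (snd p))) \<in> borel_measurable (horizon \<Otimes>\<^sub>M M)"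
  "(\<lambda>p. others_rate i (fst p) (s (fst p) (snd p))) \<in> borel_measurable (horizon \<Otimes>\<^sub>M M)"
  using y_product w_product player
  by (auto simp: z_def case_prod_beta' intro!: regime_coefficient_measurable)

lemma z'_product_measurable [measurable]: "(\<lambda>p. z' (fst p) (snd p)) \<in> borel_measurable (horizon \<Otimes>\<^sub>M M)"
  unfolding z'_def by measurable

lemma z_adapted: "t \<in> {0..T} \<Longrightarrow> z t \<in> borel_measurable (F t)"
  unfolding z_def[abs_def] using y_adapted by measurable

lemma z'_adapted:
  assumes "t \<in> {0..T}" shows "z' t \<in> borel_measurable (F t)"
  unfolding z'_def[abs_def]
  using assms by (intro borel_measurable_add borel_measurable_times regime_coefficient_adapted z_adapted w_adapted)

lemma growth_integrable: "set_integrable lborel {0..T} growth"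
proof -
  have "integrable lborel (\<lambda>t. \<Sum>a\<in>UNIV. 2 * \<bar>indicat_real {0..T} t *\<^sub>R others_rate i t a\<bar> + indicat_real {0..T} t *\<^sub>R (b2 i t a)\<^sup>2)"
    using rate_integrable(1) b2_integrable[OF player] unfolding set_integrable_def
    by (intro Bochner_Integration.integrable_sum Bochner_Integration.integrable_add integrable_mult_right integrable_abs) auto
  then show ?thesis
    unfolding set_integrable_def growth_def by (simp add: sum_distrib_left abs_mult distrib_left mult.left_commute)
qed

lemma growth_ge: "2 * \<bar>others_rate i t a\<bar> + (b2 i t a)\<^sup>2 \<le> growth t"
  unfolding growth_def by (rule member_le_sum) auto

lemma growth_nonneg: "0 \<le> growth t"
  unfolding growth_def by (intro sum_nonneg) auto

text \<open>
  The mixed term \<open>2 * b2 * z * w\<close> is split as \<open>b2\<^sup>2 * z\<^sup>2 + w\<^sup>2\<close>, so that square integrability of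
  \<open>b2\<close> in time suffices.
\<close>

lemma z_z'_bound: "\<bar>2 * z t \<omega> * z' t \<omega>\<bar> \<le> growth t * (z t \<omega>)\<^sup>2 + (w t \<omega>)\<^sup>2"
proof -
  let ?o = "others_rate i t (s t \<omega>)" and ?b = "b2 i t (s t \<omega>)"
  have "2 * z t \<omega> * z' t \<omega> = 2 * ?o * (z t \<omega>)\<^sup>2 + 2 * (?b * z t \<omega>) * w t \<omega>"
    by (simp add: z'_def power2_eq_square algebra_simps)
  also have "\<bar>\<dots>\<bar> \<le> 2 * \<bar>?o\<bar> * (z t \<omega>)\<^sup>2 + \<bar>2 * (?b * z t \<omega>) * w t \<omega>\<bar>"
    by (rule order_trans[OF abs_triangle_ineq]) (simp add: abs_mult)
  also have "\<bar>2 * (?b * z t \<omega>) * w t \<omega>\<bar> \<le> (?b * z t \<omega>)\<^sup>2 + (w t \<omega>)\<^sup>2"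
    using sum_squares_bound[of "?b * z t \<omega>" "w t \<omega>"] sum_squares_bound[of "?b * z t \<omega>" "- w t \<omega>"]
    by (simp add: abs_le_iff)
  also have "2 * \<bar>?o\<bar> * (z t \<omega>)\<^sup>2 + ((?b * z t \<omega>)\<^sup>2 + (w t \<omega>)\<^sup>2) = (2 * \<bar>?o\<bar> + ?b\<^sup>2) * (z t \<omega>)\<^sup>2 + (w t \<omega>)\<^sup>2"
    by (simp add: power_mult_distrib algebra_simps)
  also have "\<dots> \<le> growth t * (z t \<omega>)\<^sup>2 + (w t \<omega>)\<^sup>2"
    by (intro add_right_mono mult_right_mono growth_ge) auto
  finally show ?thesis by simp
qed

end

text \<open>
  A deviation on an event \<open>A\<close>, known at time \<open>0\<close>, on which the initial state is bounded and the control
  has finite expected cost. Since \<open>A\<close> belongs to \<open>F 0\<close>, multiplication by its indicator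
  preserves adaptedness.
\<close>

locale localized_deviation = unilateral_deviation +
  fixes A c
  assumes A: "A \<in> sets (F 0)" and x0_bounded: "\<And>\<omega>. \<omega> \<in> A \<Longrightarrow> \<bar>ln (x0 \<omega>)\<bar> \<le> c"
    and energy: "integrable \<mu>
      (\<lambda>(t, \<omega>). indicat_real {0..T} t * (indicat_real A \<omega> * (r i t (s t \<omega>) * (w t \<omega>)\<^sup>2)))"
begin

lemma A_M [measurable]: "A \<in> sets M"
  using A subalg by (auto simp: subalgebra_def)

lemma indicator_A_adapted: "0 \<le> t \<Longrightarrow> indicat_real A \<in> borel_measurable (F t)"
  using A sets_F_mono[of 0 t] by (intro borel_measurable_indicator) auto

definition "control_energy \<omega> = indicat_real A \<omega> * (LBINT t:{0..T}. (w t \<omega>)\<^sup>2)"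
definition "sup_bound \<omega> = exp (LBINT t:{0..T}. growth t) * (indicat_real A \<omega> * c\<^sup>2 + control_energy \<omega>)"

lemma w_square_integrable:
  "integrable \<mu> (\<lambda>(t, \<omega>). indicat_real {0..T} t * (indicat_real A \<omega> * (w t \<omega>)\<^sup>2))"
proof (rule Bochner_Integration.integrable_bound)
  show "integrable \<mu> (\<lambda>p. (1 / \<delta>) * (case p of (t, \<omega>) \<Rightarrow> indicat_real {0..T} t * (indicat_real A \<omega> * (r i t (s t \<omega>) * (w t \<omega>)\<^sup>2))))"
    by (intro integrable_mult_right energy)
  have "(\<lambda>p. indicat_real A (snd p) * (w (fst p) (snd p))\<^sup>2) \<in> borel_measurable (horizon \<Otimes>\<^sub>M M)"
    by measurable
  from measurable_extend_interval[OF this T_nonneg]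
  show "(\<lambda>(t, \<omega>). indicat_real {0..T} t * (indicat_real A \<omega> * (w t \<omega>)\<^sup>2)) \<in> borel_measurable \<mu>"
    by (simp add: case_prod_beta')
  have "\<delta> * (w t \<omega>)\<^sup>2 \<le> r i t (s t \<omega>) * (w t \<omega>)\<^sup>2" if "t \<in> {0..T}" for t \<omega>
    using r_gt[OF player that, of "s t \<omega>"] by (intro mult_right_mono) auto
  then show "AE p in \<mu>. norm (case p of (t, \<omega>) \<Rightarrow> indicat_real {0..T} t * (indicat_real A \<omega> * (w t \<omega>)\<^sup>2))
      \<le> norm ((1 / \<delta>) * (case p of (t, \<omega>) \<Rightarrow> indicat_real {0..T} t * (indicat_real A \<omega> * (r i t (s t \<omega>) * (w t \<omega>)\<^sup>2))))"
    using \<delta>_pos r_pos[OF player]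
    by (intro AE_I2) (auto simp: indicator_def abs_mult field_simps less_imp_le split: prod.splits)
qed

lemma control_energy_integrable: "integrable M control_energy"
  using prod.integrable_snd[OF w_square_integrable]
  by (simp add: control_energy_def[abs_def] set_lebesgue_integral_def mult.left_commute)

lemma sup_bound_integrable: "integrable M sup_bound"
  unfolding sup_bound_def[abs_def]
  by (intro integrable_mult_right Bochner_Integration.integrable_add integrable_mult_left control_energy_integrable
      integrable_real_indicator) (auto simp: less_top[symmetric])

lemma z_square_bound: "AE \<omega> in M. \<forall>t\<in>{0..T}. indicat_real A \<omega> * (z t \<omega>)\<^sup>2 \<le> sup_bound \<omega>"
  using z_primitive prod.AE_integrable_snd[OF w_square_integrable]
proof eventually_elim
  case (elim \<omega>)
  show ?case
  proof (cases "\<omega> \<in> A")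
    case True
    have w2: "set_integrable lborel {0..T} (\<lambda>t. (w t \<omega>)\<^sup>2)"
      using elim(2) True by (simp add: set_integrable_def)
    have prim: "primitive_on T (\<lambda>t. 2 * z t \<omega> * z' t \<omega>) (\<lambda>t. (z t \<omega>)\<^sup>2)"
      using elim(1) T_nonneg by (intro primitive_on_square) auto
    have "(z t \<omega>)\<^sup>2 \<le> sup_bound \<omega>" if "t \<in> {0..T}" for t
    proof -
      have "(z t \<omega>)\<^sup>2 \<le> exp (LBINT t:{0..T}. growth t) * ((z 0 \<omega>)\<^sup>2 + (LBINT t:{0..T}. (w t \<omega>)\<^sup>2))"
        using prim T_nonneg growth_integrable growth_nonneg w2 z_z'_bound that
        by (intro primitive_on_gronwall) (auto intro: order_trans[OF abs_ge_self])
      also have "\<dots> \<le> sup_bound \<omega>"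
      proof -
        have "(z 0 \<omega>)\<^sup>2 \<le> c\<^sup>2"
          using x0_bounded[OF True] elim(1) by (simp add: abs_le_square_iff[symmetric])
        then show ?thesis using True by (simp add: sup_bound_def control_energy_def)
      qed
      finally show ?thesis .
    qed
    then show ?thesis using True by simp
  next
    case False
    then show ?thesis by (simp add: sup_bound_def control_energy_def)
  qed
qed

text \<open>
  A time factor \<open>m\<close> that is merely integrable is compatible with \<open>z\<^sup>2\<close> because \<open>z\<^sup>2\<close> is bounded in
  time by the integrable \<open>sup_bound\<close>.
\<close>

lemma dominated_integrable:
  assumes f: "f \<in> borel_measurable (horizon \<Otimes>\<^sub>M M)"
    and m: "set_integrable lborel {0..T} m" "\<And>t. t \<in> {0..T} \<Longrightarrow> 0 \<le> m t" and "0 \<le> C"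
    and le: "\<And>t \<omega>. t \<in> {0..T} \<Longrightarrow> \<bar>f (t, \<omega>)\<bar> \<le> indicat_real A \<omega> * (m t * (z t \<omega>)\<^sup>2 + C * (w t \<omega>)\<^sup>2)"
  shows "integrable \<mu> (\<lambda>p. indicat_real {0..T} (fst p) * f p)"
proof (rule Bochner_Integration.integrable_bound)
  let ?g = "\<lambda>p. (indicat_real {0..T} (fst p) *\<^sub>R m (fst p)) * sup_bound (snd p)
     + C * (case p of (t, \<omega>) \<Rightarrow> indicat_real {0..T} t * (indicat_real A \<omega> * (w t \<omega>)\<^sup>2))"
  show "integrable \<mu> ?g"
    using m(1) sup_bound_integrable unfolding set_integrable_def
    by (intro Bochner_Integration.integrable_add prod.integrable_mult_pair integrable_mult_right w_square_integrable)
  show "(\<lambda>p. indicat_real {0..T} (fst p) * f p) \<in> borel_measurable \<mu>"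
    using f T_nonneg by (rule measurable_extend_interval)
  have "AE p in \<mu>. \<forall>t\<in>{0..T}. indicat_real A (snd p) * (z t (snd p))\<^sup>2 \<le> sup_bound (snd p)"
    using z_square_bound by (intro AE_snd_pair) (unfold_locales)
  then show "AE p in \<mu>. norm (indicat_real {0..T} (fst p) * f p) \<le> norm (?g p)"
  proof eventually_elim
    case (elim p)
    obtain t \<omega> where p: "p = (t, \<omega>)" by (cases p)
    show ?case
    proof (cases "t \<in> {0..T}")
      case True
      have "\<bar>f (t, \<omega>)\<bar> \<le> m t * (indicat_real A \<omega> * (z t \<omega>)\<^sup>2) + C * (indicat_real A \<omega> * (w t \<omega>)\<^sup>2)"
        using le[OF True, of \<omega>] by (simp add: algebra_simps)
      also have "\<dots> \<le> m t * sup_bound \<omega> + C * (indicat_real A \<omega> * (w t \<omega>)\<^sup>2)"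
        using elim True m(2)[OF True] by (intro add_right_mono mult_left_mono) (auto simp: p)
      finally show ?thesis using True by (simp add: p)
    qed (simp add: p)
  qed
qed

end

section \<open>The cost of a deviation\<close>

context localized_deviation
begin

text \<open>
  The value of player \<open>i\<close> with the regime frozen at \<open>a\<close>, and its time derivative along the trajectory.
\<close>

definition "value_part a t \<omega> = indicat_real A \<omega> * (\<alpha> i t a * (z t \<omega>)\<^sup>2)"
definition "value_speed a t \<omega> = indicat_real A \<omega> * (\<alpha>' i t a * (z t \<omega>)\<^sup>2 + \<alpha> i t a * (2 * z t \<omega> * z' t \<omega>))"

lemma product_coefficient_measurable [measurable]:
  "(\<lambda>p. \<alpha> i (fst p) a) \<in> borel_measurable (horizon \<Otimes>\<^sub>M M)"
  "(\<lambda>p. \<alpha>' i (fst p) a) \<in> borel_measurable (horizon \<Otimes>\<^sub>M M)"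
  using player by (auto intro!: measurable_compose[OF measurable_fst])

lemma value_speed_integrable:
  "integrable \<mu> (on_horizon (value_speed a))"
proof -
  obtain C where C: "0 \<le> C" "\<And>t a. t \<in> {0..T} \<Longrightarrow> \<bar>\<alpha> i t a\<bar> \<le> C"
    using \<alpha>_bounded[OF player] by blast
  have "integrable \<mu> (\<lambda>p. indicat_real {0..T} (fst p) * value_speed a (fst p) (snd p))"
  proof (rule dominated_integrable)
    show "(\<lambda>p. value_speed a (fst p) (snd p)) \<in> borel_measurable (horizon \<Otimes>\<^sub>M M)"
      unfolding value_speed_def by measurable
    show "set_integrable lborel {0..T} (\<lambda>t. \<bar>\<alpha>' i t a\<bar> + C * growth t)"
      by (rule set_integral_add(1)[OF set_integrable_abs[OF primitive_onD(1)[OF \<alpha>_primitive[OF player]]]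
            set_integrable_mult_right[OF growth_integrable]])
    fix t \<omega> assume t: "t \<in> {0..T}"
    have "\<bar>\<alpha>' i t a * (z t \<omega>)\<^sup>2 + \<alpha> i t a * (2 * z t \<omega> * z' t \<omega>)\<bar>
        \<le> \<bar>\<alpha>' i t a\<bar> * (z t \<omega>)\<^sup>2 + \<bar>\<alpha> i t a\<bar> * \<bar>2 * z t \<omega> * z' t \<omega>\<bar>"
      by (rule order_trans[OF abs_triangle_ineq]) (simp add: abs_mult)
    also have "\<dots> \<le> \<bar>\<alpha>' i t a\<bar> * (z t \<omega>)\<^sup>2 + C * (growth t * (z t \<omega>)\<^sup>2 + (w t \<omega>)\<^sup>2)"
      by (intro add_left_mono mult_mono C(2) z_z'_bound t) (auto simp: C(1))
    finally show "\<bar>value_speed a (fst (t, \<omega>)) (snd (t, \<omega>))\<bar>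
       \<le> indicat_real A \<omega> * ((\<bar>\<alpha>' i t a\<bar> + C * growth t) * (z t \<omega>)\<^sup>2 + C * (w t \<omega>)\<^sup>2)"
      by (simp add: value_speed_def abs_mult indicator_def algebra_simps)
  qed (use C(1) growth_nonneg in auto)
  then show ?thesis by (simp add: case_prod_beta')
qed

lemma value_primitive: "AE \<omega> in M. primitive_on T (\<lambda>t. value_speed a t \<omega>) (\<lambda>t. value_part a t \<omega>)"
  using z_primitive
proof eventually_elim
  case (elim \<omega>)
  have "primitive_on T (\<lambda>t. indicat_real A \<omega> * (\<alpha>' i t a * (z t \<omega>)\<^sup>2 + \<alpha> i t a * (2 * z t \<omega> * z' t \<omega>)))
     (\<lambda>t. indicat_real A \<omega> * (\<alpha> i t a * (z t \<omega>)\<^sup>2))"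
    using elim T_nonneg by (intro primitive_on_cmult primitive_on_mult \<alpha>_primitive player primitive_on_square) auto
  then show ?case unfolding value_speed_def value_part_def .
qed

lemma adapted_value: "adapted_primitive M F T rate s0 s (value_part a) (value_speed a)"
proof
  fix t assume t: "t \<in> {0..T}"
  have [measurable]: "indicat_real A \<in> borel_measurable (F t)" "z t \<in> borel_measurable (F t)" "z' t \<in> borel_measurable (F t)"
    using t by (auto intro: indicator_A_adapted z_adapted z'_adapted)
  show "value_part a t \<in> borel_measurable (F t)" "value_speed a t \<in> borel_measurable (F t)"
    unfolding value_part_def[abs_def] value_speed_def[abs_def] by measurable
next
  have "(\<lambda>p. value_part a (fst p) (snd p)) \<in> borel_measurable (horizon \<Otimes>\<^sub>M M)"
    unfolding value_part_def by measurable
  from measurable_extend_interval[OF this T_nonneg]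
  show "(on_horizon (value_part a)) \<in> borel_measurable \<mu>"
    by (simp add: case_prod_beta')
  obtain C where C: "0 \<le> C" "\<And>t a. t \<in> {0..T} \<Longrightarrow> \<bar>\<alpha> i t a\<bar> \<le> C"
    using \<alpha>_bounded[OF player] by blast
  show "integrable M (value_part a 0)"
  proof (rule Bochner_Integration.integrable_bound)
    show "integrable M (\<lambda>\<omega>. C * sup_bound \<omega>)" using sup_bound_integrable by simp
    have [measurable]: "z 0 \<in> borel_measurable M"
      using z_adapted[of 0] T_nonneg measurable_F_M by auto
    show "value_part a 0 \<in> borel_measurable M"
      unfolding value_part_def[abs_def] by measurable
    show "AE \<omega> in M. norm (value_part a 0 \<omega>) \<le> norm (C * sup_bound \<omega>)"
      using z_square_bound
    proof eventually_elim
      case (elim \<omega>)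
      then have 1: "indicat_real A \<omega> * (z 0 \<omega>)\<^sup>2 \<le> sup_bound \<omega>" using T_nonneg by auto
      have "\<bar>\<alpha> i 0 a\<bar> * (indicat_real A \<omega> * (z 0 \<omega>)\<^sup>2) \<le> C * sup_bound \<omega>"
        using C(1) C(2)[of 0 a] 1 T_nonneg by (intro mult_mono) auto
      also have "\<dots> \<le> \<bar>C * sup_bound \<omega>\<bar>" by (rule abs_ge_self)
      finally show ?case by (simp add: value_part_def abs_mult mult.left_commute)
    qed
  qed
qed (rule value_speed_integrable value_primitive)+

lemma rate_sum_zero: "(\<Sum>b\<in>UNIV. rate a b) = 0"
  using rate_row_sum[of a] by (simp add: sum.remove[of UNIV a])

definition "running_cost t \<omega> = indicat_real A \<omega> * (q i t (s t \<omega>) * (z t \<omega>)\<^sup>2 + r i t (s t \<omega>) * (w t \<omega>)\<^sup>2)"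
text \<open>
  The loss of player \<open>i\<close> on \<open>A\<close> per unit of time from playing \<open>w\<close> and not the equilibrium law.
\<close>

definition "excess t \<omega> = indicat_real A \<omega> * (r i t (s t \<omega>) * (w t \<omega> + gain i t (s t \<omega>) * z t \<omega>)\<^sup>2)"

text \<open>
  The left-hand side is the sum over \<open>a\<close> of the generators of the frozen values, the expected rate of
  change of the value along the trajectory. In the Riccati equation the jump term cancels the second sum (rows of
  \<open>rate\<close> sum to zero), the sum over the other players cancels their feedback in \<open>others_rate\<close>,
  and the quadratic term completes \<open>2 * \<alpha> * b2 * z * w\<close> to a square.
\<close>

lemma completing_the_square:
  assumes t: "t \<in> {0..T}"
  shows "(\<Sum>a\<in>UNIV. value_speed a t \<omega> * ind a t \<omega> + value_part a t \<omega> * rate (s t \<omega>) a)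
    = excess t \<omega> - running_cost t \<omega>"
proof -
  define a where "a = s t \<omega>"
  define Z where "Z = z t \<omega>"
  define W where "W = w t \<omega>"
  define \<Sigma> where "\<Sigma> = (\<Sum>j\<in>{1..I} - {i}. \<alpha> j t a * ((b2 j t a)\<^sup>2 / r j t a))"
  define R where "R = (\<Sum>b\<in>UNIV. \<alpha> i t b * rate a b)"
  define g where "g = gain i t a"
  define \<rho> where "\<rho> = r i t a"
  have \<rho>: "\<rho> \<noteq> 0" using r_pos[OF player t, of a] by (simp add: \<rho>_def)
  have g: "\<alpha> i t a * b2 i t a = \<rho> * g" using \<rho> by (simp add: g_def gain_def \<rho>_def)
  have o: "others_rate i t a = b1 t a - \<Sigma>"
    unfolding others_rate_def \<Sigma>_def gain_def by (simp add: power2_eq_square mult_ac)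
  have jump: "(\<Sum>b\<in>UNIV. (\<alpha> i t b - \<alpha> i t a) * rate a b) = R"
    using rate_sum_zero[of a] by (simp add: left_diff_distrib sum_subtractf R_def sum_distrib_left[symmetric])
  have sq: "(\<alpha> i t a)\<^sup>2 * ((b2 i t a)\<^sup>2 / r i t a) = \<rho> * g\<^sup>2"
    using g \<rho> unfolding \<rho>_def[symmetric] by (simp add: field_simps power2_eq_square)
  have d: "\<alpha>' i t a = - q i t a - 2 * b1 t a * \<alpha> i t a + 2 * \<alpha> i t a * \<Sigma> + \<rho> * g\<^sup>2 - R"
    by (simp only: \<alpha>'_def \<Sigma>_def[symmetric] jump sq)
  have "(\<Sum>c\<in>UNIV. value_speed c t \<omega> * ind c t \<omega>) = value_speed a t \<omega>"
    by (simp add: a_def indicator_def of_bool_def if_distrib sum.delta cong: if_cong)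
  moreover have "(\<Sum>c\<in>UNIV. value_part c t \<omega> * rate (s t \<omega>) c) = indicat_real A \<omega> * (Z\<^sup>2 * R)"
    by (simp add: value_part_def R_def sum_distrib_left Z_def a_def mult_ac)
  moreover have "value_speed a t \<omega> + indicat_real A \<omega> * (Z\<^sup>2 * R)
     = indicat_real A \<omega> * (\<alpha>' i t a * Z\<^sup>2 + 2 * \<alpha> i t a * others_rate i t a * Z\<^sup>2 + 2 * (\<alpha> i t a * b2 i t a) * Z * W + Z\<^sup>2 * R)"
    by (simp add: value_speed_def z'_def Z_def W_def a_def power2_eq_square algebra_simps)
  moreover have "\<dots> = indicat_real A \<omega> * (\<rho> * (W + g * Z)\<^sup>2 - (q i t a * Z\<^sup>2 + \<rho> * W\<^sup>2))"
    unfolding d o g by (simp add: power2_eq_square algebra_simps)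
  moreover have "\<dots> = excess t \<omega> - running_cost t \<omega>"
    by (simp add: excess_def running_cost_def \<rho>_def g_def W_def Z_def a_def algebra_simps)
  ultimately show ?thesis by (simp add: sum.distrib)
qed

lemma excess_integrable:
  "integrable \<mu> (on_horizon excess)"
proof -
  obtain m where m_int: "set_integrable lborel {0..T} m"
    and m_ge: "\<And>t a. t \<in> {0..T} \<Longrightarrow> r i t a * (gain i t a)\<^sup>2 \<le> m t"
    using gain_weight_dominated[OF player] by blast
  define f where "f p = indicat_real A (snd p) * (r i (fst p) (s (fst p) (snd p)) * (gain i (fst p) (s (fst p) (snd p)) * z (fst p) (snd p))\<^sup>2)" for p
  have gz: "integrable \<mu> (\<lambda>p. indicat_real {0..T} (fst p) * f p)"
  proof (rule dominated_integrable[where C = 0])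
    show "f \<in> borel_measurable (horizon \<Otimes>\<^sub>M M)" unfolding f_def[abs_def] by measurable
    show "set_integrable lborel {0..T} m" by (rule m_int)
    fix t assume t: "t \<in> {0..T}"
    have w0: "0 \<le> r i t a * (gain i t a)\<^sup>2" for a
      using r_pos[OF player t, of a] by simp
    then show "0 \<le> m t" using m_ge[OF t] order_trans by blast
    fix \<omega>
    have "r i t (s t \<omega>) * (gain i t (s t \<omega>))\<^sup>2 * (z t \<omega>)\<^sup>2 \<le> m t * (z t \<omega>)\<^sup>2"
      by (intro mult_right_mono m_ge[OF t]) simp
    then show "\<bar>f (t, \<omega>)\<bar> \<le> indicat_real A \<omega> * (m t * (z t \<omega>)\<^sup>2 + 0 * (w t \<omega>)\<^sup>2)"
      using r_pos[OF player t, of "s t \<omega>"]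
      by (simp add: f_def abs_mult indicator_def power_mult_distrib mult.assoc)
  qed simp
  show ?thesis
  proof (rule Bochner_Integration.integrable_bound)
    show "integrable \<mu> (\<lambda>p. 2 * (indicat_real {0..T} (fst p) * f p)
       + 2 * (case p of (t, \<omega>) \<Rightarrow> indicat_real {0..T} t * (indicat_real A \<omega> * (r i t (s t \<omega>) * (w t \<omega>)\<^sup>2))))"
      by (intro Bochner_Integration.integrable_add integrable_mult_right gz energy)
    have "(\<lambda>p. excess (fst p) (snd p)) \<in> borel_measurable (horizon \<Otimes>\<^sub>M M)"
      unfolding excess_def by measurable
    from measurable_extend_interval[OF this T_nonneg]
    show "(on_horizon excess) \<in> borel_measurable \<mu>"
      by (simp add: case_prod_beta')
    have key: "\<bar>excess t \<omega>\<bar> \<le> \<bar>2 * f (t, \<omega>) + 2 * (indicat_real A \<omega> * (r i t (s t \<omega>) * (w t \<omega>)\<^sup>2))\<bar>"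
      if "t \<in> {0..T}" for t \<omega>
    proof -
      define u where "u = gain i t (s t \<omega>) * z t \<omega>"
      have "(w t \<omega> + u)\<^sup>2 \<le> 2 * u\<^sup>2 + 2 * (w t \<omega>)\<^sup>2"
        using sum_squares_bound[of "w t \<omega>" u] by (simp add: power2_sum)
      then have "r i t (s t \<omega>) * (w t \<omega> + u)\<^sup>2 \<le> r i t (s t \<omega>) * (2 * u\<^sup>2 + 2 * (w t \<omega>)\<^sup>2)"
        using r_pos[OF player that, of "s t \<omega>"] by (intro mult_left_mono) auto
      then show ?thesis
        using r_pos[OF player that, of "s t \<omega>"]
        by (auto simp: excess_def f_def u_def indicator_def algebra_simps)
    qed
    then show "AE p in \<mu>. norm (on_horizon excess p)
      \<le> norm (2 * (indicat_real {0..T} (fst p) * f p)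
       + 2 * (case p of (t, \<omega>) \<Rightarrow> indicat_real {0..T} t * (indicat_real A \<omega> * (r i t (s t \<omega>) * (w t \<omega>)\<^sup>2))))"
      by (intro AE_I2) (auto simp: indicator_def split: prod.splits)
  qed
qed

text \<open>
  Dynkin's formula for each frozen value, summed over the regimes; the terminal condition turns the
  final value into the terminal cost. The running cost is integrable as the difference of the excess and
  the sum of the generators.
\<close>

lemma cost_identity:
  shows "integrable \<mu> (on_horizon running_cost)"
    and "integrable M (\<lambda>\<omega>. indicat_real A \<omega> * (q i T (s T \<omega>) * (z T \<omega>)\<^sup>2))"
    and "integrable M (\<lambda>\<omega>. indicat_real A \<omega> * (\<alpha> i 0 (s0 \<omega>) * (ln (x0 \<omega>))\<^sup>2))"
    and "expectation (\<lambda>\<omega>. indicat_real A \<omega> * (q i T (s T \<omega>) * (z T \<omega>)\<^sup>2))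
       + integral\<^sup>L \<mu> (on_horizon running_cost)
     = expectation (\<lambda>\<omega>. indicat_real A \<omega> * (\<alpha> i 0 (s0 \<omega>) * (ln (x0 \<omega>))\<^sup>2))
       + integral\<^sup>L \<mu> (on_horizon excess)"
proof -
  interpret V: adapted_primitive M F T rate s0 s "value_part a" "value_speed a" for a
    by (rule adapted_value)
  have T0: "0 \<in> {0..T}" "T \<in> {0..T}" using T_nonneg by auto
  have end_int: "integrable M (\<lambda>\<omega>. value_part a t \<omega> * ind a t \<omega>)" if "t \<in> {0..T}" for a t
  proof -
    have [measurable]: "s t \<in> measurable M (count_space UNIV)" using that by (rule measurable_regime)
    show ?thesis by (rule V.Y_bounded_mult_integrable[OF that, where C = 1]) auto
  qed
  have part_sum: "(\<Sum>a\<in>UNIV. value_part a t \<omega> * ind a t \<omega>) = value_part (s t \<omega>) t \<omega>" for t \<omega>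
    by (simp add: indicator_def of_bool_def if_distrib sum.delta cong: if_cong)
  have part_int: "integrable M (\<lambda>\<omega>. value_part (s t \<omega>) t \<omega>)" if "t \<in> {0..T}" for t
    unfolding part_sum[symmetric] by (rule Bochner_Integration.integrable_sum) (rule end_int[OF that])
  have part_exp: "expectation (\<lambda>\<omega>. value_part (s t \<omega>) t \<omega>) = (\<Sum>a\<in>UNIV. expectation (\<lambda>\<omega>. value_part a t \<omega> * ind a t \<omega>))"
    if "t \<in> {0..T}" for t
    unfolding part_sum[symmetric] by (rule Bochner_Integration.integral_sum) (rule end_int[OF that])
  have gen_eq: "(\<lambda>p. \<Sum>a\<in>UNIV. on_horizon (V.generator a a) p)
      = (\<lambda>p. (on_horizon excess p) - (on_horizon running_cost p))"
  proof (rule ext, clarify)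
    fix t \<omega>
    show "(\<Sum>a\<in>UNIV. indicat_real {0..T} t * V.generator a a t \<omega>) = indicat_real {0..T} t * excess t \<omega> - indicat_real {0..T} t * running_cost t \<omega>"
      using completing_the_square[of t \<omega>]
      by (cases "t \<in> {0..T}") (simp_all add: V.generator_def)
  qed
  have gen_int: "integrable \<mu> (\<lambda>p. \<Sum>a\<in>UNIV. on_horizon (V.generator a a) p)"
    by (intro Bochner_Integration.integrable_sum V.generator_integrable)
  from Bochner_Integration.integrable_diff[OF excess_integrable this[unfolded gen_eq]]
  show run_int: "integrable \<mu> (on_horizon running_cost)"
    by (simp add: case_prod_beta')
  have final_eq: "value_part (s T \<omega>) T \<omega> = indicat_real A \<omega> * (q i T (s T \<omega>) * (z T \<omega>)\<^sup>2)" for \<omega>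
    by (simp add: value_part_def terminal[OF player])
  show "integrable M (\<lambda>\<omega>. indicat_real A \<omega> * (q i T (s T \<omega>) * (z T \<omega>)\<^sup>2))"
    using part_int[OF T0(2)] by (simp add: final_eq)
  have s_start: "\<And>\<omega>. \<omega> \<in> space M \<Longrightarrow> s 0 \<omega> = s0 \<omega>"
    using switching by (simp add: regime_switching_def)
  have start: "AE \<omega> in M. value_part (s 0 \<omega>) 0 \<omega> = indicat_real A \<omega> * (\<alpha> i 0 (s0 \<omega>) * (ln (x0 \<omega>))\<^sup>2)"
    using z_primitive AE_space by eventually_elim (simp add: value_part_def s_start)
  have "s0 \<in> measurable M (count_space UNIV)"
    using measurable_regime[OF T0(1)] by (rule measurable_cong[THEN iffD1, rotated]) (rule s_start)
  moreover have "x0 \<in> borel_measurable M" using x0_measurable by (rule measurable_F_M)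
  ultimately have [measurable]: "(\<lambda>\<omega>. indicat_real A \<omega> * (\<alpha> i 0 (s0 \<omega>) * (ln (x0 \<omega>))\<^sup>2)) \<in> borel_measurable M"
    by measurable
  show "integrable M (\<lambda>\<omega>. indicat_real A \<omega> * (\<alpha> i 0 (s0 \<omega>) * (ln (x0 \<omega>))\<^sup>2))"
    by (rule integrable_cong_AE_imp[OF part_int[OF T0(1)] _ start]) measurable
  have start_exp: "expectation (\<lambda>\<omega>. value_part (s 0 \<omega>) 0 \<omega>) = expectation (\<lambda>\<omega>. indicat_real A \<omega> * (\<alpha> i 0 (s0 \<omega>) * (ln (x0 \<omega>))\<^sup>2))"
    using start part_int[OF T0(1)] by (intro integral_cong_AE) auto
  have "expectation (\<lambda>\<omega>. value_part (s T \<omega>) T \<omega>) = (\<Sum>a\<in>UNIV. expectation (\<lambda>\<omega>. value_part a 0 \<omega> * ind a 0 \<omega>)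
     + integral\<^sup>L \<mu> (on_horizon (V.generator a a)))"
    unfolding part_exp[OF T0(2)] by (rule sum.cong[OF refl V.dynkin_formula])
  also have "\<dots> = expectation (\<lambda>\<omega>. value_part (s 0 \<omega>) 0 \<omega>)
     + integral\<^sup>L \<mu> (\<lambda>p. \<Sum>a\<in>UNIV. on_horizon (V.generator a a) p)"
    by (simp add: sum.distrib part_exp[OF T0(1)] Bochner_Integration.integral_sum[OF V.generator_integrable])
  also have "integral\<^sup>L \<mu> (\<lambda>p. \<Sum>a\<in>UNIV. on_horizon (V.generator a a) p)
     = integral\<^sup>L \<mu> (on_horizon excess)
      - integral\<^sup>L \<mu> (on_horizon running_cost)"
    unfolding gen_eq by (rule Bochner_Integration.integral_diff[OF excess_integrable run_int])
  finally show "expectation (\<lambda>\<omega>. indicat_real A \<omega> * (q i T (s T \<omega>) * (z T \<omega>)\<^sup>2))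
       + integral\<^sup>L \<mu> (on_horizon running_cost)
     = expectation (\<lambda>\<omega>. indicat_real A \<omega> * (\<alpha> i 0 (s0 \<omega>) * (ln (x0 \<omega>))\<^sup>2))
       + integral\<^sup>L \<mu> (on_horizon excess)"
    unfolding final_eq start_exp by linarith
qed

end

context unilateral_deviation
begin

definition "path_cost \<omega> = ennreal (q i T (s T \<omega>) * (ln (y T \<omega>))\<^sup>2) +
  (\<integral>\<^sup>+t\<in>{0..T}. ennreal (q i t (s t \<omega>) * (ln (y t \<omega>))\<^sup>2 + r i t (s t \<omega>) * (w t \<omega>)\<^sup>2) \<partial>lborel)"

lemma expected_cost_eq: "expected_cost M T (q i) (r i) s y w = (\<integral>\<^sup>+\<omega>. path_cost \<omega> \<partial>M)"
  by (simp add: expected_cost_def path_cost_def)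

lemma measurable_ennreal_extend:
  assumes [measurable]: "(\<lambda>p. g (fst p) (snd p)) \<in> borel_measurable (horizon \<Otimes>\<^sub>M M)"
  shows "(\<lambda>p. indicator {0..T} (fst p) * ennreal (g (fst p) (snd p))) \<in> borel_measurable \<mu>"
proof -
  have "(\<lambda>p. ennreal (indicat_real {0..T} (fst p) * g (fst p) (snd p))) \<in> borel_measurable \<mu>"
    by (intro measurable_compose[OF measurable_extend_interval[OF assms T_nonneg] measurable_ennreal])
  also have "(\<lambda>p. ennreal (indicat_real {0..T} (fst p) * g (fst p) (snd p))) = (\<lambda>p. indicator {0..T} (fst p) * ennreal (g (fst p) (snd p)))"
    by (auto simp: indicator_def)
  finally show ?thesis .
qed

lemma path_cost_measurable [measurable]: "path_cost \<in> borel_measurable M"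
proof -
  have [measurable]: "s T \<in> measurable M (count_space UNIV)" "y T \<in> borel_measurable M"
    using T_nonneg y_adapted[of T] measurable_F_M by (auto intro: measurable_regime)
  have "(\<lambda>p. q i (fst p) (s (fst p) (snd p)) * (z (fst p) (snd p))\<^sup>2 + r i (fst p) (s (fst p) (snd p)) * (w (fst p) (snd p))\<^sup>2)
     \<in> borel_measurable (horizon \<Otimes>\<^sub>M M)"
    by measurable
  from measurable_ennreal_extend[OF this]
  have "(\<lambda>\<omega>. \<integral>\<^sup>+t. indicator {0..T} t * ennreal (q i t (s t \<omega>) * (z t \<omega>)\<^sup>2 + r i t (s t \<omega>) * (w t \<omega>)\<^sup>2) \<partial>lborel) \<in> borel_measurable M"
    by (intro lborel.borel_measurable_nn_integral) (simp add: measurable_split_conv case_prod_beta' measurable_pair_swap_iff[of _ M lborel])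
  then show ?thesis
    unfolding path_cost_def[abs_def] z_def by (simp add: mult.commute)
qed

end

context localized_deviation
begin

lemma localized_cost:
  "(\<integral>\<^sup>+\<omega>. indicator A \<omega> * path_cost \<omega> \<partial>M)
    = ennreal (expectation (\<lambda>\<omega>. indicat_real A \<omega> * (\<alpha> i 0 (s0 \<omega>) * (ln (x0 \<omega>))\<^sup>2))
       + integral\<^sup>L \<mu> (on_horizon excess))"
proof -
  have nn_T: "0 \<le> indicat_real A \<omega> * (q i T (s T \<omega>) * (z T \<omega>)\<^sup>2)" for \<omega>
    using q_nonneg[OF player, of T "s T \<omega>"] T_nonneg by simp
  have nn_run: "0 \<le> indicat_real {0..T} t * running_cost t \<omega>" for t \<omega>
    using q_nonneg[OF player, of t "s t \<omega>"] r_pos[OF player, of t "s t \<omega>"]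
    by (cases "t \<in> {0..T}") (auto simp: running_cost_def)
  have "(\<integral>\<^sup>+\<omega>. indicator A \<omega> * path_cost \<omega> \<partial>M)
     = (\<integral>\<^sup>+\<omega>. ennreal (indicat_real A \<omega> * (q i T (s T \<omega>) * (z T \<omega>)\<^sup>2))
         + (\<integral>\<^sup>+t. ennreal (indicat_real {0..T} t * running_cost t \<omega>) \<partial>lborel) \<partial>M)"
  proof (rule nn_integral_cong)
    fix \<omega>
    show "indicator A \<omega> * path_cost \<omega> = ennreal (indicat_real A \<omega> * (q i T (s T \<omega>) * (z T \<omega>)\<^sup>2))
         + (\<integral>\<^sup>+t. ennreal (indicat_real {0..T} t * running_cost t \<omega>) \<partial>lborel)"
    proof (cases "\<omega> \<in> A")
      case True
      then have "(\<integral>\<^sup>+t. ennreal (indicat_real {0..T} t * running_cost t \<omega>) \<partial>lborel)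
        = (\<integral>\<^sup>+t\<in>{0..T}. ennreal (q i t (s t \<omega>) * (ln (y t \<omega>))\<^sup>2 + r i t (s t \<omega>) * (w t \<omega>)\<^sup>2) \<partial>lborel)"
        by (intro nn_integral_cong) (auto simp: running_cost_def z_def indicator_def)
      with True show ?thesis by (simp add: path_cost_def z_def)
    next
      case False
      then show ?thesis by (simp add: running_cost_def)
    qed
  qed
  also have "\<dots> = (\<integral>\<^sup>+\<omega>. ennreal (indicat_real A \<omega> * (q i T (s T \<omega>) * (z T \<omega>)\<^sup>2)) \<partial>M)
      + (\<integral>\<^sup>+\<omega>. (\<integral>\<^sup>+t. ennreal (indicat_real {0..T} t * running_cost t \<omega>) \<partial>lborel) \<partial>M)"
  proof (rule nn_integral_add)
    show "(\<lambda>\<omega>. ennreal (indicat_real A \<omega> * (q i T (s T \<omega>) * (z T \<omega>)\<^sup>2))) \<in> borel_measurable M"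
      using cost_identity(2) by simp
    have "(\<lambda>(t, \<omega>). ennreal (indicat_real {0..T} t * running_cost t \<omega>)) \<in> borel_measurable \<mu>"
      using measurable_compose[OF borel_measurable_integrable[OF cost_identity(1)] measurable_ennreal] by (simp add: case_prod_beta')
    then show "(\<lambda>\<omega>. \<integral>\<^sup>+t. ennreal (indicat_real {0..T} t * running_cost t \<omega>) \<partial>lborel) \<in> borel_measurable M"
      by (intro lborel.borel_measurable_nn_integral) (simp add: measurable_split_conv case_prod_beta' measurable_pair_swap_iff[of _ M lborel])
  qed
  also have "(\<integral>\<^sup>+\<omega>. ennreal (indicat_real A \<omega> * (q i T (s T \<omega>) * (z T \<omega>)\<^sup>2)) \<partial>M)
     = ennreal (expectation (\<lambda>\<omega>. indicat_real A \<omega> * (q i T (s T \<omega>) * (z T \<omega>)\<^sup>2)))"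
    using nn_T by (intro nn_integral_eq_integral cost_identity(2)) auto
  also have "(\<integral>\<^sup>+\<omega>. (\<integral>\<^sup>+t. ennreal (indicat_real {0..T} t * running_cost t \<omega>) \<partial>lborel) \<partial>M)
     = (\<integral>\<^sup>+p. ennreal (on_horizon running_cost p) \<partial>\<mu>)"
    using prod.nn_integral_snd[of "\<lambda>p. ennreal (on_horizon running_cost p)"]
      borel_measurable_integrable[OF cost_identity(1)] by simp
  also have "\<dots> = ennreal (integral\<^sup>L \<mu> (on_horizon running_cost))"
    using nn_run by (intro nn_integral_eq_integral cost_identity(1)) auto
  also have "ennreal (expectation (\<lambda>\<omega>. indicat_real A \<omega> * (q i T (s T \<omega>) * (z T \<omega>)\<^sup>2)))
      + ennreal (integral\<^sup>L \<mu> (on_horizon running_cost))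
     = ennreal (expectation (\<lambda>\<omega>. indicat_real A \<omega> * (q i T (s T \<omega>) * (z T \<omega>)\<^sup>2))
       + integral\<^sup>L \<mu> (on_horizon running_cost))"
    using nn_T nn_run by (intro ennreal_plus[symmetric] Bochner_Integration.integral_nonneg) auto
  finally show ?thesis unfolding cost_identity(4) .
qed

end

section \<open>The closed loop and the costs at equilibrium\<close>

context log_quadratic_game
begin

text \<open>
  With everybody using the feedback law, \<open>z' = closed_rate * z\<close>, which integrates explicitly.
\<close>

definition "exponent t \<omega> = (LBINT u:{0..t}. closed_rate u (s u \<omega>))"
definition "solution t \<omega> = exp (ln (x0 \<omega>) * exp (exponent t \<omega>))"

lemma closed_rate_product:
  "(\<lambda>p. indicat_real {0..T} (fst p) * closed_rate (fst p) (s (fst p) (snd p))) \<in> borel_measurable \<mu>"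
  by (intro measurable_extend_interval regime_coefficient_measurable T_nonneg rate_measurable)

lemma closed_rate_path_integrable:
  assumes "\<omega> \<in> space M"
  shows "set_integrable lborel {0..T} (\<lambda>u. closed_rate u (s u \<omega>))"
proof (rule set_integrable_bound)
  have "integrable lborel (\<lambda>t. \<Sum>a\<in>UNIV. \<bar>indicat_real {0..T} t *\<^sub>R closed_rate t a\<bar>)"
    using rate_integrable(2) unfolding set_integrable_def
    by (intro Bochner_Integration.integrable_sum integrable_abs) auto
  then show "set_integrable lborel {0..T} (\<lambda>t. \<Sum>a\<in>UNIV. \<bar>closed_rate t a\<bar>)"
    unfolding set_integrable_def by (simp add: sum_distrib_left abs_mult)
  from measurable_compose[OF measurable_Pair2'[OF assms] closed_rate_product]
  show "set_borel_measurable lborel {0..T} (\<lambda>u. closed_rate u (s u \<omega>))"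
    by (simp add: set_borel_measurable_def)
  show "AE u in lborel. u \<in> {0..T} \<longrightarrow> norm (closed_rate u (s u \<omega>)) \<le> norm (\<Sum>a\<in>UNIV. \<bar>closed_rate u a\<bar>)"
  proof (intro AE_I2 impI)
    fix u
    have "\<bar>closed_rate u (s u \<omega>)\<bar> \<le> (\<Sum>a\<in>UNIV. \<bar>closed_rate u a\<bar>)"
      by (rule member_le_sum[of "s u \<omega>" UNIV "\<lambda>a. \<bar>closed_rate u a\<bar>"]) auto
    then show "norm (closed_rate u (s u \<omega>)) \<le> norm (\<Sum>a\<in>UNIV. \<bar>closed_rate u a\<bar>)" by simp
  qed
qed

text \<open>
  This is where progressive measurability of the regime is used: the integral up to \<open>t\<close> is
  \<open>F t\<close>-measurable.
\<close>

lemma exponent_adapted: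
  assumes "t \<in> {0..T}" shows "exponent t \<in> borel_measurable (F t)"
proof -
  have "(\<lambda>u. closed_rate u a) \<in> borel_measurable (restrict_space borel {0..t})" for a
    using measurable_restrict_mono[OF rate_measurable(2)[of a], of "{0..t}"] assms by auto
  then have "(\<lambda>p. closed_rate (fst p) a) \<in> borel_measurable (restrict_space borel {0..t} \<Otimes>\<^sub>M F t)" for a
    by (rule measurable_compose[OF measurable_fst])
  then have "(\<lambda>p. closed_rate (fst p) (s (fst p) (snd p))) \<in> borel_measurable (restrict_space borel {0..t} \<Otimes>\<^sub>M F t)"
    using assms by (intro measurable_compose_countable[where f = "\<lambda>a p. closed_rate (fst p) a", OF _ progressively_measurable_regime]) auto
  from measurable_extend_interval[OF this]
  have "(\<lambda>p. indicat_real {0..t} (fst p) * closed_rate (fst p) (s (fst p) (snd p))) \<in> borel_measurable (lborel \<Otimes>\<^sub>M F t)"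
    using assms by simp
  from measurable_compose[OF measurable_pair_swap' this]
  have "(\<lambda>(\<omega>, u). indicat_real {0..t} u * closed_rate u (s u \<omega>)) \<in> borel_measurable (F t \<Otimes>\<^sub>M lborel)"
    by (simp add: case_prod_beta')
  from lborel.borel_measurable_lebesgue_integral[OF this] show ?thesis
    by (simp add: exponent_def[abs_def] set_lebesgue_integral_def)
qed

lemma exponent_product: "(\<lambda>p. exponent (fst p) (snd p)) \<in> borel_measurable (horizon \<Otimes>\<^sub>M M)"
proof -
  define g where "g = (\<lambda>p. indicat_real {0..T} (fst p) * closed_rate (fst p) (s (fst p) (snd p)))"
  have "(\<lambda>x. (snd x, snd (fst x))) \<in> measurable ((horizon \<Otimes>\<^sub>M M) \<Otimes>\<^sub>M lborel) \<mu>"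
    by measurable
  from measurable_compose[OF this closed_rate_product]
  have [measurable]: "(\<lambda>x. g (snd x, snd (fst x))) \<in> borel_measurable ((horizon \<Otimes>\<^sub>M M) \<Otimes>\<^sub>M lborel)"
    by (simp add: g_def)
  have [measurable]: "(\<lambda>x. fst (fst x)) \<in> borel_measurable ((horizon \<Otimes>\<^sub>M M) \<Otimes>\<^sub>M lborel)"
    by (intro measurable_compose[OF measurable_fst measurable_compose[OF measurable_fst measurable_restrict_space1]]) simp
  have [measurable]: "(\<lambda>x. snd x) \<in> borel_measurable ((horizon \<Otimes>\<^sub>M M) \<Otimes>\<^sub>M lborel)"
    by measurable
  have "(\<lambda>x. if snd x \<le> fst (fst x) then g (snd x, snd (fst x)) else 0) \<in> borel_measurable ((horizon \<Otimes>\<^sub>M M) \<Otimes>\<^sub>M lborel)"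
    by measurable
  then have "(\<lambda>p. LBINT u. (if u \<le> fst p then g (u, snd p) else 0)) \<in> borel_measurable (horizon \<Otimes>\<^sub>M M)"
    by (intro lborel.borel_measurable_lebesgue_integral) (simp add: case_prod_beta')
  moreover have "exponent (fst p) (snd p) = (LBINT u. (if u \<le> fst p then g (u, snd p) else 0))"
    if "p \<in> space (horizon \<Otimes>\<^sub>M M)" for p
    unfolding exponent_def set_lebesgue_integral_def
    using that by (intro Bochner_Integration.integral_cong) (auto simp: g_def indicator_def space_pair_measure space_restrict_space)
  ultimately show ?thesis
    by (simp cong: measurable_cong)
qed

lemma solution_trajectory:
  assumes law: "\<And>j t x a. j \<in> {1..I} \<Longrightarrow> \<phi> j t x a = - gain j t a * ln x"
  shows "trajectory M F T I b1 b2 s x0 (feedback_control \<phi> s solution) solution"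
  unfolding trajectory_def
proof (intro conjI ballI)
  have [measurable]: "x0 \<in> borel_measurable M" using x0_measurable by (rule measurable_F_M)
  have adapted: "solution t \<in> borel_measurable (F t)" if "t \<in> {0..T}" for t
  proof -
    have [measurable]: "x0 \<in> borel_measurable (F t)" using x0_measurable that by (auto intro: measurable_F_mono)
    have [measurable]: "exponent t \<in> borel_measurable (F t)" using that by (rule exponent_adapted)
    show ?thesis unfolding solution_def[abs_def] by measurable
  qed
  have product [measurable]: "(\<lambda>p. solution (fst p) (snd p)) \<in> borel_measurable (horizon \<Otimes>\<^sub>M M)"
    unfolding solution_def using exponent_product by measurable
  show "adapted_process M F T solution"
    unfolding adapted_process_def using adapted product by (simp add: case_prod_beta')
  fix j assume j: "j \<in> {1..I}"
  show "adapted_process M F T (feedback_control \<phi> s solution j)"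
    unfolding adapted_process_def
  proof (intro conjI ballI)
    fix t assume t: "t \<in> {0..T}"
    have "(\<lambda>\<omega>. - gain j t (s t \<omega>) * ln (solution t \<omega>)) \<in> borel_measurable (F t)"
      using t adapted[OF t] by (intro borel_measurable_times borel_measurable_uminus regime_coefficient_adapted borel_measurable_ln)
    then show "feedback_control \<phi> s solution j t \<in> borel_measurable (F t)"
      by (simp add: feedback_control_def[abs_def] law[OF j])
  next
    have [measurable]: "(\<lambda>p. gain j (fst p) (s (fst p) (snd p))) \<in> borel_measurable (horizon \<Otimes>\<^sub>M M)"
      using j by (intro regime_coefficient_measurable gain_measurable)
    have "(\<lambda>p. - gain j (fst p) (s (fst p) (snd p)) * ln (solution (fst p) (snd p))) \<in> borel_measurable (horizon \<Otimes>\<^sub>M M)"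
      by measurable
    then show "(\<lambda>(t, \<omega>). feedback_control \<phi> s solution j t \<omega>) \<in> borel_measurable (horizon \<Otimes>\<^sub>M M)"
      by (simp add: feedback_control_def law[OF j] case_prod_beta')
  qed
next
  show "AE \<omega> in M. set_integrable lborel {0..T}
             (\<lambda>t. drift I b1 b2 t (s t \<omega>) (solution t \<omega>) (\<lambda>j. feedback_control \<phi> s solution j t \<omega>)) \<and>
            (\<forall>t\<in>{0..T}. 0 < solution t \<omega> \<and>
                 solution t \<omega> = x0 \<omega> + (LBINT t':{0..t}.
                   drift I b1 b2 t' (s t' \<omega>) (solution t' \<omega>) (\<lambda>j. feedback_control \<phi> s solution j t' \<omega>)))"
    using x0_gt AE_space
  proof eventually_elim
    case (elim \<omega>)
    define \<xi> where "\<xi> = ln (x0 \<omega>)"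
    let ?d = "\<lambda>t. drift I b1 b2 t (s t \<omega>) (solution t \<omega>) (\<lambda>j. feedback_control \<phi> s solution j t \<omega>)"
    have x0_pos: "0 < x0 \<omega>" using elim(1) exp_gt_zero[of "1::real"] by linarith
    have "primitive_on T (\<lambda>u. closed_rate u (s u \<omega>)) (\<lambda>t. exponent t \<omega>)"
      using primitive_on_indefinite_integral[OF closed_rate_path_integrable[OF elim(2)], of 0] by (simp add: exponent_def)
    then have "primitive_on T (\<lambda>t. exp (exponent t \<omega>) * closed_rate t (s t \<omega>)) (\<lambda>t. exp (exponent t \<omega>))"
      by (rule primitive_on_compose[OF _ T_nonneg]) (rule DERIV_exp, intro continuous_intros)
    then have "primitive_on T (\<lambda>t. \<xi> * (exp (exponent t \<omega>) * closed_rate t (s t \<omega>))) (\<lambda>t. \<xi> * exp (exponent t \<omega>))"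
      by (rule primitive_on_cmult)
    then have "primitive_on T (\<lambda>t. exp (\<xi> * exp (exponent t \<omega>)) * (\<xi> * (exp (exponent t \<omega>) * closed_rate t (s t \<omega>))))
       (\<lambda>t. exp (\<xi> * exp (exponent t \<omega>)))"
      by (rule primitive_on_compose[OF _ T_nonneg]) (rule DERIV_exp, intro continuous_intros)
    then have prim: "primitive_on T ?d (\<lambda>t. solution t \<omega>)"
    proof (rule primitive_on_cong)
      fix t
      have "(\<Sum>j\<in>{1..I}. b2 j t (s t \<omega>) * solution t \<omega> * feedback_control \<phi> s solution j t \<omega>)
         = (\<Sum>j\<in>{1..I}. - (solution t \<omega> * ln (solution t \<omega>)) * (b2 j t (s t \<omega>) * gain j t (s t \<omega>)))"
        by (intro sum.cong refl) (simp add: feedback_control_def law)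
      also have "\<dots> = - (solution t \<omega> * ln (solution t \<omega>)) * (\<Sum>j\<in>{1..I}. b2 j t (s t \<omega>) * gain j t (s t \<omega>))"
        by (rule sum_distrib_left[symmetric])
      finally have "?d t = solution t \<omega> * (ln (solution t \<omega>) * closed_rate t (s t \<omega>))"
        by (simp add: drift_def closed_rate_def algebra_simps)
      then show "exp (\<xi> * exp (exponent t \<omega>)) * (\<xi> * (exp (exponent t \<omega>) * closed_rate t (s t \<omega>))) = ?d t"
        by (simp add: solution_def \<xi>_def)
    qed (simp_all add: solution_def \<xi>_def T_nonneg)
    have "exponent 0 \<omega> = 0" by (simp add: exponent_def set_integral_at_point)
    then have start: "solution 0 \<omega> = x0 \<omega>" using x0_pos by (simp add: solution_def)
    have "solution t \<omega> = x0 \<omega> + (LBINT t':{0..t}. ?d t')" if "t \<in> {0..T}" for t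
      using primitive_onD(2)[OF prim that] unfolding start .
    moreover have "0 < solution t \<omega>" for t by (simp add: solution_def)
    ultimately show ?case using primitive_onD(1)[OF prim] by blast
  qed
qed

text \<open>
  Along the closed loop \<open>z\<^sup>2\<close> is at most a constant times \<open>z(0)\<^sup>2\<close>, hence bounded on \<open>A\<close>, and the cost
  of the control is finite because \<open>r * gain\<^sup>2\<close> has an integrable bound.
\<close>

lemma equilibrium_localized:
  assumes law: "\<And>j t x a. j \<in> {1..I} \<Longrightarrow> \<phi> j t x a = - gain j t a * ln x"
    and traj: "trajectory M F T I b1 b2 s x0 (feedback_control \<phi> s x) x"
    and i: "i \<in> {1..I}" and A: "A \<in> sets (F 0)" "\<And>\<omega>. \<omega> \<in> A \<Longrightarrow> \<bar>ln (x0 \<omega>)\<bar> \<le> c"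
  shows "localized_deviation M F T rate s0 s \<delta> I x0 b1 b2 q r \<alpha> \<phi> i (feedback_control \<phi> s x i) x A c"
proof -
  let ?w = "feedback_control \<phi> s x i"
  interpret unilateral_deviation M F T rate s0 s \<delta> I x0 b1 b2 q r \<alpha> \<phi> i ?w x
    by unfold_locales (use i law traj in auto)
  have w: "?w t \<omega> = - gain i t (s t \<omega>) * z t \<omega>" for t \<omega>
    by (simp add: feedback_control_def law[OF i] z_def)
  have z': "z' t \<omega> = closed_rate t (s t \<omega>) * z t \<omega>" for t \<omega>
    by (simp add: z'_def w closed_rate_eq[OF i] algebra_simps)
  define k where "k t = (\<Sum>a\<in>UNIV. 2 * \<bar>closed_rate t a\<bar>)" for t
  have "integrable lborel (\<lambda>t. \<Sum>a\<in>UNIV. 2 * \<bar>indicat_real {0..T} t *\<^sub>R closed_rate t a\<bar>)"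
    using rate_integrable(2) unfolding set_integrable_def
    by (intro Bochner_Integration.integrable_sum integrable_mult_right integrable_abs) auto
  then have k_int: "set_integrable lborel {0..T} k"
    unfolding set_integrable_def k_def by (simp add: sum_distrib_left abs_mult mult.left_commute)
  have k_ge: "2 * \<bar>closed_rate t a\<bar> \<le> k t" for t a
    unfolding k_def by (rule member_le_sum[of a UNIV "\<lambda>a. 2 * \<bar>closed_rate t a\<bar>"]) auto
  have k0: "0 \<le> k t" for t by (simp add: k_def sum_nonneg)
  define K where "K = exp (LBINT t:{0..T}. k t)"
  have bound: "AE \<omega> in M. \<forall>t\<in>{0..T}. indicat_real A \<omega> * (z t \<omega>)\<^sup>2 \<le> K * c\<^sup>2"
    using z_primitive
  proof eventually_elim
    case (elim \<omega>)
    have prim: "primitive_on T (\<lambda>t. 2 * z t \<omega> * z' t \<omega>) (\<lambda>t. (z t \<omega>)\<^sup>2)"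
      using elim T_nonneg by (intro primitive_on_square) auto
    have le: "2 * z t \<omega> * z' t \<omega> \<le> k t * (z t \<omega>)\<^sup>2 + 0" for t
    proof -
      have "2 * z t \<omega> * z' t \<omega> = 2 * closed_rate t (s t \<omega>) * (z t \<omega>)\<^sup>2"
        by (simp add: z' power2_eq_square)
      also have "\<dots> \<le> k t * (z t \<omega>)\<^sup>2"
        using k_ge[of t "s t \<omega>"] by (intro mult_right_mono) auto
      finally show ?thesis by simp
    qed
    show ?case
    proof
      fix t assume t: "t \<in> {0..T}"
      have "(z t \<omega>)\<^sup>2 \<le> K * ((z 0 \<omega>)\<^sup>2 + (LBINT t:{0..T}. 0))"
        unfolding K_def
        by (rule primitive_on_gronwall[OF prim T_nonneg k_int]) (use k0 le t in \<open>auto simp: set_integrable_def\<close>)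
      then have "(z t \<omega>)\<^sup>2 \<le> K * (z 0 \<omega>)\<^sup>2" by simp
      moreover have "K * (z 0 \<omega>)\<^sup>2 \<le> K * c\<^sup>2" if "\<omega> \<in> A"
        using A(2)[OF that] elim by (intro mult_left_mono) (auto simp: K_def abs_le_square_iff[symmetric])
      ultimately have "(z t \<omega>)\<^sup>2 \<le> K * c\<^sup>2" if "\<omega> \<in> A"
        using that order_trans by blast
      moreover have "0 \<le> K * c\<^sup>2" by (simp add: K_def)
      ultimately show "indicat_real A \<omega> * (z t \<omega>)\<^sup>2 \<le> K * c\<^sup>2"
        by (cases "\<omega> \<in> A") simp_all
    qed
  qed
  have A_M [measurable]: "A \<in> sets M" using A(1) subalg by (auto simp: subalgebra_def)
  obtain m where m_int: "set_integrable lborel {0..T} m"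
    and m_ge: "\<And>t a. t \<in> {0..T} \<Longrightarrow> r i t a * (gain i t a)\<^sup>2 \<le> m t"
    using gain_weight_dominated[OF i] by blast
  have "integrable \<mu> (\<lambda>(t, \<omega>). indicat_real {0..T} t * (indicat_real A \<omega> * (r i t (s t \<omega>) * (?w t \<omega>)\<^sup>2)))"
  proof (rule Bochner_Integration.integrable_bound)
    show "integrable \<mu> (\<lambda>p. (indicat_real {0..T} (fst p) *\<^sub>R m (fst p)) * (K * c\<^sup>2))"
      using prod.integrable_mult_pair[OF m_int[unfolded set_integrable_def], of "\<lambda>_. K * c\<^sup>2"] by simp
    have "(\<lambda>p. indicat_real A (snd p) * (r i (fst p) (s (fst p) (snd p)) * (?w (fst p) (snd p))\<^sup>2)) \<in> borel_measurable (horizon \<Otimes>\<^sub>M M)"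
      by measurable
    from measurable_extend_interval[OF this T_nonneg]
    show "(\<lambda>(t, \<omega>). indicat_real {0..T} t * (indicat_real A \<omega> * (r i t (s t \<omega>) * (?w t \<omega>)\<^sup>2))) \<in> borel_measurable \<mu>"
      by (simp add: case_prod_beta')
    have "AE p in \<mu>. \<forall>t\<in>{0..T}. indicat_real A (snd p) * (z t (snd p))\<^sup>2 \<le> K * c\<^sup>2"
      using bound by (intro AE_snd_pair) (unfold_locales)
    then show "AE p in \<mu>. norm (case p of (t, \<omega>) \<Rightarrow> indicat_real {0..T} t * (indicat_real A \<omega> * (r i t (s t \<omega>) * (?w t \<omega>)\<^sup>2)))
       \<le> norm ((indicat_real {0..T} (fst p) *\<^sub>R m (fst p)) * (K * c\<^sup>2))"
    proof eventually_elim
      case (elim p)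
      obtain t \<omega> where p: "p = (t, \<omega>)" by (cases p)
      show ?case
      proof (cases "t \<in> {0..T}")
        case True
        have r0: "0 < r i t (s t \<omega>)" using r_pos[OF i True] .
        have e: "indicat_real A \<omega> * (r i t (s t \<omega>) * (?w t \<omega>)\<^sup>2)
            = (r i t (s t \<omega>) * (gain i t (s t \<omega>))\<^sup>2) * (indicat_real A \<omega> * (z t \<omega>)\<^sup>2)"
          by (simp add: w power_mult_distrib)
        have "(r i t (s t \<omega>) * (gain i t (s t \<omega>))\<^sup>2) * (indicat_real A \<omega> * (z t \<omega>)\<^sup>2) \<le> m t * (K * c\<^sup>2)"
        proof (rule mult_mono)
          show "r i t (s t \<omega>) * (gain i t (s t \<omega>))\<^sup>2 \<le> m t" by (rule m_ge[OF True])
          then show "0 \<le> m t" using r0 by (intro order_trans[OF _ m_ge[OF True, of "s t \<omega>"]]) simp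
          show "indicat_real A \<omega> * (z t \<omega>)\<^sup>2 \<le> K * c\<^sup>2" using elim True by (simp add: p)
        qed simp
        also have "\<dots> \<le> \<bar>m t * (K * c\<^sup>2)\<bar>" by (rule abs_ge_self)
        finally have "\<bar>indicat_real A \<omega> * (r i t (s t \<omega>) * (?w t \<omega>)\<^sup>2)\<bar> \<le> \<bar>m t * (K * c\<^sup>2)\<bar>"
          unfolding e[symmetric] using r0 by (simp only: abs_of_nonneg mult_nonneg_nonneg indicator_pos_le less_imp_le zero_le_power2)
        then show ?thesis using True by (simp add: p)
      qed (simp add: p)
    qed
  qed
  then show ?thesis
    by unfold_locales (use A in auto)
qed

lemma s0_measurable: "s0 \<in> measurable (F 0) (count_space UNIV)"
proof -
  have "s 0 \<omega> = s0 \<omega>" if "\<omega> \<in> space (F 0)" for \<omega>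
    using switching that by (simp add: regime_switching_def)
  moreover have "s 0 \<in> measurable (F 0) (count_space UNIV)"
    using T_nonneg by (intro measurable_regime_F) auto
  ultimately show ?thesis by (rule measurable_cong[THEN iffD1])
qed

lemma initial_value_measurable: "(\<lambda>\<omega>. \<alpha> i 0 (s0 \<omega>) * (ln (x0 \<omega>))\<^sup>2) \<in> borel_measurable M"
proof -
  have [measurable]: "s0 \<in> measurable M (count_space UNIV)" "x0 \<in> borel_measurable M"
    using s0_measurable x0_measurable by (auto intro: measurable_F_M)
  show ?thesis by measurable
qed

text \<open>
  On the event \<open>A n\<close> where \<open>\<alpha>\<close> is negative and \<open>\<bar>ln x0\<bar> \<le> n\<close>, the cost identity for the closed loop
  equates a nonnegative cost with the integral of \<open>\<alpha> * (ln x0)\<^sup>2 < 0\<close>. Hence \<open>A n\<close> is null; the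
  assumption \<open>x0 > e\<close> keeps \<open>ln x0\<close> away from zero.
\<close>

lemma \<alpha>_initial_nonneg:
  assumes i: "i \<in> {1..I}"
  shows "AE \<omega> in M. 0 \<le> \<alpha> i 0 (s0 \<omega>)"
proof -
  define \<phi> where "\<phi> j t x a = - gain j t a * ln x" for j :: nat and t x :: real and a
  have law: "\<phi> j t x a = - gain j t a * ln x" for j t x a by (simp add: \<phi>_def)
  define A where "A n = {\<omega> \<in> space M. \<alpha> i 0 (s0 \<omega>) < 0 \<and> \<bar>ln (x0 \<omega>)\<bar> \<le> real n}" for n :: nat
  have "AE \<omega> in M. \<omega> \<notin> A n" for n
  proof -
    have [measurable]: "s0 \<in> measurable (F 0) (count_space UNIV)" "x0 \<in> borel_measurable (F 0)"
      by (rule s0_measurable x0_measurable)+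
    have "{\<omega> \<in> space (F 0). \<alpha> i 0 (s0 \<omega>) < 0 \<and> \<bar>ln (x0 \<omega>)\<bar> \<le> real n} \<in> sets (F 0)"
      by measurable
    then have An: "A n \<in> sets (F 0)" by (simp add: A_def)
    interpret localized_deviation M F T rate s0 s \<delta> I x0 b1 b2 q r \<alpha> \<phi> i "feedback_control \<phi> s solution i" solution "A n" "real n"
      by (rule equilibrium_localized[OF law solution_trajectory[OF law] i An]) (simp add: A_def)
    let ?v = "\<lambda>\<omega>. indicat_real (A n) \<omega> * (\<alpha> i 0 (s0 \<omega>) * (ln (x0 \<omega>))\<^sup>2)"
    have "excess t \<omega> = 0" for t \<omega>
      by (simp add: excess_def z_def feedback_control_def law[OF i])
    then have "expectation ?v = expectation (\<lambda>\<omega>. indicat_real (A n) \<omega> * (q i T (s T \<omega>) * (z T \<omega>)\<^sup>2))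
       + integral\<^sup>L \<mu> (on_horizon running_cost)"
      using cost_identity(4) by (simp add: case_prod_beta')
    moreover have "0 \<le> expectation (\<lambda>\<omega>. indicat_real (A n) \<omega> * (q i T (s T \<omega>) * (z T \<omega>)\<^sup>2))"
      using q_nonneg[OF i, of T] T_nonneg by (intro Bochner_Integration.integral_nonneg) auto
    moreover have "0 \<le> integral\<^sup>L \<mu> (on_horizon running_cost)"
    proof (rule Bochner_Integration.integral_nonneg)
      fix p :: "real \<times> 'a"
      show "0 \<le> (on_horizon running_cost p)"
        using q_nonneg[OF i, of "fst p"] r_pos[OF i, of "fst p"]
        by (cases "fst p \<in> {0..T}") (auto simp: running_cost_def case_prod_beta' less_imp_le)
    qed
    moreover have neg: "0 \<le> - ?v \<omega>" for \<omega>
      by (auto simp: A_def indicator_def mult_nonpos_nonneg)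
    then have "0 \<le> expectation (\<lambda>\<omega>. - ?v \<omega>)" by (rule Bochner_Integration.integral_nonneg)
    moreover have "expectation (\<lambda>\<omega>. - ?v \<omega>) = - expectation ?v" by simp
    ultimately have "expectation (\<lambda>\<omega>. - ?v \<omega>) = 0" by linarith
    moreover have "integrable M (\<lambda>\<omega>. - ?v \<omega>)" using cost_identity(3) by simp
    ultimately have "AE \<omega> in M. - ?v \<omega> = 0"
      using neg by (subst (asm) integral_nonneg_eq_0_iff_AE) auto
    then show ?thesis
      using x0_gt
    proof eventually_elim
      case (elim \<omega>)
      have "0 < x0 \<omega>" using elim(2) exp_gt_zero[of "1::real"] by linarith
      with elim(2) have "exp 1 < exp (ln (x0 \<omega>))" by simp
      then have "1 < ln (x0 \<omega>)" by (simp only: exp_less_cancel_iff)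
      with elim(1) show ?case by (auto simp: A_def)
    qed
  qed
  then have "AE \<omega> in M. \<forall>n. \<omega> \<notin> A n" by (simp add: AE_all_countable)
  then show ?thesis
    using AE_space
  proof eventually_elim
    case (elim \<omega>)
    obtain n :: nat where "\<bar>ln (x0 \<omega>)\<bar> \<le> real n" using real_arch_simple by blast
    with elim have "\<not> \<alpha> i 0 (s0 \<omega>) < 0" by (auto simp: A_def)
    then show ?case by simp
  qed
qed

definition "level n = {\<omega> \<in> space M. \<bar>ln (x0 \<omega>)\<bar> \<le> real n}"

lemma level_F0: "level n \<in> sets (F 0)"
proof -
  have [measurable]: "x0 \<in> borel_measurable (F 0)" by (rule x0_measurable)
  have "{\<omega> \<in> space (F 0). \<bar>ln (x0 \<omega>)\<bar> \<le> real n} \<in> sets (F 0)" by measurable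
  then show ?thesis by (simp add: level_def)
qed

lemma localized_initial_value:
  assumes i: "i \<in> {1..I}"
    and int: "integrable M (\<lambda>\<omega>. indicat_real A \<omega> * (\<alpha> i 0 (s0 \<omega>) * (ln (x0 \<omega>))\<^sup>2))"
  shows "(\<integral>\<^sup>+\<omega>. indicator A \<omega> * ennreal (\<alpha> i 0 (s0 \<omega>) * (ln (x0 \<omega>))\<^sup>2) \<partial>M)
    = ennreal (expectation (\<lambda>\<omega>. indicat_real A \<omega> * (\<alpha> i 0 (s0 \<omega>) * (ln (x0 \<omega>))\<^sup>2)))"
    and "0 \<le> expectation (\<lambda>\<omega>. indicat_real A \<omega> * (\<alpha> i 0 (s0 \<omega>) * (ln (x0 \<omega>))\<^sup>2))"
proof -
  have nn: "AE \<omega> in M. 0 \<le> indicat_real A \<omega> * (\<alpha> i 0 (s0 \<omega>) * (ln (x0 \<omega>))\<^sup>2)"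
    using \<alpha>_initial_nonneg[OF i] by eventually_elim simp
  have "(\<integral>\<^sup>+\<omega>. indicator A \<omega> * ennreal (\<alpha> i 0 (s0 \<omega>) * (ln (x0 \<omega>))\<^sup>2) \<partial>M)
     = (\<integral>\<^sup>+\<omega>. ennreal (indicat_real A \<omega> * (\<alpha> i 0 (s0 \<omega>) * (ln (x0 \<omega>))\<^sup>2)) \<partial>M)"
    by (intro nn_integral_cong) (auto simp: indicator_def)
  also have "\<dots> = ennreal (expectation (\<lambda>\<omega>. indicat_real A \<omega> * (\<alpha> i 0 (s0 \<omega>) * (ln (x0 \<omega>))\<^sup>2)))"
    using int nn by (rule nn_integral_eq_integral)
  finally show "(\<integral>\<^sup>+\<omega>. indicator A \<omega> * ennreal (\<alpha> i 0 (s0 \<omega>) * (ln (x0 \<omega>))\<^sup>2) \<partial>M)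
    = ennreal (expectation (\<lambda>\<omega>. indicat_real A \<omega> * (\<alpha> i 0 (s0 \<omega>) * (ln (x0 \<omega>))\<^sup>2)))" .
  show "0 \<le> expectation (\<lambda>\<omega>. indicat_real A \<omega> * (\<alpha> i 0 (s0 \<omega>) * (ln (x0 \<omega>))\<^sup>2))"
    using nn by (rule integral_nonneg_AE)
qed

lemma equilibrium_cost:
  assumes law: "\<And>j t x a. j \<in> {1..I} \<Longrightarrow> \<phi> j t x a = - gain j t a * ln x"
    and traj: "trajectory M F T I b1 b2 s x0 (feedback_control \<phi> s x) x"
    and i: "i \<in> {1..I}"
  shows "expected_cost M T (q i) (r i) s x (feedback_control \<phi> s x i)
    = (\<integral>\<^sup>+\<omega>. ennreal (\<alpha> i 0 (s0 \<omega>) * (ln (x0 \<omega>))\<^sup>2) \<partial>M)"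
proof -
  interpret U: unilateral_deviation M F T rate s0 s \<delta> I x0 b1 b2 q r \<alpha> \<phi> i "feedback_control \<phi> s x i" x
    by unfold_locales (use i law traj in auto)
  have eq: "(\<integral>\<^sup>+\<omega>. indicator (level n) \<omega> * U.path_cost \<omega> \<partial>M)
     = (\<integral>\<^sup>+\<omega>. indicator (level n) \<omega> * ennreal (\<alpha> i 0 (s0 \<omega>) * (ln (x0 \<omega>))\<^sup>2) \<partial>M)" for n
  proof -
    interpret localized_deviation M F T rate s0 s \<delta> I x0 b1 b2 q r \<alpha> \<phi> i "feedback_control \<phi> s x i" x "level n" "real n"
      by (rule equilibrium_localized[OF law traj i level_F0]) (simp_all add: level_def)
    have "excess t \<omega> = 0" for t \<omega>
      by (simp add: excess_def U.z_def feedback_control_def law[OF i])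
    then show ?thesis
      using localized_cost localized_initial_value(1)[OF i cost_identity(3)] by (simp add: case_prod_beta')
  qed
  have [measurable]: "x0 \<in> borel_measurable M" using x0_measurable by (rule measurable_F_M)
  have ln: "(\<lambda>\<omega>. ln (x0 \<omega>)) \<in> borel_measurable M" by measurable
  have v: "(\<lambda>\<omega>. ennreal (\<alpha> i 0 (s0 \<omega>) * (ln (x0 \<omega>))\<^sup>2)) \<in> borel_measurable M"
    using initial_value_measurable by simp
  have "(\<integral>\<^sup>+\<omega>. U.path_cost \<omega> \<partial>M) = (\<integral>\<^sup>+\<omega>. ennreal (\<alpha> i 0 (s0 \<omega>) * (ln (x0 \<omega>))\<^sup>2) \<partial>M)"
  proof (rule antisym)
    show "(\<integral>\<^sup>+\<omega>. U.path_cost \<omega> \<partial>M) \<le> (\<integral>\<^sup>+\<omega>. ennreal (\<alpha> i 0 (s0 \<omega>) * (ln (x0 \<omega>))\<^sup>2) \<partial>M)"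
      by (rule nn_integral_le_by_localization[OF ln U.path_cost_measurable])
         (rule eq_refl[OF eq[unfolded level_def]])
    show "(\<integral>\<^sup>+\<omega>. ennreal (\<alpha> i 0 (s0 \<omega>) * (ln (x0 \<omega>))\<^sup>2) \<partial>M) \<le> (\<integral>\<^sup>+\<omega>. U.path_cost \<omega> \<partial>M)"
      by (rule nn_integral_le_by_localization[OF ln v])
         (rule eq_refl[OF eq[symmetric, unfolded level_def]])
  qed
  then show ?thesis by (simp add: U.expected_cost_eq)
qed

text \<open>
  On each event where \<open>\<bar>ln x0\<bar> \<le> n\<close>, either the cost is infinite and there is nothing to prove, or the
  control has finite energy and the cost identity applies with a nonnegative excess.
\<close>

lemma deviation_cost_ge:
  assumes law: "\<And>j t x a. j \<in> {1..I} \<Longrightarrow> \<phi> j t x a = - gain j t a * ln x"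
    and traj: "trajectory M F T I b1 b2 s x0 ((feedback_control \<phi> s y)(i := w)) y"
    and i: "i \<in> {1..I}"
  shows "(\<integral>\<^sup>+\<omega>. ennreal (\<alpha> i 0 (s0 \<omega>) * (ln (x0 \<omega>))\<^sup>2) \<partial>M) \<le> expected_cost M T (q i) (r i) s y w"
proof -
  interpret U: unilateral_deviation M F T rate s0 s \<delta> I x0 b1 b2 q r \<alpha> \<phi> i w y
    by unfold_locales (use i law traj in auto)
  have le: "(\<integral>\<^sup>+\<omega>. indicator (level n) \<omega> * ennreal (\<alpha> i 0 (s0 \<omega>) * (ln (x0 \<omega>))\<^sup>2) \<partial>M)
     \<le> (\<integral>\<^sup>+\<omega>. indicator (level n) \<omega> * U.path_cost \<omega> \<partial>M)" for n
  proof (cases "(\<integral>\<^sup>+\<omega>. indicator (level n) \<omega> * U.path_cost \<omega> \<partial>M) = \<infinity>")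
    case False
    have [measurable]: "level n \<in> sets M" using level_F0 subalg by (auto simp: subalgebra_def)
    let ?e = "\<lambda>p. indicat_real {0..T} (fst p) * (indicat_real (level n) (snd p) * (r i (fst p) (s (fst p) (snd p)) * (w (fst p) (snd p))\<^sup>2))"
    have e_meas: "?e \<in> borel_measurable \<mu>"
      by (rule measurable_extend_interval[OF _ T_nonneg]) measurable
    have e_nn: "0 \<le> ?e p" for p
      using r_pos[OF i, of "fst p"] by (cases "fst p \<in> {0..T}") (auto simp: less_imp_le)
    have "integrable \<mu> ?e"
    proof (rule integrableI_nonneg)
      have "(\<integral>\<^sup>+p. ennreal (?e p) \<partial>\<mu>) = (\<integral>\<^sup>+\<omega>. \<integral>\<^sup>+t. ennreal (?e (t, \<omega>)) \<partial>lborel \<partial>M)"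
        using e_meas by (intro U.prod.nn_integral_snd[symmetric]) simp
      also have "\<dots> \<le> (\<integral>\<^sup>+\<omega>. indicator (level n) \<omega> * U.path_cost \<omega> \<partial>M)"
      proof (rule nn_integral_mono)
        fix \<omega>
        show "(\<integral>\<^sup>+t. ennreal (?e (t, \<omega>)) \<partial>lborel) \<le> indicator (level n) \<omega> * U.path_cost \<omega>"
        proof (cases "\<omega> \<in> level n")
          case True
          have "(\<integral>\<^sup>+t. ennreal (?e (t, \<omega>)) \<partial>lborel)
             \<le> (\<integral>\<^sup>+t\<in>{0..T}. ennreal (q i t (s t \<omega>) * (ln (y t \<omega>))\<^sup>2 + r i t (s t \<omega>) * (w t \<omega>)\<^sup>2) \<partial>lborel)"
            using True q_nonneg[OF i] by (intro nn_integral_mono) (auto simp: indicator_def intro!: ennreal_leI)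
          also have "\<dots> \<le> U.path_cost \<omega>" unfolding U.path_cost_def by simp
          finally show ?thesis using True by simp
        qed simp
      qed
      also have "\<dots> < \<infinity>" using False by (simp add: less_top)
      finally show "(\<integral>\<^sup>+p. ennreal (?e p) \<partial>\<mu>) < \<infinity>" .
    qed (use e_meas e_nn in auto)
    then interpret localized_deviation M F T rate s0 s \<delta> I x0 b1 b2 q r \<alpha> \<phi> i w y "level n" "real n"
      by unfold_locales (simp_all add: level_F0 case_prod_beta', simp add: level_def)
    have "0 \<le> integral\<^sup>L \<mu> (on_horizon excess)"
    proof (rule Bochner_Integration.integral_nonneg)
      fix p :: "real \<times> 'a"
      show "0 \<le> (on_horizon excess p)"
        using r_pos[OF i, of "fst p"] by (cases "fst p \<in> {0..T}") (auto simp: excess_def case_prod_beta' less_imp_le)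
    qed
    then show ?thesis
      unfolding localized_cost localized_initial_value(1)[OF i cost_identity(3)] by (intro ennreal_leI) simp
  qed simp
  have [measurable]: "x0 \<in> borel_measurable M" using x0_measurable by (rule measurable_F_M)
  have ln: "(\<lambda>\<omega>. ln (x0 \<omega>)) \<in> borel_measurable M" by measurable
  have v: "(\<lambda>\<omega>. ennreal (\<alpha> i 0 (s0 \<omega>) * (ln (x0 \<omega>))\<^sup>2)) \<in> borel_measurable M"
    using initial_value_measurable by simp
  show ?thesis
    unfolding U.expected_cost_eq using le unfolding level_def by (rule nn_integral_le_by_localization[OF ln v])
qed

end

section \<open>The Nash equilibrium\<close>

theorem proposition2:
  fixes M :: "'a measure" and F :: "real \<Rightarrow> 'a measure"
    and T \<delta> :: real and I :: nat
    and rate :: "'s::finite \<Rightarrow> 's \<Rightarrow> real"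
    and s0 :: "'a \<Rightarrow> 's" and s :: "real \<Rightarrow> 'a \<Rightarrow> 's" and x0 :: "'a \<Rightarrow> real"
    and b1 :: "real \<Rightarrow> 's \<Rightarrow> real"
    and b2 q r \<alpha> :: "nat \<Rightarrow> real \<Rightarrow> 's \<Rightarrow> real"
    and ustar :: "nat \<Rightarrow> real \<Rightarrow> real \<Rightarrow> 's \<Rightarrow> real"
  assumes "filtered_prob_space M F" and "0 < T"
    and rate_pos: "\<And>a b. a \<noteq> b \<Longrightarrow> 0 < rate a b"
    and rate_diag: "\<And>a. rate a a = - (\<Sum>b\<in>UNIV - {a}. rate a b)"
    and "regime_switching M F T rate s0 s"
    and "x0 \<in> borel_measurable (F 0)" and "AE \<omega> in M. exp 1 < x0 \<omega>"
    and "\<And>a. set_integrable lborel {0..T} (\<lambda>t. b1 t a)"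
    and "\<And>j a. j \<in> {1..I} \<Longrightarrow> set_borel_measurable lborel {0..T} (\<lambda>t. b2 j t a)"
    and "\<And>j a. j \<in> {1..I} \<Longrightarrow> set_integrable lborel {0..T} (\<lambda>t. (b2 j t a)\<^sup>2)"
    and "\<And>i a. i \<in> {1..I} \<Longrightarrow> set_borel_measurable lborel {0..T} (\<lambda>t. q i t a)"
    and "\<And>i a. i \<in> {1..I} \<Longrightarrow> set_borel_measurable lborel {0..T} (\<lambda>t. r i t a)"
    and "\<And>i t a. i \<in> {1..I} \<Longrightarrow> t \<in> {0..T} \<Longrightarrow> 0 \<le> q i t a"
    and "0 < \<delta>" and "\<And>i t a. i \<in> {1..I} \<Longrightarrow> t \<in> {0..T} \<Longrightarrow> \<delta> < r i t a"
    and riccati: "\<And>i t a. i \<in> {1..I} \<Longrightarrow> t \<in> {0..T} \<Longrightarrow>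
      ((\<lambda>t'. \<alpha> i t' a) has_real_derivative
        (- q i t a - 2 * b1 t a * \<alpha> i t a
         + 2 * \<alpha> i t a * (\<Sum>j\<in>{1..I} - {i}. \<alpha> j t a * ((b2 j t a)\<^sup>2 / r j t a))
         + (\<alpha> i t a)\<^sup>2 * ((b2 i t a)\<^sup>2 / r i t a)
         - (\<Sum>b\<in>UNIV. (\<alpha> i t b - \<alpha> i t a) * rate a b))) (at t within {0..T})"
    and terminal: "\<And>i a. i \<in> {1..I} \<Longrightarrow> \<alpha> i T a = q i T a"
    and ustar: "\<And>i t x c. i \<in> {1..I} \<Longrightarrow> ustar i t x c =
      - (\<Sum>a\<in>UNIV. indicat_real {a} c * (\<alpha> i t a * b2 i t a / r i t a) * ln x)"
  shows "feedback_nash M F T I b1 b2 q r s x0 ustar \<and>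
    (\<forall>i\<in>{1..I}. (AE \<omega> in M. 0 \<le> \<alpha> i 0 (s0 \<omega>)) \<and>
       (\<forall>x. trajectory M F T I b1 b2 s x0 (feedback_control ustar s x) x \<longrightarrow>
          expected_cost M T (q i) (r i) s x (feedback_control ustar s x i)
            = (\<integral>\<^sup>+\<omega>. ennreal (\<alpha> i 0 (s0 \<omega>) * (ln (x0 \<omega>))\<^sup>2) \<partial>M)))"
proof -
  interpret log_quadratic_game M F T rate s0 s \<delta> I x0 b1 b2 q r \<alpha>
    by unfold_locales (rule assms; assumption)+
  have law: "ustar j t x a = - gain j t a * ln x" if "j \<in> {1..I}" for j t x a
    by (simp add: ustar[OF that] gain_def indicator_def of_bool_def if_distrib if_distribR sum.delta cong: if_cong)
  show ?thesis
    unfolding feedback_nash_def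
  proof (intro conjI ballI allI impI)
    show "\<exists>x. trajectory M F T I b1 b2 s x0 (feedback_control ustar s x) x"
      using solution_trajectory[OF law] by blast
    fix x i w y
    assume x: "trajectory M F T I b1 b2 s x0 (feedback_control ustar s x) x" and i: "i \<in> {1..I}"
      and y: "trajectory M F T I b1 b2 s x0 ((feedback_control ustar s y)(i := w)) y"
    show "expected_cost M T (q i) (r i) s x (feedback_control ustar s x i) \<le> expected_cost M T (q i) (r i) s y w"
      by (rule ord_eq_le_trans[OF equilibrium_cost[OF law x i] deviation_cost_ge[OF law y i]])
  next
    fix i assume i: "i \<in> {1..I}"
    show "AE \<omega> in M. 0 \<le> \<alpha> i 0 (s0 \<omega>)" by (rule \<alpha>_initial_nonneg[OF i])
    fix x assume x: "trajectory M F T I b1 b2 s x0 (feedback_control ustar s x) x"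
    show "expected_cost M T (q i) (r i) s x (feedback_control ustar s x i)
        = (\<integral>\<^sup>+\<omega>. ennreal (\<alpha> i 0 (s0 \<omega>) * (ln (x0 \<omega>))\<^sup>2) \<partial>M)"
      by (rule equilibrium_cost[OF law x i])
  qed
qed

end
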